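(* For every $n\ge1$ there exists a theory $\mathfrak{T}$ in the language of arithmetic, extending $\textsf{PA}$, whose set of axioms is $\Delta_{n+1}$-definable (definable in $\mathbb{N}$ both by a $\Sigma_{n+1}$-formula and by a $\Pi_{n+1}$-formula), which is $\Sigma_{n-1}$-sound, and which proves its own $\Sigma_{n-1}$-soundness: $\mathfrak{T}\vdash\Sigma_{n-1}\text{-}\textsf{Sound}(\mathfrak{T})$, where the soundness sentence is formed from a $\Sigma_{n+1}$-formula defining the axioms of $\mathfrak{T}$.
   Context: A theory is $\Sigma_{n-1}$-sound if it proves no $\Sigma_{n-1}$-sentence false in $\mathbb{N}$. For a theory $S$ defined by a formula $\textsf{Axiom}_S(x)$ (meaning $\mathbb{N}\models\textsf{Axiom}_S(m)$ iff $m$ codes an axiom of $S$), $\textsf{ConjAx}_S(s)$ says $s$ codes a conjunction of axioms of $S$, $\Pi_{n-1}\text{-}\textsf{True}(t)$ is a formula defining the set of true $\Pi_{n-1}$-sentences, $\textsf{Proof}(u,x)$ is the standard proof relation, and $\Sigma_{n-1}\text{-}\textsf{Sound}(S)$ is the sentence $\forall s,t,u\,[\textsf{ConjAx}_S(s)\wedge\Pi_{n-1}\text{-}\textsf{True}(t)\rightarrow\neg\textsf{Proof}(u,\ulcorner s\wedge t\rightarrow\bot\urcorner)]$. *)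

theory Defs
  imports "HOL-Library.Nat_Bijection" "HOL-Number_Theory.Cong"
begin

section \<open>Syntax and semantics of first-order arithmetic\<close>

datatype tm = Zero | Var nat | Succ tm | Plus tm tm | Times tm tm

datatype fm =
    Bot
  | Equal tm tm  (infix "\<^bold>=" 55)
  | Leq tm tm    (infix "\<^bold>\<le>" 55)
  | Imp fm fm    (infixr "\<^bold>\<rightarrow>" 25)
  | Forall nat fm

abbreviation Neg :: "fm \<Rightarrow> fm"  ("\<^bold>\<not> _" [40] 40)
  where "\<^bold>\<not> \<phi> \<equiv> \<phi> \<^bold>\<rightarrow> Bot"
definition And :: "fm \<Rightarrow> fm \<Rightarrow> fm"  (infixr "\<^bold>\<and>" 35)
  where "(\<phi> \<^bold>\<and> \<psi>) = (\<^bold>\<not> (\<phi> \<^bold>\<rightarrow> \<^bold>\<not> \<psi>))"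
definition Or :: "fm \<Rightarrow> fm \<Rightarrow> fm"  (infixr "\<^bold>\<or>" 30)
  where "(\<phi> \<^bold>\<or> \<psi>) = (\<^bold>\<not> \<phi> \<^bold>\<rightarrow> \<psi>)"
definition Exists :: "nat \<Rightarrow> fm \<Rightarrow> fm"
  where "Exists k \<phi> = (\<^bold>\<not> Forall k (\<^bold>\<not> \<phi>))"

primrec val :: "(nat \<Rightarrow> nat) \<Rightarrow> tm \<Rightarrow> nat" where
  "val e Zero = 0"
| "val e (Var k) = e k"
| "val e (Succ t) = Suc (val e t)"
| "val e (Plus s t) = val e s + val e t"
| "val e (Times s t) = val e s * val e t"

primrec sat :: "(nat \<Rightarrow> nat) \<Rightarrow> fm \<Rightarrow> bool" where
  "sat e Bot \<longleftrightarrow> False"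
| "sat e (s \<^bold>= t) \<longleftrightarrow> val e s = val e t"
| "sat e (s \<^bold>\<le> t) \<longleftrightarrow> val e s \<le> val e t"
| "sat e (\<phi> \<^bold>\<rightarrow> \<psi>) \<longleftrightarrow> (sat e \<phi> \<longrightarrow> sat e \<psi>)"
| "sat e (Forall k \<phi>) \<longleftrightarrow> (\<forall>m. sat (e(k := m)) \<phi>)"

definition true_in_N :: "fm \<Rightarrow> bool"  ("\<nat> \<Turnstile> _" [20] 20)
  where "(\<nat> \<Turnstile> \<phi>) \<longleftrightarrow> (\<forall>e. sat e \<phi>)"

primrec fvt :: "tm \<Rightarrow> nat set" where
  "fvt Zero = {}"
| "fvt (Var k) = {k}"
| "fvt (Succ t) = fvt t"
| "fvt (Plus s t) = fvt s \<union> fvt t"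
| "fvt (Times s t) = fvt s \<union> fvt t"

primrec fv :: "fm \<Rightarrow> nat set" where
  "fv Bot = {}"
| "fv (s \<^bold>= t) = fvt s \<union> fvt t"
| "fv (s \<^bold>\<le> t) = fvt s \<union> fvt t"
| "fv (\<phi> \<^bold>\<rightarrow> \<psi>) = fv \<phi> \<union> fv \<psi>"
| "fv (Forall k \<phi>) = fv \<phi> - {k}"

definition sentence :: "fm \<Rightarrow> bool"
  where "sentence \<phi> \<longleftrightarrow> fv \<phi> = {}"

primrec substt :: "nat \<Rightarrow> tm \<Rightarrow> tm \<Rightarrow> tm" where
  "substt k t Zero = Zero"
| "substt k t (Var j) = (if j = k then t else Var j)"
| "substt k t (Succ s) = Succ (substt k t s)"
| "substt k t (Plus s u) = Plus (substt k t s) (substt k t u)"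
| "substt k t (Times s u) = Times (substt k t s) (substt k t u)"

primrec subst :: "nat \<Rightarrow> tm \<Rightarrow> fm \<Rightarrow> fm" where
  "subst k t Bot = Bot"
| "subst k t (s \<^bold>= u) = (substt k t s \<^bold>= substt k t u)"
| "subst k t (s \<^bold>\<le> u) = (substt k t s \<^bold>\<le> substt k t u)"
| "subst k t (\<phi> \<^bold>\<rightarrow> \<psi>) = (subst k t \<phi> \<^bold>\<rightarrow> subst k t \<psi>)"
| "subst k t (Forall j \<phi>) = (if j = k then Forall j \<phi> else Forall j (subst k t \<phi>))"

text \<open>Slightly stricter than the usual notion: a quantifier that binds a variable of the term is
  not tolerated even if no free occurrence of the substituted variable lies in its scope. The
  calculus below remains complete, because bound variables can be renamed.\<close>

primrec free_for :: "tm \<Rightarrow> nat \<Rightarrow> fm \<Rightarrow> bool" where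
  "free_for t k Bot \<longleftrightarrow> True"
| "free_for t k (s \<^bold>= u) \<longleftrightarrow> True"
| "free_for t k (s \<^bold>\<le> u) \<longleftrightarrow> True"
| "free_for t k (\<phi> \<^bold>\<rightarrow> \<psi>) \<longleftrightarrow> free_for t k \<phi> \<and> free_for t k \<psi>"
| "free_for t k (Forall j \<phi>) \<longleftrightarrow> j = k \<or> (j \<notin> fvt t \<and> free_for t k \<phi>)"

section \<open>Proofs and theories\<close>

inductive logical_axiom :: "fm \<Rightarrow> bool" where
  "logical_axiom (\<phi> \<^bold>\<rightarrow> \<psi> \<^bold>\<rightarrow> \<phi>)"
| "logical_axiom ((\<phi> \<^bold>\<rightarrow> \<psi> \<^bold>\<rightarrow> \<chi>) \<^bold>\<rightarrow> (\<phi> \<^bold>\<rightarrow> \<psi>) \<^bold>\<rightarrow> \<phi> \<^bold>\<rightarrow> \<chi>)"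
| "logical_axiom (\<^bold>\<not> (\<^bold>\<not> \<phi>) \<^bold>\<rightarrow> \<phi>)"
| "free_for t k \<phi> \<Longrightarrow> logical_axiom (Forall k \<phi> \<^bold>\<rightarrow> subst k t \<phi>)"
| "k \<notin> fv \<phi> \<Longrightarrow> logical_axiom (Forall k (\<phi> \<^bold>\<rightarrow> \<psi>) \<^bold>\<rightarrow> \<phi> \<^bold>\<rightarrow> Forall k \<psi>)"
| "logical_axiom (t \<^bold>= t)"
| "free_for s k \<phi> \<Longrightarrow> free_for t k \<phi> \<Longrightarrow>
     logical_axiom (s \<^bold>= t \<^bold>\<rightarrow> subst k s \<phi> \<^bold>\<rightarrow> subst k t \<phi>)"

definition is_proof :: "fm set \<Rightarrow> fm list \<Rightarrow> bool" where
  "is_proof T ps \<longleftrightarrow> (\<forall>i<length ps.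
       ps ! i \<in> T \<or> logical_axiom (ps ! i)
     \<or> (\<exists>\<phi>. \<phi> \<in> set (take i ps) \<and> (\<phi> \<^bold>\<rightarrow> ps ! i) \<in> set (take i ps))
     \<or> (\<exists>k \<phi>. \<phi> \<in> set (take i ps) \<and> ps ! i = Forall k \<phi>))"

definition proves :: "fm set \<Rightarrow> fm \<Rightarrow> bool"  (infix "\<turnstile>" 50) where
  "T \<turnstile> \<phi> \<longleftrightarrow> (\<exists>ps. ps \<noteq> [] \<and> is_proof T ps \<and> last ps = \<phi>)"

definition is_theory :: "fm set \<Rightarrow> bool"
  where "is_theory T \<longleftrightarrow> (\<forall>\<phi>\<in>T. sentence \<phi>)"

definition extends :: "fm set \<Rightarrow> fm set \<Rightarrow> bool"
  where "extends T S \<longleftrightarrow> (\<forall>\<phi>. S \<turnstile> \<phi> \<longrightarrow> T \<turnstile> \<phi>)"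

definition induction_fm :: "nat \<Rightarrow> fm \<Rightarrow> fm" where
  "induction_fm k \<phi> =
     (subst k Zero \<phi> \<^bold>\<rightarrow> Forall k (\<phi> \<^bold>\<rightarrow> subst k (Succ (Var k)) \<phi>) \<^bold>\<rightarrow> Forall k \<phi>)"

inductive_set PA :: "fm set" where
  "Forall 0 (\<^bold>\<not> (Succ (Var 0) \<^bold>= Zero)) \<in> PA"
| "Forall 0 (Forall 1 (Succ (Var 0) \<^bold>= Succ (Var 1) \<^bold>\<rightarrow> Var 0 \<^bold>= Var 1)) \<in> PA"
| "Forall 0 (Plus (Var 0) Zero \<^bold>= Var 0) \<in> PA"
| "Forall 0 (Forall 1 (Plus (Var 0) (Succ (Var 1)) \<^bold>= Succ (Plus (Var 0) (Var 1)))) \<in> PA"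
| "Forall 0 (Times (Var 0) Zero \<^bold>= Zero) \<in> PA"
| "Forall 0 (Forall 1 (Times (Var 0) (Succ (Var 1)) \<^bold>= Plus (Times (Var 0) (Var 1)) (Var 0))) \<in> PA"
| "Forall 0 (Forall 1 (Var 0 \<^bold>\<le> Var 1 \<^bold>\<rightarrow> Exists 2 (Plus (Var 2) (Var 0) \<^bold>= Var 1))) \<in> PA"
| "Forall 0 (Forall 1 (Exists 2 (Plus (Var 2) (Var 0) \<^bold>= Var 1) \<^bold>\<rightarrow> Var 0 \<^bold>\<le> Var 1)) \<in> PA"
| "sentence (foldr Forall ks (induction_fm k \<phi>)) \<Longrightarrow> foldr Forall ks (induction_fm k \<phi>) \<in> PA"

section \<open>The arithmetical hierarchy\<close>

inductive is_Delta0 :: "fm \<Rightarrow> bool" where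
  "is_Delta0 Bot"
| "is_Delta0 (s \<^bold>= t)"
| "is_Delta0 (s \<^bold>\<le> t)"
| "is_Delta0 \<phi> \<Longrightarrow> is_Delta0 \<psi> \<Longrightarrow> is_Delta0 (\<phi> \<^bold>\<rightarrow> \<psi>)"
| "is_Delta0 \<phi> \<Longrightarrow> k \<notin> fvt t \<Longrightarrow> is_Delta0 (Forall k (Var k \<^bold>\<le> t \<^bold>\<rightarrow> \<phi>))"

inductive is_Sigma :: "nat \<Rightarrow> fm \<Rightarrow> bool" and is_Pi :: "nat \<Rightarrow> fm \<Rightarrow> bool" where
  "is_Delta0 \<phi> \<Longrightarrow> is_Sigma 0 \<phi>"
| "is_Delta0 \<phi> \<Longrightarrow> is_Pi 0 \<phi>"
| "is_Pi n \<phi> \<Longrightarrow> is_Sigma (Suc n) \<phi>"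
| "is_Sigma (Suc n) \<phi> \<Longrightarrow> is_Sigma (Suc n) (Exists k \<phi>)"
| "is_Sigma n \<phi> \<Longrightarrow> is_Pi (Suc n) \<phi>"
| "is_Pi (Suc n) \<phi> \<Longrightarrow> is_Pi (Suc n) (Forall k \<phi>)"

definition Sigma_sound :: "nat \<Rightarrow> fm set \<Rightarrow> bool" where
  "Sigma_sound n T \<longleftrightarrow> (\<forall>\<phi>. sentence \<phi> \<and> is_Sigma n \<phi> \<and> T \<turnstile> \<phi> \<longrightarrow> (\<nat> \<Turnstile> \<phi>))"

section \<open>Goedel numbering\<close>

text \<open>Both codings are bijections onto the natural numbers, so no arithmetized recognition of codes
  of terms and of formulas is needed.\<close>

primrec tcode :: "tm \<Rightarrow> nat" where
  "tcode Zero = 0"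
| "tcode (Var k) = 4 * k + 1"
| "tcode (Succ t) = 4 * tcode t + 2"
| "tcode (Plus s t) = 4 * prod_encode (tcode s, tcode t) + 3"
| "tcode (Times s t) = 4 * prod_encode (tcode s, tcode t) + 4"

primrec fcode :: "fm \<Rightarrow> nat" where
  "fcode Bot = 0"
| "fcode (s \<^bold>= t) = 4 * prod_encode (tcode s, tcode t) + 1"
| "fcode (s \<^bold>\<le> t) = 4 * prod_encode (tcode s, tcode t) + 2"
| "fcode (\<phi> \<^bold>\<rightarrow> \<psi>) = 4 * prod_encode (fcode \<phi>, fcode \<psi>) + 3"
| "fcode (Forall k \<phi>) = 4 * prod_encode (k, fcode \<phi>) + 4"

definition defines_axioms :: "fm \<Rightarrow> fm set \<Rightarrow> bool" where
  "defines_axioms \<sigma> T \<longleftrightarrow> fv \<sigma> \<subseteq> {0} \<and> (\<forall>e m. sat (e(0 := m)) \<sigma> \<longleftrightarrow> m \<in> fcode ` T)"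

definition beta :: "nat \<Rightarrow> nat \<Rightarrow> nat \<Rightarrow> nat" where
  "beta a b i = a mod Suc (Suc i * b)"

text \<open>A proof \<open>ps\<close> is coded by a number \<open>\<langle>a, \<langle>b, l\<rangle>\<rangle>\<close> such that
  \<open>l + 1\<close> is its length and \<open>beta a b i\<close> is the code of its \<open>i\<close>-th formula.\<close>

definition codes_proof :: "nat \<Rightarrow> fm list \<Rightarrow> bool" where
  "codes_proof u ps \<longleftrightarrow> (\<exists>a b l. u = prod_encode (a, prod_encode (b, l)) \<and>
     map fcode ps = map (beta a b) [0..<Suc l])"

inductive conjunction_of :: "fm set \<Rightarrow> fm \<Rightarrow> bool" for T :: "fm set" where
  "\<phi> \<in> T \<Longrightarrow> conjunction_of T \<phi>"
| "conjunction_of T \<phi> \<Longrightarrow> conjunction_of T \<psi> \<Longrightarrow> conjunction_of T (\<phi> \<^bold>\<and> \<psi>)"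

section \<open>Arithmetization\<close>

text \<open>The formula builders below take the index \<open>d\<close> of the next unused variable: all variables of
  the argument terms have index below \<open>d\<close>, and all variables bound by the builder have index at
  least \<open>d\<close>. The body of a quantifier receives the new value of \<open>d\<close> and the bound variable.\<close>

type_synonym body = "nat \<Rightarrow> tm \<Rightarrow> fm"

definition ex :: "nat \<Rightarrow> body \<Rightarrow> fm"
  where "ex d F = Exists d (F (Suc d) (Var d))"

definition exb :: "nat \<Rightarrow> tm \<Rightarrow> body \<Rightarrow> fm"
  where "exb d t F = Exists d (Var d \<^bold>\<le> t \<^bold>\<and> F (Suc d) (Var d))"

definition allb :: "nat \<Rightarrow> tm \<Rightarrow> body \<Rightarrow> fm"
  where "allb d t F = Forall d (Var d \<^bold>\<le> t \<^bold>\<rightarrow> F (Suc d) (Var d))"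

primrec numeral_tm :: "nat \<Rightarrow> tm" where
  "numeral_tm 0 = Zero"
| "numeral_tm (Suc n) = Succ (numeral_tm n)"

text \<open>\<open>z = prod_encode (x, y)\<close>, that is, \<open>2z = (x + y)(x + y + 1) + 2x\<close>.\<close>

definition pair_fm :: "tm \<Rightarrow> tm \<Rightarrow> tm \<Rightarrow> fm" where
  "pair_fm x y z = (Plus z z \<^bold>= Plus (Times (Plus x y) (Succ (Plus x y))) (Plus x x))"

text \<open>\<open>node r d x y F\<close> says \<open>F\<close> of the number \<open>4 * prod_encode (x, y) + r\<close>. In \<open>imp_code d x y F\<close>
  and its relatives, \<open>F\<close> thus speaks about the code of the implication etc.\ of the objects coded
  by \<open>x\<close> and \<open>y\<close>.\<close>

definition tag :: "nat \<Rightarrow> tm \<Rightarrow> tm"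
  where "tag r x = Plus (Times (numeral_tm 4) x) (numeral_tm r)"

definition node :: "nat \<Rightarrow> nat \<Rightarrow> tm \<Rightarrow> tm \<Rightarrow> body \<Rightarrow> fm"
  where "node r d x y F = ex d (\<lambda>d c. pair_fm x y c \<^bold>\<and> F d (tag r c))"

abbreviation "var_code \<equiv> tag 1"
abbreviation "succ_code \<equiv> tag 2"
abbreviation "plus_code \<equiv> node 3"
abbreviation "times_code \<equiv> node 4"
abbreviation "eq_code \<equiv> node 1"
abbreviation "leq_code \<equiv> node 2"
abbreviation "imp_code \<equiv> node 3"
abbreviation "all_code \<equiv> node 4"

definition neg_code :: "nat \<Rightarrow> tm \<Rightarrow> body \<Rightarrow> fm"
  where "neg_code d x F = imp_code d x Zero F"

definition and_code :: "nat \<Rightarrow> tm \<Rightarrow> tm \<Rightarrow> body \<Rightarrow> fm" where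
  "and_code d x y F = neg_code d y (\<lambda>d z. imp_code d x z (\<lambda>d z. neg_code d z F))"

definition ex_code :: "nat \<Rightarrow> tm \<Rightarrow> tm \<Rightarrow> body \<Rightarrow> fm" where
  "ex_code d k x F = neg_code d x (\<lambda>d z. all_code d k z (\<lambda>d z. neg_code d z F))"

definition beta_fm :: "nat \<Rightarrow> tm \<Rightarrow> tm \<Rightarrow> tm \<Rightarrow> tm \<Rightarrow> fm" where
  "beta_fm d a b i y =
     (let m = Succ (Times (Succ i) b)
      in Succ y \<^bold>\<le> m \<^bold>\<and> ex d (\<lambda>d q. a \<^bold>= Plus (Times q m) y))"

text \<open>\<open>derivation d a b l R\<close>: every entry \<open>y\<close> of the sequence \<open>beta a b 0, \<dots>, beta a b l\<close> satisfies
  \<open>R d y prev\<close>, where \<open>prev d z\<close> says that \<open>z\<close> is an earlier entry. Accordingly, \<open>gen d R x\<close> says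
  that \<open>x\<close> belongs to the set that is inductively generated by the rule \<open>R\<close>, and \<open>gen2\<close> is the
  analogue for binary relations.\<close>

type_synonym rule = "nat \<Rightarrow> tm \<Rightarrow> body \<Rightarrow> fm"
type_synonym rule2 = "nat \<Rightarrow> tm \<Rightarrow> tm \<Rightarrow> (nat \<Rightarrow> tm \<Rightarrow> tm \<Rightarrow> fm) \<Rightarrow> fm"

definition derivation :: "nat \<Rightarrow> tm \<Rightarrow> tm \<Rightarrow> tm \<Rightarrow> rule \<Rightarrow> fm" where
  "derivation d a b l R =
     allb d l (\<lambda>d i. ex d (\<lambda>d y. beta_fm d a b i y \<^bold>\<and>
       R d y (\<lambda>d z. exb d i (\<lambda>d j. Succ j \<^bold>\<le> i \<^bold>\<and> beta_fm d a b j z))))"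

definition gen :: "nat \<Rightarrow> rule \<Rightarrow> tm \<Rightarrow> fm" where
  "gen d R x = ex d (\<lambda>d a. ex d (\<lambda>d b. ex d (\<lambda>d l.
     beta_fm d a b l x \<^bold>\<and> derivation d a b l R)))"

definition gen2 :: "nat \<Rightarrow> rule2 \<Rightarrow> tm \<Rightarrow> tm \<Rightarrow> fm" where
  "gen2 d R x y = ex d (\<lambda>d w. pair_fm x y w \<^bold>\<and>
     gen d (\<lambda>d w prev. ex d (\<lambda>d x. ex d (\<lambda>d y. pair_fm x y w \<^bold>\<and>
       R d x y (\<lambda>d x' y'. ex d (\<lambda>d w'. pair_fm x' y' w' \<^bold>\<and> prev d w'))))) w)"

text \<open>\<open>y\<close> codes the result of substituting the term \<open>t\<close> for the variable \<open>k\<close> in the term \<open>x\<close>.\<close>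

definition substt_fm :: "nat \<Rightarrow> tm \<Rightarrow> tm \<Rightarrow> tm \<Rightarrow> tm \<Rightarrow> fm" where
  "substt_fm d k t = gen2 d (\<lambda>d x y prev.
       (x \<^bold>= Zero \<^bold>\<and> y \<^bold>= Zero)
     \<^bold>\<or> (x \<^bold>= var_code k \<^bold>\<and> y \<^bold>= t)
     \<^bold>\<or> ex d (\<lambda>d j. \<^bold>\<not> (j \<^bold>= k) \<^bold>\<and> x \<^bold>= var_code j \<^bold>\<and> y \<^bold>= x)
     \<^bold>\<or> ex d (\<lambda>d u. ex d (\<lambda>d u'. x \<^bold>= succ_code u \<^bold>\<and> y \<^bold>= succ_code u' \<^bold>\<and> prev d u u'))
     \<^bold>\<or> ex d (\<lambda>d u. ex d (\<lambda>d u'. ex d (\<lambda>d v. ex d (\<lambda>d v'.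
         prev d u u' \<^bold>\<and> prev d v v' \<^bold>\<and>
         (  (plus_code d u v (\<lambda>d z. x \<^bold>= z) \<^bold>\<and> plus_code d u' v' (\<lambda>d z. y \<^bold>= z))
          \<^bold>\<or> (times_code d u v (\<lambda>d z. x \<^bold>= z) \<^bold>\<and> times_code d u' v' (\<lambda>d z. y \<^bold>= z))))))))"

text \<open>A variable is not free in a term or formula iff replacing it by \<open>0\<close> changes nothing.\<close>

definition not_free_tm_fm :: "nat \<Rightarrow> tm \<Rightarrow> tm \<Rightarrow> fm"
  where "not_free_tm_fm d k x = substt_fm d k Zero x x"

text \<open>\<open>t\<close> is free for \<open>k\<close> in the formula \<open>x\<close>, and \<open>y\<close> codes the result of the substitution.\<close>

definition subst_fm :: "nat \<Rightarrow> tm \<Rightarrow> tm \<Rightarrow> tm \<Rightarrow> tm \<Rightarrow> fm" where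
  "subst_fm d k t = gen2 d (\<lambda>d x y prev.
       (x \<^bold>= Zero \<^bold>\<and> y \<^bold>= Zero)
     \<^bold>\<or> ex d (\<lambda>d u. ex d (\<lambda>d u'. ex d (\<lambda>d v. ex d (\<lambda>d v'.
         substt_fm d k t u u' \<^bold>\<and> substt_fm d k t v v' \<^bold>\<and>
         (  (eq_code d u v (\<lambda>d z. x \<^bold>= z) \<^bold>\<and> eq_code d u' v' (\<lambda>d z. y \<^bold>= z))
          \<^bold>\<or> (leq_code d u v (\<lambda>d z. x \<^bold>= z) \<^bold>\<and> leq_code d u' v' (\<lambda>d z. y \<^bold>= z)))))))
     \<^bold>\<or> ex d (\<lambda>d u. ex d (\<lambda>d u'. ex d (\<lambda>d v. ex d (\<lambda>d v'.
         prev d u u' \<^bold>\<and> prev d v v' \<^bold>\<and>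
         imp_code d u v (\<lambda>d z. x \<^bold>= z) \<^bold>\<and> imp_code d u' v' (\<lambda>d z. y \<^bold>= z)))))
     \<^bold>\<or> ex d (\<lambda>d u. all_code d k u (\<lambda>d z. x \<^bold>= z) \<^bold>\<and> y \<^bold>= x)
     \<^bold>\<or> ex d (\<lambda>d j. ex d (\<lambda>d u. ex d (\<lambda>d u'.
         \<^bold>\<not> (j \<^bold>= k) \<^bold>\<and> not_free_tm_fm d j t \<^bold>\<and> prev d u u' \<^bold>\<and>
         all_code d j u (\<lambda>d z. x \<^bold>= z) \<^bold>\<and> all_code d j u' (\<lambda>d z. y \<^bold>= z)))))"

definition not_free_fm :: "nat \<Rightarrow> tm \<Rightarrow> tm \<Rightarrow> fm"
  where "not_free_fm d k x = subst_fm d k Zero x x"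

text \<open>The index of a variable that occurs in a formula is bounded by the code of the formula.\<close>

definition sentence_fm :: "nat \<Rightarrow> tm \<Rightarrow> fm"
  where "sentence_fm d x = allb d x (\<lambda>d k. not_free_fm d k x)"

definition logical_axiom_fm :: "nat \<Rightarrow> tm \<Rightarrow> fm" where
  "logical_axiom_fm d x =
     (  ex d (\<lambda>d p. ex d (\<lambda>d q.
          imp_code d q p (\<lambda>d z. imp_code d p z (\<lambda>d z. x \<^bold>= z))))
      \<^bold>\<or> ex d (\<lambda>d p. ex d (\<lambda>d q. ex d (\<lambda>d r.
          imp_code d q r (\<lambda>d qr. imp_code d p qr (\<lambda>d pqr.
          imp_code d p q (\<lambda>d pq. imp_code d p r (\<lambda>d pr.
          imp_code d pq pr (\<lambda>d z. imp_code d pqr z (\<lambda>d z. x \<^bold>= z)))))))))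
      \<^bold>\<or> ex d (\<lambda>d p.
          neg_code d p (\<lambda>d z. neg_code d z (\<lambda>d z. imp_code d z p (\<lambda>d z. x \<^bold>= z))))
      \<^bold>\<or> ex d (\<lambda>d k. ex d (\<lambda>d t. ex d (\<lambda>d p. ex d (\<lambda>d q.
          subst_fm d k t p q \<^bold>\<and>
          all_code d k p (\<lambda>d z. imp_code d z q (\<lambda>d z. x \<^bold>= z))))))
      \<^bold>\<or> ex d (\<lambda>d k. ex d (\<lambda>d p. ex d (\<lambda>d q.
          not_free_fm d k p \<^bold>\<and>
          imp_code d p q (\<lambda>d pq. all_code d k pq (\<lambda>d apq.
          all_code d k q (\<lambda>d aq. imp_code d p aq (\<lambda>d z.
          imp_code d apq z (\<lambda>d z. x \<^bold>= z))))))))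
      \<^bold>\<or> ex d (\<lambda>d t. eq_code d t t (\<lambda>d z. x \<^bold>= z))
      \<^bold>\<or> ex d (\<lambda>d k. ex d (\<lambda>d s. ex d (\<lambda>d t. ex d (\<lambda>d p. ex d (\<lambda>d q. ex d (\<lambda>d r.
          subst_fm d k s p q \<^bold>\<and> subst_fm d k t p r \<^bold>\<and>
          eq_code d s t (\<lambda>d st. imp_code d q r (\<lambda>d qr.
          imp_code d st qr (\<lambda>d z. x \<^bold>= z))))))))))"

text \<open>\<open>u\<close> codes a proof in pure logic (no non-logical axioms) of the formula coded by \<open>x\<close>.\<close>

definition Proof_fm :: "nat \<Rightarrow> tm \<Rightarrow> tm \<Rightarrow> fm" where
  "Proof_fm d u x =
     ex d (\<lambda>d a. ex d (\<lambda>d b. ex d (\<lambda>d l. ex d (\<lambda>d c.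
       pair_fm b l c \<^bold>\<and> pair_fm a c u \<^bold>\<and> beta_fm d a b l x \<^bold>\<and>
       derivation d a b l (\<lambda>d y prev.
           logical_axiom_fm d y
         \<^bold>\<or> ex d (\<lambda>d p. prev d p \<^bold>\<and> imp_code d p y (\<lambda>d z. prev d z))
         \<^bold>\<or> ex d (\<lambda>d k. ex d (\<lambda>d p. prev d p \<^bold>\<and> all_code d k p (\<lambda>d z. y \<^bold>= z))))))))"

text \<open>\<open>holds_at \<sigma> t\<close> expresses \<open>\<sigma>(t)\<close> for a formula \<open>\<sigma>\<close> with the free variable \<open>0\<close> and a term \<open>t\<close>
  in which this variable does not occur; no renaming of bound variables is needed.\<close>

definition holds_at :: "fm \<Rightarrow> tm \<Rightarrow> fm"
  where "holds_at \<sigma> t = Forall 0 (Var 0 \<^bold>= t \<^bold>\<rightarrow> \<sigma>)"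

definition ConjAx_fm :: "fm \<Rightarrow> nat \<Rightarrow> tm \<Rightarrow> fm" where
  "ConjAx_fm \<sigma> d s = gen d (\<lambda>d x prev.
       holds_at \<sigma> x
     \<^bold>\<or> ex d (\<lambda>d p. ex d (\<lambda>d q. prev d p \<^bold>\<and> prev d q \<^bold>\<and> and_code d p q (\<lambda>d z. x \<^bold>= z)))) s"

subsection \<open>Truth for sentences of bounded complexity\<close>

text \<open>\<open>c\<close> codes the numeral of \<open>m\<close>.\<close>

definition numeral_fm :: "nat \<Rightarrow> tm \<Rightarrow> tm \<Rightarrow> fm" where
  "numeral_fm d = gen2 d (\<lambda>d m c prev.
       (m \<^bold>= Zero \<^bold>\<and> c \<^bold>= Zero)
     \<^bold>\<or> ex d (\<lambda>d m'. ex d (\<lambda>d c'. m \<^bold>= Succ m' \<^bold>\<and> c \<^bold>= succ_code c' \<^bold>\<and> prev d m' c')))"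

text \<open>\<open>x\<close> codes a closed term of value \<open>m\<close>.\<close>

definition value_fm :: "nat \<Rightarrow> tm \<Rightarrow> tm \<Rightarrow> fm" where
  "value_fm d = gen2 d (\<lambda>d x m prev.
       (x \<^bold>= Zero \<^bold>\<and> m \<^bold>= Zero)
     \<^bold>\<or> ex d (\<lambda>d u. ex d (\<lambda>d i. x \<^bold>= succ_code u \<^bold>\<and> m \<^bold>= Succ i \<^bold>\<and> prev d u i))
     \<^bold>\<or> ex d (\<lambda>d u. ex d (\<lambda>d i. ex d (\<lambda>d v. ex d (\<lambda>d j.
         prev d u i \<^bold>\<and> prev d v j \<^bold>\<and>
         (  (plus_code d u v (\<lambda>d z. x \<^bold>= z) \<^bold>\<and> m \<^bold>= Plus i j)
          \<^bold>\<or> (times_code d u v (\<lambda>d z. x \<^bold>= z) \<^bold>\<and> m \<^bold>= Times i j)))))))"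

text \<open>\<open>F\<close> holds of the code of the instance of \<open>p\<close> in which the variable \<open>k\<close> is replaced by the
  numeral of \<open>m\<close>.\<close>

definition instance_fm :: "nat \<Rightarrow> tm \<Rightarrow> tm \<Rightarrow> tm \<Rightarrow> body \<Rightarrow> fm" where
  "instance_fm d k m p F = ex d (\<lambda>d c. numeral_fm d m c \<^bold>\<and> ex d (\<lambda>d q. subst_fm d k c p q \<^bold>\<and> F d q))"

text \<open>\<open>x\<close> codes a \<open>\<Delta>\<^sub>0\<close>-sentence whose truth value is \<open>b\<close> (\<open>0\<close> or \<open>1\<close>).\<close>

definition Delta0_value_fm :: "nat \<Rightarrow> tm \<Rightarrow> tm \<Rightarrow> fm" where
  "Delta0_value_fm d = gen2 d (\<lambda>d x b prev.
       (x \<^bold>= Zero \<^bold>\<and> b \<^bold>= Zero)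
     \<^bold>\<or> ex d (\<lambda>d s. ex d (\<lambda>d m. ex d (\<lambda>d t. ex d (\<lambda>d n.
         value_fm d s m \<^bold>\<and> value_fm d t n \<^bold>\<and>
         (  (eq_code d s t (\<lambda>d z. x \<^bold>= z) \<^bold>\<and>
             (m \<^bold>= n \<^bold>\<and> b \<^bold>= numeral_tm 1 \<^bold>\<or> \<^bold>\<not> (m \<^bold>= n) \<^bold>\<and> b \<^bold>= Zero))
          \<^bold>\<or> (leq_code d s t (\<lambda>d z. x \<^bold>= z) \<^bold>\<and>
             (m \<^bold>\<le> n \<^bold>\<and> b \<^bold>= numeral_tm 1 \<^bold>\<or> \<^bold>\<not> (m \<^bold>\<le> n) \<^bold>\<and> b \<^bold>= Zero)))))))
     \<^bold>\<or> ex d (\<lambda>d p. ex d (\<lambda>d i. ex d (\<lambda>d q. ex d (\<lambda>d j.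
         prev d p i \<^bold>\<and> prev d q j \<^bold>\<and> imp_code d p q (\<lambda>d z. x \<^bold>= z) \<^bold>\<and>
         (i \<^bold>\<le> j \<^bold>\<and> b \<^bold>= numeral_tm 1 \<^bold>\<or> \<^bold>\<not> (i \<^bold>\<le> j) \<^bold>\<and> b \<^bold>= Zero)))))
     \<^bold>\<or> ex d (\<lambda>d k. ex d (\<lambda>d t. ex d (\<lambda>d n. ex d (\<lambda>d p.
         not_free_tm_fm d k t \<^bold>\<and> value_fm d t n \<^bold>\<and>
         leq_code d (var_code k) t (\<lambda>d z. imp_code d z p (\<lambda>d z. all_code d k z (\<lambda>d z. x \<^bold>= z))) \<^bold>\<and>
         (  (allb d n (\<lambda>d m. instance_fm d k m p (\<lambda>d q. prev d q (numeral_tm 1)))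
              \<^bold>\<and> b \<^bold>= numeral_tm 1)
          \<^bold>\<or> (allb d n (\<lambda>d m. instance_fm d k m p (\<lambda>d q.
                prev d q Zero \<^bold>\<or> prev d q (numeral_tm 1)))
              \<^bold>\<and> exb d n (\<lambda>d m. instance_fm d k m p (\<lambda>d q. prev d q Zero))
              \<^bold>\<and> b \<^bold>= Zero)))))))"

definition is_Delta0_fm :: "nat \<Rightarrow> tm \<Rightarrow> fm" where
  "is_Delta0_fm d = gen d (\<lambda>d x prev.
       x \<^bold>= Zero
     \<^bold>\<or> ex d (\<lambda>d s. ex d (\<lambda>d t. eq_code d s t (\<lambda>d z. x \<^bold>= z) \<^bold>\<or> leq_code d s t (\<lambda>d z. x \<^bold>= z)))
     \<^bold>\<or> ex d (\<lambda>d p. ex d (\<lambda>d q. prev d p \<^bold>\<and> prev d q \<^bold>\<and> imp_code d p q (\<lambda>d z. x \<^bold>= z)))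
     \<^bold>\<or> ex d (\<lambda>d k. ex d (\<lambda>d t. ex d (\<lambda>d p.
         not_free_tm_fm d k t \<^bold>\<and> prev d p \<^bold>\<and>
         leq_code d (var_code k) t (\<lambda>d z. imp_code d z p (\<lambda>d z. all_code d k z (\<lambda>d z. x \<^bold>= z)))))))"

fun is_Sigma_fm :: "nat \<Rightarrow> nat \<Rightarrow> tm \<Rightarrow> fm" and is_Pi_fm :: "nat \<Rightarrow> nat \<Rightarrow> tm \<Rightarrow> fm" where
  "is_Sigma_fm 0 d x = is_Delta0_fm d x"
| "is_Pi_fm 0 d x = is_Delta0_fm d x"
| "is_Sigma_fm (Suc n) d x = gen d (\<lambda>d x prev.
       is_Pi_fm n d x
     \<^bold>\<or> ex d (\<lambda>d k. ex d (\<lambda>d p. prev d p \<^bold>\<and> ex_code d k p (\<lambda>d z. x \<^bold>= z)))) x"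
| "is_Pi_fm (Suc n) d x = gen d (\<lambda>d x prev.
       is_Sigma_fm n d x
     \<^bold>\<or> ex d (\<lambda>d k. ex d (\<lambda>d p. prev d p \<^bold>\<and> all_code d k p (\<lambda>d z. x \<^bold>= z)))) x"

text \<open>Truth of \<open>\<Sigma>\<^sub>n\<close>-sentences and falsity of \<open>\<Pi>\<^sub>n\<close>-sentences are generated from
  instances; the other two notions are obtained by complementation.\<close>

fun Sigma_True_fm :: "nat \<Rightarrow> nat \<Rightarrow> tm \<Rightarrow> fm"
  and Sigma_False_fm :: "nat \<Rightarrow> nat \<Rightarrow> tm \<Rightarrow> fm"
  and Pi_True_fm :: "nat \<Rightarrow> nat \<Rightarrow> tm \<Rightarrow> fm"
  and Pi_False_fm :: "nat \<Rightarrow> nat \<Rightarrow> tm \<Rightarrow> fm" where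
  "Sigma_True_fm 0 d x = Delta0_value_fm d x (numeral_tm 1)"
| "Sigma_False_fm 0 d x = Delta0_value_fm d x Zero"
| "Pi_True_fm 0 d x = Delta0_value_fm d x (numeral_tm 1)"
| "Pi_False_fm 0 d x = Delta0_value_fm d x Zero"
| "Sigma_True_fm (Suc n) d x = gen d (\<lambda>d x prev.
       Pi_True_fm n d x
     \<^bold>\<or> ex d (\<lambda>d k. ex d (\<lambda>d p. ex d (\<lambda>d m.
         ex_code d k p (\<lambda>d z. x \<^bold>= z) \<^bold>\<and> instance_fm d k m p (\<lambda>d q. prev d q))))) x"
| "Pi_False_fm (Suc n) d x = gen d (\<lambda>d x prev.
       Sigma_False_fm n d x
     \<^bold>\<or> ex d (\<lambda>d k. ex d (\<lambda>d p. ex d (\<lambda>d m.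
         all_code d k p (\<lambda>d z. x \<^bold>= z) \<^bold>\<and> instance_fm d k m p (\<lambda>d q. prev d q))))) x"
| "Sigma_False_fm (Suc n) d x =
     (sentence_fm d x \<^bold>\<and> is_Sigma_fm (Suc n) d x \<^bold>\<and> \<^bold>\<not> Sigma_True_fm (Suc n) d x)"
| "Pi_True_fm (Suc n) d x =
     (sentence_fm d x \<^bold>\<and> is_Pi_fm (Suc n) d x \<^bold>\<and> \<^bold>\<not> Pi_False_fm (Suc n) d x)"

subsection \<open>The soundness sentence\<close>

text \<open>\<open>\<Sigma>\<^sub>n\<close>-soundness of the theory whose axioms are defined by \<open>\<sigma>\<close>. The bound variables are
  \<open>s = 1\<close>, \<open>t = 2\<close>, \<open>u = 3\<close>; variable \<open>0\<close> is reserved for \<open>\<sigma>\<close>.\<close>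

definition Sound_fm :: "nat \<Rightarrow> fm \<Rightarrow> fm" where
  "Sound_fm n \<sigma> = Forall 1 (Forall 2 (Forall 3
     (ConjAx_fm \<sigma> 4 (Var 1) \<^bold>\<and> Pi_True_fm n 4 (Var 2) \<^bold>\<rightarrow>
      \<^bold>\<not> and_code 4 (Var 1) (Var 2) (\<lambda>d z. imp_code d z Zero (\<lambda>d z. Proof_fm d (Var 3) z)))))"

section \<open>Correctness of the arithmetization\<close>

text \<open>The statements of interest are \<open>Proof_fm_correct\<close>, \<open>ConjAx_fm_correct\<close>,
  \<open>Pi_True_fm_correct\<close> and \<open>Sound_fm_correct\<close>: in the standard model the formulas define
  the notions they are named after.\<close>

subsection \<open>Basic builders and inductively generated relations\<close>

lemma sat_Exists [simp]: "sat e (Exists k \<phi>) \<longleftrightarrow> (\<exists>m. sat (e(k := m)) \<phi>)"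
  by (simp add: Exists_def)
lemma sat_Or [simp]: "sat e (\<phi> \<^bold>\<or> \<psi>) \<longleftrightarrow> sat e \<phi> \<or> sat e \<psi>"
  by (auto simp: Or_def)
lemma sat_And [simp]: "sat e (\<phi> \<^bold>\<and> \<psi>) \<longleftrightarrow> sat e \<phi> \<and> sat e \<psi>"
  by (simp add: And_def)

text \<open>The least \<open>d\<close> such that all variables of the term have index below \<open>d\<close>.\<close>

primrec ub :: "tm \<Rightarrow> nat" where
  "ub Zero = 0"
| "ub (Var k) = Suc k"
| "ub (Succ t) = ub t"
| "ub (Plus s t) = max (ub s) (ub t)"
| "ub (Times s t) = max (ub s) (ub t)"

lemma val_cong: "(\<And>k. k < ub t \<Longrightarrow> e k = e' k) \<Longrightarrow> val e t = val e' t"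
  by (induction t) auto

lemma val_upd [simp]: "ub t \<le> k \<Longrightarrow> val (e(k := v)) t = val e t"
  by (rule val_cong) auto

lemma val_numeral_tm [simp]: "val e (numeral_tm n) = n"
  by (induction n) auto

lemma ub_numeral_tm [simp]: "ub (numeral_tm n) = 0"
  by (induction n) auto

lemma val_tag [simp]: "val e (tag r x) = 4 * val e x + r"
  by (simp add: tag_def)

lemma ub_tag [simp]: "ub (tag r x) = ub x"
  by (simp add: tag_def)

lemma sat_ex [simp]: "sat e (ex d F) \<longleftrightarrow> (\<exists>m. sat (e(d := m)) (F (Suc d) (Var d)))"
  by (simp add: ex_def)

lemma sat_exb [simp]:
  "ub t \<le> d \<Longrightarrow> sat e (exb d t F) \<longleftrightarrow> (\<exists>m\<le>val e t. sat (e(d := m)) (F (Suc d) (Var d)))"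
  by (auto simp: exb_def)

lemma sat_allb [simp]:
  "ub t \<le> d \<Longrightarrow> sat e (allb d t F) \<longleftrightarrow> (\<forall>m\<le>val e t. sat (e(d := m)) (F (Suc d) (Var d)))"
  by (auto simp: allb_def)

lemma sat_pair_fm [simp]:
  "sat e (pair_fm x y z) \<longleftrightarrow> val e z = prod_encode (val e x, val e y)"
proof -
  have "2 * triangle n = n * Suc n" for n
    by (induction n) (auto simp: triangle_def)
  then have "2 * prod_encode (a, b) = (a + b) * Suc (a + b) + 2 * a" for a b
    by (simp add: prod_encode_def distrib_left)
  from this[of "val e x" "val e y"] show ?thesis
    by (simp add: pair_fm_def) linarith
qed

lemma sat_node [simp]:
  "ub x \<le> d \<Longrightarrow> ub y \<le> d \<Longrightarrow>
   sat e (node r d x y F) \<longleftrightarrow>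
   sat (e(d := prod_encode (val e x, val e y))) (F (Suc d) (tag r (Var d)))"
  by (simp add: node_def)

lemma sat_beta_fm [simp]:
  "ub a \<le> d \<Longrightarrow> ub b \<le> d \<Longrightarrow> ub i \<le> d \<Longrightarrow> ub y \<le> d \<Longrightarrow>
   sat e (beta_fm d a b i y) \<longleftrightarrow> beta (val e a) (val e b) (val e i) = val e y"
proof -
  have *: "(y < m \<and> (\<exists>q. a = q * m + y)) \<longleftrightarrow> a mod m = y" if "m > 0" for a m y :: nat
    using that by (auto intro: exI[of _ "a div m"])
  assume "ub a \<le> d" "ub b \<le> d" "ub i \<le> d" "ub y \<le> d"
  then show ?thesis
    using *[of "Suc (Suc (val e i) * val e b)" "val e y" "val e a"]
    by (simp add: beta_fm_def beta_def Let_def Suc_le_eq less_Suc_eq_le)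
qed

lemma beta_exists: "\<exists>a b. \<forall>i\<le>l. beta a b i = f i"
proof -
  define M where "M = Max (insert (Suc l) (f ` {..l}))"
  have fM: "f i \<le> M" if "i \<le> l" for i
    using that unfolding M_def by (intro Max_ge) auto
  have lM: "Suc l \<le> M"
    unfolding M_def by (intro Max_ge) auto
  define b where "b = (fact M :: nat)"
  define m where "m = (\<lambda>i. Suc (Suc i * b))"
  have cop: "coprime (m i) (m j)" if "i \<le> l" "j \<le> l" "i < j" for i j
  proof (rule coprimeI)
    fix c assume c: "c dvd m i" "c dvd m j"
    have "coprime c b"
    proof (rule coprimeI)
      fix q assume "q dvd c" "q dvd b"
      then have "q dvd m i" "q dvd Suc i * b"
        using c by auto
      then have "q dvd (m i - Suc i * b)"
        by (rule dvd_diff_nat)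
      then show "is_unit q" by (simp add: m_def)
    qed
    have "c dvd Suc j * m i - Suc i * m j"
      using c by (intro dvd_diff_nat) auto
    also have "Suc j * m i - Suc i * m j = j - i"
      by (simp add: m_def algebra_simps)
    finally have "c dvd j - i" .
    moreover have "j - i dvd b"
      unfolding b_def using that lM by (intro dvd_fact) auto
    ultimately have "c dvd b" by (rule dvd_trans)
    with \<open>coprime c b\<close> show "is_unit c"
      by (metis coprime_common_divisor dvd_refl)
  qed
  have "\<forall>i\<in>{..l}. \<forall>j\<in>{..l}. i \<noteq> j \<longrightarrow> coprime (m i) (m j)"
  proof (intro ballI impI)
    fix i j assume "i \<in> {..l}" "j \<in> {..l}" "i \<noteq> j"
    then show "coprime (m i) (m j)"
      using cop[of i j] cop[of j i] by (cases "i < j") (auto simp: coprime_commute)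
  qed
  then obtain a where a: "\<forall>i\<in>{..l}. [a = f i] (mod m i)"
    using chinese_remainder_nat[of "{..l}" m f] by auto
  have "beta a b i = f i" if "i \<le> l" for i
  proof -
    have "M \<le> b"
      unfolding b_def by (rule fact_ge_self)
    then have "f i < m i"
      using fM[OF that] by (simp add: m_def)
    moreover have "a mod m i = f i mod m i"
      using a that by (auto simp: cong_def)
    ultimately show ?thesis by (simp add: beta_def m_def)
  qed
  then show ?thesis by blast
qed

text \<open>\<open>P\<close> is the meaning of the rule \<open>R\<close> in the context given by \<open>d\<close> and \<open>e\<close>.\<close>

definition rule_sem :: "nat \<Rightarrow> (nat \<Rightarrow> nat) \<Rightarrow> rule \<Rightarrow> (nat \<Rightarrow> nat set \<Rightarrow> bool) \<Rightarrow> bool" where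
  "rule_sem d e R P \<longleftrightarrow> (\<forall>d' e' y prev S. d \<le> d' \<longrightarrow> (\<forall>k<d. e' k = e k) \<longrightarrow> ub y \<le> d' \<longrightarrow>
     (\<forall>k\<in>fvt y. d \<le> k) \<longrightarrow>
     (\<forall>d'' e'' z. d' \<le> d'' \<longrightarrow> (\<forall>k<d'. e'' k = e' k) \<longrightarrow> ub z \<le> d'' \<longrightarrow>
        sat e'' (prev d'' z) = (val e'' z \<in> S)) \<longrightarrow>
     sat e' (R d' y prev) = P (val e' y) S)"

lemma sat_derivation:
  assumes "rule_sem d e R P" "ub a \<le> d" "ub b \<le> d" "ub l \<le> d"
  shows "sat e (derivation d a b l R) \<longleftrightarrow>
    (\<forall>i\<le>val e l. P (beta (val e a) (val e b) i) (beta (val e a) (val e b) ` {..<i}))"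
proof -
  have "sat e (derivation d a b l R) \<longleftrightarrow>
    (\<forall>i\<le>val e l. \<exists>y. beta (val e a) (val e b) i = y \<and> P y (beta (val e a) (val e b) ` {..<i}))"
    (is "_ = (\<forall>i\<le>_. \<exists>y. ?B i y)")
  proof -
    have *: "sat (e(d := i, Suc d := y)) (R (Suc (Suc d)) (Var (Suc d))
        (\<lambda>d'. \<lambda>z. exb d' (Var d) (\<lambda>d'' j. Succ j \<^bold>\<le> Var d \<^bold>\<and> beta_fm d'' a b j z)))
      = P (val (e(d := i, Suc d := y)) (Var (Suc d))) (beta (val e a) (val e b) ` {..<i})" for i y
    proof (rule assms(1)[unfolded rule_sem_def, rule_format])
      fix d'' e'' z
      assume d: "Suc (Suc d) \<le> d''" and e: "\<And>k. k < Suc (Suc d) \<Longrightarrow> e'' k = (e(d := i, Suc d := y)) k"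
        and z: "ub z \<le> d''"
      have "val e'' a = val e a" "val e'' b = val e b"
        using assms(2,3) e by (auto intro!: val_cong)
      moreover have "e'' d = i"
        using e[of d] by simp
      ultimately show "sat e'' (exb d'' (Var d) (\<lambda>d'' j. Succ j \<^bold>\<le> Var d \<^bold>\<and> beta_fm d'' a b j z)) =
            (val e'' z \<in> beta (val e a) (val e b) ` {..<i})"
        using assms(2,3) d z
        by (auto simp: Suc_le_eq image_iff) (metis lessThan_iff, metis less_imp_le_nat)
    qed auto
    show ?thesis
      unfolding derivation_def using assms(2-4) by (simp add: *)
  qed
  then show ?thesis by simp
qed

lemma derivation_exists:
  assumes mono: "\<And>y S S'. P y S \<Longrightarrow> S \<subseteq> S' \<Longrightarrow> P y S'"
    and step: "\<And>x. Q x \<Longrightarrow> \<exists>S. finite S \<and> P x S \<and> (\<forall>z\<in>S. Q z \<and> \<mu> z < (\<mu> x :: nat))"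
    and "Q x"
  shows "\<exists>xs. (\<forall>i<length xs. P (xs ! i) (set (take i xs))) \<and> xs \<noteq> [] \<and> last xs = x"
  using \<open>Q x\<close>
proof (induction "\<mu> x" arbitrary: x rule: less_induct)
  case less
  let ?ok = "\<lambda>xs. \<forall>i<length xs. P (xs ! i) (set (take i xs))"
  from step[OF \<open>Q x\<close>] obtain S where S: "finite S" "P x S" "\<forall>z\<in>S. Q z \<and> \<mu> z < \<mu> x" by blast
  have app: "?ok (xs @ ys)" if "?ok xs" "?ok ys" for xs ys
  proof (intro allI impI)
    fix i assume i: "i < length (xs @ ys)"
    show "P ((xs @ ys) ! i) (set (take i (xs @ ys)))"
    proof (cases "i < length xs")
      case True
      then show ?thesis using that(1) by (auto simp: nth_append)
    next
      case False
      then have "P ((xs @ ys) ! i) (set (take (i - length xs) ys))"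
        using that(2) i by (auto simp: nth_append)
      then show ?thesis
        by (rule mono) (use False in auto)
    qed
  qed
  from S(1,3) have "\<exists>xs. ?ok xs \<and> S \<subseteq> set xs"
  proof (induction S rule: finite_induct)
    case empty
    show ?case by (intro exI[of _ "[]"]) auto
  next
    case (insert z S)
    then obtain xs where xs: "?ok xs" "S \<subseteq> set xs" by auto
    from insert.prems less.hyps[of z] obtain ys where "?ok ys" "ys \<noteq> []" "last ys = z" by auto
    then show ?case
      using app[OF xs(1)] xs(2) by (intro exI[of _ "xs @ ys"]) (auto dest: last_in_set)
  qed
  then obtain xs where xs: "?ok xs" "S \<subseteq> set xs" by blast
  have "?ok (xs @ [x])"
    using xs mono[OF S(2) xs(2)] by (auto simp: nth_append less_Suc_eq)
  then show ?case by (intro exI[of _ "xs @ [x]"]) auto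
qed

lemma rule_sem_ext:
  "rule_sem d e R P \<Longrightarrow> d \<le> d' \<Longrightarrow> (\<And>k. k < d \<Longrightarrow> e' k = e k) \<Longrightarrow> rule_sem d' e' R P"
  unfolding rule_sem_def
  apply (intro allI impI)
  subgoal premises prems for d'' e'' y prev S
    using prems(2-) by (intro prems(1)[rule_format]) auto
  done

lemma sat_gen:
  assumes R: "rule_sem d e R P" and x: "ub x \<le> d"
    and mono: "\<And>y S S'. P y S \<Longrightarrow> S \<subseteq> S' \<Longrightarrow> P y S'"
    and sound: "\<And>y S. P y S \<Longrightarrow> \<forall>z\<in>S. Q z \<Longrightarrow> Q y"
    and step: "\<And>x. Q x \<Longrightarrow> \<exists>S. finite S \<and> P x S \<and> (\<forall>z\<in>S. Q z \<and> \<mu> z < (\<mu> x :: nat))"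
  shows "sat e (gen d R x) \<longleftrightarrow> Q (val e x)"
proof -
  have *: "rule_sem (Suc (Suc (Suc d))) (e(d := a, Suc d := b, Suc (Suc d) := l)) R P" for a b l
    by (rule rule_sem_ext[OF R]) auto
  have "sat e (gen d R x) \<longleftrightarrow>
      (\<exists>a b l. beta a b l = val e x \<and> (\<forall>i\<le>l. P (beta a b i) (beta a b ` {..<i})))"
    unfolding gen_def using x by (simp add: sat_derivation[OF *])
  also have "\<dots> \<longleftrightarrow> Q (val e x)"
  proof
    assume "\<exists>a b l. beta a b l = val e x \<and> (\<forall>i\<le>l. P (beta a b i) (beta a b ` {..<i}))"
    then obtain a b l where abl: "beta a b l = val e x" "\<forall>i\<le>l. P (beta a b i) (beta a b ` {..<i})"
      by blast
    have "i \<le> l \<Longrightarrow> Q (beta a b i)" for i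
    proof (induction i rule: less_induct)
      case (less i)
      then show ?case
        using abl(2) by (intro sound[of "beta a b i" "beta a b ` {..<i}"]) auto
    qed
    from this[of l] show "Q (val e x)" by (simp add: abl(1))
  next
    assume "Q (val e x)"
    then have "\<exists>xs. (\<forall>i<length xs. P (xs ! i) (set (take i xs))) \<and> xs \<noteq> [] \<and> last xs = val e x"
      using mono step by (intro derivation_exists[of P Q \<mu>])
    then obtain xs
      where xs: "\<forall>i<length xs. P (xs ! i) (set (take i xs))" "xs \<noteq> []" "last xs = val e x" by blast
    from beta_exists[of "length xs" "\<lambda>i. xs ! i"] obtain a b
      where ab: "\<forall>i\<le>length xs. beta a b i = xs ! i" by blast
    have "P (beta a b i) (beta a b ` {..<i})" if "i \<le> length xs - 1" for i
    proof -
      have i: "i < length xs" using that xs(2) by (cases xs) auto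
      have "set (take i xs) = beta a b ` {..<i}"
        using ab i by (simp add: nth_image[symmetric] atLeast0LessThan)
      then show ?thesis using xs(1) ab i by auto
    qed
    moreover have "beta a b (length xs - 1) = val e x"
      using ab xs(2,3) by (auto simp: last_conv_nth)
    ultimately show "\<exists>a b l. beta a b l = val e x \<and> (\<forall>i\<le>l. P (beta a b i) (beta a b ` {..<i}))"
      by blast
  qed
  finally show ?thesis .
qed

definition rule2_sem ::
  "nat \<Rightarrow> (nat \<Rightarrow> nat) \<Rightarrow> rule2 \<Rightarrow> (nat \<Rightarrow> nat \<Rightarrow> (nat \<Rightarrow> nat \<Rightarrow> bool) \<Rightarrow> bool) \<Rightarrow> bool" where
  "rule2_sem d e R P \<longleftrightarrow> (\<forall>d' e' x y prev S. d \<le> d' \<longrightarrow> (\<forall>k<d. e' k = e k) \<longrightarrow>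
     ub x \<le> d' \<longrightarrow> ub y \<le> d' \<longrightarrow>
     (\<forall>d'' e'' u v. d' \<le> d'' \<longrightarrow> (\<forall>k<d'. e'' k = e' k) \<longrightarrow> ub u \<le> d'' \<longrightarrow> ub v \<le> d'' \<longrightarrow>
        sat e'' (prev d'' u v) = S (val e'' u) (val e'' v)) \<longrightarrow>
     sat e' (R d' x y prev) = P (val e' x) (val e' y) S)"

lemma rule2_sem_ext:
  "rule2_sem d e R P \<Longrightarrow> d \<le> d' \<Longrightarrow> (\<And>k. k < d \<Longrightarrow> e' k = e k) \<Longrightarrow> rule2_sem d' e' R P"
  unfolding rule2_sem_def
  apply (intro allI impI)
  subgoal premises prems for d'' e'' x y prev S
    using prems(2-) by (intro prems(1)[rule_format]) auto
  done

lemma sat_gen2: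
  assumes R: "rule2_sem d e R P" and xy: "ub x \<le> d" "ub y \<le> d"
    and mono: "\<And>x y S S'. P x y S \<Longrightarrow> (\<And>u v. S u v \<Longrightarrow> S' u v) \<Longrightarrow> P x y S'"
    and sound: "\<And>x y. P x y Q \<Longrightarrow> Q x y"
    and step: "\<And>x y. Q x y \<Longrightarrow> \<exists>S. finite S \<and> P x y (\<lambda>u v. (u, v) \<in> S) \<and>
                 (\<forall>(u, v)\<in>S. Q u v \<and> \<mu> u < (\<mu> x :: nat))"
  shows "sat e (gen2 d R x y) \<longleftrightarrow> Q (val e x) (val e y)"
proof -
  define P' where "P' = (\<lambda>w (S :: nat set). \<exists>x y. w = prod_encode (x, y) \<and> P x y (\<lambda>u v. prod_encode (u, v) \<in> S))"
  define Q' where "Q' = (\<lambda>w. case prod_decode w of (x, y) \<Rightarrow> Q x y)"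
  define \<mu>' where "\<mu>' = (\<lambda>w. \<mu> (fst (prod_decode w)))"
  define R' where "R' = (\<lambda>d w prev. ex d (\<lambda>d x. ex d (\<lambda>d y. pair_fm x y w \<^bold>\<and>
       R d x y (\<lambda>d x' y'. ex d (\<lambda>d w'. pair_fm x' y' w' \<^bold>\<and> prev d w')))))"
  have R'1: "rule_sem d e R' P'"
    unfolding rule_sem_def
  proof (intro allI impI)
    fix d' e' w prev S
    assume d': "d \<le> d'" and e': "\<forall>k<d. e' k = e k" and w: "ub w \<le> d'"
      and prev: "\<forall>d'' e'' z. d' \<le> d'' \<longrightarrow> (\<forall>k<d'. e'' k = e' k) \<longrightarrow> ub z \<le> d'' \<longrightarrow>
        sat e'' (prev d'' z) = (val e'' z \<in> S)"
    have "sat (e'(d' := m, Suc d' := n)) (R (Suc (Suc d')) (Var d') (Var (Suc d')) 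
          (\<lambda>d x' y'. ex d (\<lambda>d w'. pair_fm x' y' w' \<^bold>\<and> prev d w'))) =
        P m n (\<lambda>u v. prod_encode (u, v) \<in> S)" for m n
      using R[unfolded rule2_sem_def, rule_format, of "Suc (Suc d')" "e'(d' := m, Suc d' := n)"
          "Var d'" "Var (Suc d')" "\<lambda>d x' y'. ex d (\<lambda>d w'. pair_fm x' y' w' \<^bold>\<and> prev d w')"
          "\<lambda>u v. prod_encode (u, v) \<in> S"] d' e' prev by simp
    then show "sat e' (R' d' w prev) = P' (val e' w) S"
      unfolding R'_def P'_def using w by simp
  qed
  have R'2: "rule_sem (Suc d) (e(d := m)) R' P'" for m
    by (rule rule_sem_ext[OF R'1]) auto
  have *: "sat (e(d := m)) (gen (Suc d) R' (Var d)) \<longleftrightarrow> Q' (val (e(d := m)) (Var d))" for m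
  proof (rule sat_gen[where P = P' and Q = Q' and \<mu> = \<mu>'])
    show "rule_sem (Suc d) (e(d := m)) R' P'" by (rule R'2)
  next
    fix w S S' assume "P' w S" "S \<subseteq> S'"
    then obtain x y where w: "w = prod_encode (x, y)" and P: "P x y (\<lambda>u v. prod_encode (u, v) \<in> S)"
      unfolding P'_def by blast
    from P have "P x y (\<lambda>u v. prod_encode (u, v) \<in> S')"
      by (rule mono) (use \<open>S \<subseteq> S'\<close> in auto)
    with w show "P' w S'" unfolding P'_def by blast
  next
    fix w S assume "P' w S" "\<forall>z\<in>S. Q' z"
    then obtain x y where w: "w = prod_encode (x, y)" and P: "P x y (\<lambda>u v. prod_encode (u, v) \<in> S)"
      and S: "\<forall>z\<in>S. Q' z"
      unfolding P'_def by blast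
    have "Q u v" if "prod_encode (u, v) \<in> S" for u v
      using S[rule_format, OF that] by (simp add: Q'_def)
    with P have "P x y Q" by (rule mono)
    then show "Q' w" using sound w by (simp add: Q'_def)
  next
    fix w assume "Q' w"
    obtain x y where w: "w = prod_encode (x, y)" by (metis prod_decode_inverse surj_pair)
    with \<open>Q' w\<close> have "Q x y" by (simp add: Q'_def)
    from step[OF this] obtain S where S: "finite S" "P x y (\<lambda>u v. (u, v) \<in> S)"
      "\<forall>(u, v)\<in>S. Q u v \<and> \<mu> u < \<mu> x" by blast
    show "\<exists>S. finite S \<and> P' w S \<and> (\<forall>z\<in>S. Q' z \<and> \<mu>' z < \<mu>' w)"
      by (rule exI[of _ "prod_encode ` S"])
        (use S w in \<open>auto simp: P'_def Q'_def \<mu>'_def image_iff\<close>)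
  qed simp
  have "sat e (gen2 d R x y) \<longleftrightarrow>
      (\<exists>m. m = prod_encode (val e x, val e y) \<and> sat (e(d := m)) (gen (Suc d) R' (Var d)))"
    unfolding gen2_def R'_def using xy by simp
  then show ?thesis by (simp only: * Q'_def) simp
qed

subsection \<open>Codes and substitution in terms\<close>

lemma tcode_surj: "\<exists>t. x = tcode t"
proof (induction x rule: less_induct)
  case (less x)
  show ?case
  proof (cases x)
    case 0
    then show ?thesis by (intro exI[of _ Zero]) simp
  next
    case (Suc y)
    define q where "q = y div 4"
    have x: "x = 4 * q + 1 \<or> x = 4 * q + 2 \<or> x = 4 * q + 3 \<or> x = 4 * q + 4"
      unfolding q_def Suc by presburger
    have "q < x" unfolding q_def Suc by simp
    obtain a b where ab: "q = prod_encode (a, b)" by (metis prod_decode_inverse surj_pair)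
    have "a < x" "b < x"
      using \<open>q < x\<close> le_prod_encode_1[of a b] le_prod_encode_2[of b a] ab by auto
    with less \<open>q < x\<close> obtain s t u where "q = tcode s" "a = tcode t" "b = tcode u" by blast
    then have "x = tcode (Var q) \<or> x = tcode (Succ s) \<or> x = tcode (Plus t u) \<or> x = tcode (Times t u)"
      using x ab by simp
    then show ?thesis by blast
  qed
qed

lemma fcode_surj: "\<exists>\<phi>. x = fcode \<phi>"
proof (induction x rule: less_induct)
  case (less x)
  show ?case
  proof (cases x)
    case 0
    then show ?thesis by (intro exI[of _ Bot]) simp
  next
    case (Suc y)
    define q where "q = y div 4"
    have x: "x = 4 * q + 1 \<or> x = 4 * q + 2 \<or> x = 4 * q + 3 \<or> x = 4 * q + 4"
      unfolding q_def Suc by presburger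
    have "q < x" unfolding q_def Suc by simp
    obtain a b where ab: "q = prod_encode (a, b)" by (metis prod_decode_inverse surj_pair)
    have "a < x" "b < x"
      using \<open>q < x\<close> le_prod_encode_1[of a b] le_prod_encode_2[of b a] ab by auto
    with less obtain \<phi> \<psi> where "a = fcode \<phi>" "b = fcode \<psi>" by blast
    moreover obtain s t where "a = tcode s" "b = tcode t" using tcode_surj by blast
    ultimately have "x = fcode (s \<^bold>= t) \<or> x = fcode (s \<^bold>\<le> t) \<or> x = fcode (\<phi> \<^bold>\<rightarrow> \<psi>) \<or> x = fcode (Forall a \<psi>)"
      using x ab by simp
    then show ?thesis by blast
  qed
qed

lemma tcode_inj [simp]: "tcode s = tcode t \<longleftrightarrow> s = t"
proof (induction s arbitrary: t)
  case Zero then show ?case by (cases t) auto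
next
  case (Var k) then show ?case by (cases t) (auto, presburger+)
next
  case (Succ s) then show ?case by (cases t) (auto, presburger+)
next
  case (Plus s1 s2) then show ?case by (cases t) (auto, presburger+)
next
  case (Times s1 s2) then show ?case by (cases t) (auto, presburger+)
qed

lemma fcode_inj [simp]: "fcode \<phi> = fcode \<psi> \<longleftrightarrow> \<phi> = \<psi>"
proof (induction \<phi> arbitrary: \<psi>)
  case Bot then show ?case by (cases \<psi>) auto
next
  case (Equal s t) then show ?case by (cases \<psi>) (auto, presburger+)
next
  case (Leq s t) then show ?case by (cases \<psi>) (auto, presburger+)
next
  case (Imp \<phi>1 \<phi>2) then show ?case by (cases \<psi>) (auto, presburger+)
next
  case (Forall k \<phi>) then show ?case by (cases \<psi>) (auto, presburger+)
qed

lemma tcode_ex: "(\<exists>x. P x) \<longleftrightarrow> (\<exists>t. P (tcode t))"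
  by (metis tcode_surj)

lemma fcode_ex: "(\<exists>x. P x) \<longleftrightarrow> (\<exists>\<phi>. P (fcode \<phi>))"
  by (metis fcode_surj)

lemma less_node [simp]:
  "0 < r \<Longrightarrow> a < 4 * prod_encode (a, b) + r" "0 < r \<Longrightarrow> b < 4 * prod_encode (a, b) + r"
  "a < Suc (4 * prod_encode (a, b))" "b < Suc (4 * prod_encode (a, b))"
  "a < Suc (Suc (4 * prod_encode (a, b)))" "b < Suc (Suc (4 * prod_encode (a, b)))"
  using le_prod_encode_1[of a b] le_prod_encode_2[of b a] by auto

lemma sat_substt_fm:
  assumes ub: "ub k \<le> d" "ub t \<le> d" "ub x \<le> d" "ub y \<le> d" and T: "val e t = tcode T"
  shows "sat e (substt_fm d k t x y) \<longleftrightarrow>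
    (\<exists>s. val e x = tcode s \<and> val e y = tcode (substt (val e k) T s))"
  unfolding substt_fm_def
proof (rule sat_gen2[where \<mu> = id and P = "\<lambda>x y prev.
       (x = 0 \<and> y = 0) \<or> (x = 4 * val e k + 1 \<and> y = tcode T)
     \<or> (\<exists>j. j \<noteq> val e k \<and> x = 4 * j + 1 \<and> y = x)
     \<or> (\<exists>u u'. x = 4 * u + 2 \<and> y = 4 * u' + 2 \<and> prev u u')
     \<or> (\<exists>u u' v v'. prev u u' \<and> prev v v' \<and>
         (x = 4 * prod_encode (u, v) + 3 \<and> y = 4 * prod_encode (u', v') + 3 \<or>
          x = 4 * prod_encode (u, v) + 4 \<and> y = 4 * prod_encode (u', v') + 4))" and
      Q = "\<lambda>x y. \<exists>s. x = tcode s \<and> y = tcode (substt (val e k) T s)"], goal_cases)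
  case 1
  show ?case
    unfolding rule2_sem_def
  proof (intro allI impI, goal_cases)
    case (1 d' e' x y prev S)
    have "val e' k = val e k" "val e' t = tcode T"
      using 1(2) ub T[symmetric] by (auto intro!: val_cong)
    then show ?case using 1 ub by simp
  qed
next
  case (4 x y S S')
  from 4(1) show ?case by (elim disj_forward ex_forward conj_forward) (simp_all add: 4(2))
next
  case (5 x y)
  then show ?case
    apply (elim disjE exE conjE)
         apply (rule exI[of _ Zero]; simp)
        apply (rule exI[of _ "Var (val e k)"]; simp)
       subgoal for j by (rule exI[of _ "Var j"]; simp)
      subgoal for _ _ s by (rule exI[of _ "Succ s"]; simp)
     subgoal for _ _ _ _ s s' by (rule exI[of _ "Plus s s'"]; simp)
    subgoal for _ _ _ _ s s' by (rule exI[of _ "Times s s'"]; simp)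
    done
next
  case (6 x y)
  then obtain s where s: "x = tcode s" "y = tcode (substt (val e k) T s)" by blast
  let ?c = "\<lambda>s. (tcode s, tcode (substt (val e k) T s))"
  show ?case
  proof (cases s)
    case Zero
    with s show ?thesis by (intro exI[of _ "{}"]) simp
  next
    case (Var j)
    with s show ?thesis by (intro exI[of _ "{}"]) simp
  next
    case (Succ u)
    with s show ?thesis by (intro exI[of _ "{?c u}"]) simp
  next
    case (Plus u v)
    show ?thesis
    proof (intro exI[of _ "{?c u, ?c v}"] conjI, goal_cases)
      case 2
      show ?case
        by ((rule disjI2)+, rule exI[of _ "tcode u"], rule exI[of _ "tcode (substt (val e k) T u)"],
            rule exI[of _ "tcode v"], rule exI[of _ "tcode (substt (val e k) T v)"])
          (simp add: s Plus)
    qed (auto simp: s Plus)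
  next
    case (Times u v)
    show ?thesis
    proof (intro exI[of _ "{?c u, ?c v}"] conjI, goal_cases)
      case 2
      show ?case
        by ((rule disjI2)+, rule exI[of _ "tcode u"], rule exI[of _ "tcode (substt (val e k) T u)"],
            rule exI[of _ "tcode v"], rule exI[of _ "tcode (substt (val e k) T v)"])
          (simp add: s Times)
    qed (auto simp: s Times)
  qed
qed (use ub in auto)

subsection \<open>Substitution in formulas\<close>

text \<open>Decoding functions.\<close>

definition td :: "nat \<Rightarrow> tm" where "td = inv tcode"
definition fd :: "nat \<Rightarrow> fm" where "fd = inv fcode"

lemma td_tcode [simp]: "td (tcode t) = t"
  unfolding td_def by (rule inv_f_f) (auto intro: injI)
lemma tcode_td [simp]: "tcode (td n) = n"
  by (metis td_tcode tcode_surj)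
lemma fd_fcode [simp]: "fd (fcode \<phi>) = \<phi>"
  unfolding fd_def by (rule inv_f_f) (auto intro: injI)
lemma fcode_fd [simp]: "fcode (fd n) = n"
  by (metis fd_fcode fcode_surj)

lemma fd_simps [simp]: "td 0 = Zero" "fd 0 = Bot"
  by (metis td_tcode tcode.simps(1)) (metis fd_fcode fcode.simps(1))

lemma substt_Zero: "substt k Zero s = s \<longleftrightarrow> k \<notin> fvt s"
  by (induction s) auto
lemma subst_Zero: "subst k Zero \<phi> = \<phi> \<longleftrightarrow> k \<notin> fv \<phi>"
  by (induction \<phi>) (auto simp: substt_Zero)
lemma free_for_Zero: "free_for Zero k \<phi>"
  by (induction \<phi>) auto

lemma sat_substt_fm' [simp]:
  assumes "ub k \<le> d" "ub t \<le> d" "ub x \<le> d" "ub y \<le> d"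
  shows "sat e (substt_fm d k t x y) \<longleftrightarrow>
    val e y = tcode (substt (val e k) (td (val e t)) (td (val e x)))"
  using sat_substt_fm[OF assms, of e "td (val e t)"] by (metis tcode_td td_tcode)

lemma sat_not_free_tm_fm [simp]:
  assumes "ub k \<le> d" "ub x \<le> d"
  shows "sat e (not_free_tm_fm d k x) \<longleftrightarrow> val e k \<notin> fvt (td (val e x))"
  unfolding not_free_tm_fm_def using assms
  by simp (metis tcode_td tcode_inj substt_Zero)

lemma sat_subst_fm [simp]:
  assumes ub: "ub k \<le> d" "ub t \<le> d" "ub x \<le> d" "ub y \<le> d"
  shows "sat e (subst_fm d k t x y) \<longleftrightarrow>
    free_for (td (val e t)) (val e k) (fd (val e x)) \<and>
    val e y = fcode (subst (val e k) (td (val e t)) (fd (val e x)))"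
proof -
  define T where "T = td (val e t)"
  define K where "K = val e k"
  have "sat e (subst_fm d k t x y) \<longleftrightarrow>
    free_for T K (fd (val e x)) \<and> val e y = fcode (subst K T (fd (val e x)))"
  unfolding subst_fm_def
proof (rule sat_gen2[where \<mu> = id and P = "\<lambda>x y prev.
       (x = 0 \<and> y = 0)
     \<or> (\<exists>u u' v v'. u' = tcode (substt K T (td u)) \<and> v' = tcode (substt K T (td v)) \<and>
         (x = 4 * prod_encode (u, v) + 1 \<and> y = 4 * prod_encode (u', v') + 1 \<or>
          x = 4 * prod_encode (u, v) + 2 \<and> y = 4 * prod_encode (u', v') + 2))
     \<or> (\<exists>u u' v v'. prev u u' \<and> prev v v' \<and>
          x = 4 * prod_encode (u, v) + 3 \<and> y = 4 * prod_encode (u', v') + 3)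
     \<or> (\<exists>u. x = 4 * prod_encode (K, u) + 4 \<and> y = x)
     \<or> (\<exists>j u u'. j \<noteq> K \<and> j \<notin> fvt T \<and> prev u u' \<and>
          x = 4 * prod_encode (j, u) + 4 \<and> y = 4 * prod_encode (j, u') + 4)" and
      Q = "\<lambda>x y. free_for T K (fd x) \<and> y = fcode (subst K T (fd x))"], goal_cases)
  case 1
  show ?case
    unfolding rule2_sem_def
  proof (intro allI impI, goal_cases)
    case (1 d' e' x y prev S)
    have "val e' k = K" "td (val e' t) = T"
      using 1(2) ub by (auto intro!: val_cong arg_cong[of _ _ td] simp: K_def T_def)
    then show ?case using 1 ub by simp
  qed
next
  case (4 x y S S')
  from 4(1) show ?case by (elim disj_forward ex_forward conj_forward) (simp_all add: 4(2))
next
  case (5 x y)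
  have "\<exists>\<phi>. x = fcode \<phi> \<and> free_for T K \<phi> \<and> y = fcode (subst K T \<phi>)"
    using 5
    apply (elim disjE exE conjE)
         apply (rule exI[of _ Bot]; simp)
        subgoal for u _ v by (rule exI[of _ "td u \<^bold>= td v"]; simp)
       subgoal for u _ v by (rule exI[of _ "td u \<^bold>\<le> td v"]; simp)
      subgoal for u _ v by (rule exI[of _ "fd u \<^bold>\<rightarrow> fd v"]; simp)
     subgoal for u by (rule exI[of _ "Forall K (fd u)"]; simp)
    subgoal for j u by (rule exI[of _ "Forall j (fd u)"]; simp)
    done
  then show ?case by auto
next
  case (6 x y)
  then obtain \<phi> where s: "x = fcode \<phi>" "y = fcode (subst K T \<phi>)" "free_for T K \<phi>"
    by (metis fcode_fd)
  let ?c = "\<lambda>\<phi>. (fcode \<phi>, fcode (subst K T \<phi>))"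
  show ?case
  proof (cases \<phi>)
    case Bot
    with s show ?thesis by (intro exI[of _ "{}"]) simp
  next
    case (Equal u v)
    show ?thesis
    proof (intro exI[of _ "{}"] conjI, goal_cases)
      case 2
      show ?case
        by (rule disjI2, rule disjI1, rule exI[of _ "tcode u"], rule exI[of _ "tcode (substt K T u)"],
            rule exI[of _ "tcode v"], rule exI[of _ "tcode (substt K T v)"])
          (simp add: s Equal)
    qed auto
  next
    case (Leq u v)
    show ?thesis
    proof (intro exI[of _ "{}"] conjI, goal_cases)
      case 2
      show ?case
        by (rule disjI2, rule disjI1, rule exI[of _ "tcode u"], rule exI[of _ "tcode (substt K T u)"],
            rule exI[of _ "tcode v"], rule exI[of _ "tcode (substt K T v)"])
          (simp add: s Leq)
    qed auto
  next
    case (Imp u v)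
    show ?thesis
    proof (intro exI[of _ "{?c u, ?c v}"] conjI, goal_cases)
      case 2
      show ?case
        by (rule disjI2, rule disjI2, rule disjI1, rule exI[of _ "fcode u"], rule exI[of _ "fcode (subst K T u)"],
            rule exI[of _ "fcode v"], rule exI[of _ "fcode (subst K T v)"])
          (simp add: s Imp)
    qed (use s in \<open>auto simp: Imp\<close>)
  next
    case (Forall j u)
    show ?thesis
    proof (cases "j = K")
      case True
      show ?thesis
      proof (intro exI[of _ "{}"] conjI, goal_cases)
        case 2
        show ?case
          by (rule disjI2, rule disjI2, rule disjI2, rule disjI1, rule exI[of _ "fcode u"])
            (simp add: s Forall True)
      qed auto
    next
      case False
      with s(3) Forall have *: "j \<notin> fvt T" "free_for T K u" by auto
      show ?thesis
      proof (intro exI[of _ "{?c u}"] conjI, goal_cases)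
        case 2
        show ?case
          by (rule disjI2, rule disjI2, rule disjI2, rule disjI2, rule exI[of _ j],
              rule exI[of _ "fcode u"], rule exI[of _ "fcode (subst K T u)"])
            (simp add: s Forall * False)
      qed (use s * in \<open>auto simp: Forall\<close>)
    qed
  qed
qed (use ub in auto)
  then show ?thesis by (simp add: T_def K_def)
qed

lemma sat_not_free_fm [simp]:
  assumes "ub k \<le> d" "ub x \<le> d"
  shows "sat e (not_free_fm d k x) \<longleftrightarrow> val e k \<notin> fv (fd (val e x))"
  unfolding not_free_fm_def using assms
  by (simp add: free_for_Zero) (metis fcode_fd fcode_inj subst_Zero)

lemma fvt_le_tcode: "k \<in> fvt t \<Longrightarrow> k \<le> tcode t"
proof (induction t)
  case (Plus s t)
  then show ?case
    using le_prod_encode_1[of "tcode s" "tcode t"] le_prod_encode_2[of "tcode t" "tcode s"] by auto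
next
  case (Times s t)
  then show ?case
    using le_prod_encode_1[of "tcode s" "tcode t"] le_prod_encode_2[of "tcode t" "tcode s"] by auto
qed auto

lemma fv_le_fcode: "k \<in> fv \<phi> \<Longrightarrow> k \<le> fcode \<phi>"
proof (induction \<phi>)
  case (Equal s t)
  then show ?case
    using le_prod_encode_1[of "tcode s" "tcode t"] le_prod_encode_2[of "tcode t" "tcode s"]
    by (fastforce dest: fvt_le_tcode)
next
  case (Leq s t)
  then show ?case
    using le_prod_encode_1[of "tcode s" "tcode t"] le_prod_encode_2[of "tcode t" "tcode s"]
    by (fastforce dest: fvt_le_tcode)
next
  case (Imp s t)
  then show ?case
    using le_prod_encode_1[of "fcode s" "fcode t"] le_prod_encode_2[of "fcode t" "fcode s"] by auto
next
  case (Forall j s)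
  then show ?case
    using le_prod_encode_2[of "fcode s" j] by auto
qed auto

lemma sat_sentence_fm [simp]:
  "ub x \<le> d \<Longrightarrow> sat e (sentence_fm d x) \<longleftrightarrow> sentence (fd (val e x))"
  unfolding sentence_fm_def sentence_def
  by simp (metis all_not_in_conv fcode_fd fv_le_fcode)

subsection \<open>Proofs and conjunctions of axioms\<close>

lemma sat_logical_axiom_fm [simp]:
  assumes "ub x \<le> d"
  shows "sat e (logical_axiom_fm d x) \<longleftrightarrow> logical_axiom (fd (val e x))"
proof -
  have "sat e (logical_axiom_fm d x) \<longleftrightarrow>
      (\<exists>p q. val e x = fcode (fd p \<^bold>\<rightarrow> fd q \<^bold>\<rightarrow> fd p))
    \<or> (\<exists>p q r. val e x = fcode ((fd p \<^bold>\<rightarrow> fd q \<^bold>\<rightarrow> fd r) \<^bold>\<rightarrow> (fd p \<^bold>\<rightarrow> fd q) \<^bold>\<rightarrow> fd p \<^bold>\<rightarrow> fd r))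
    \<or> (\<exists>p. val e x = fcode (\<^bold>\<not> (\<^bold>\<not> fd p) \<^bold>\<rightarrow> fd p))
    \<or> (\<exists>k t p q. free_for (td t) k (fd p) \<and> q = fcode (subst k (td t) (fd p)) \<and>
        val e x = fcode (Forall k (fd p) \<^bold>\<rightarrow> fd q))
    \<or> (\<exists>k p q. k \<notin> fv (fd p) \<and>
        val e x = fcode (Forall k (fd p \<^bold>\<rightarrow> fd q) \<^bold>\<rightarrow> fd p \<^bold>\<rightarrow> Forall k (fd q)))
    \<or> (\<exists>t. val e x = fcode (td t \<^bold>= td t))
    \<or> (\<exists>k s t p q r. (free_for (td s) k (fd p) \<and> q = fcode (subst k (td s) (fd p))) \<and>
        (free_for (td t) k (fd p) \<and> r = fcode (subst k (td t) (fd p))) \<and>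
        val e x = fcode (td s \<^bold>= td t \<^bold>\<rightarrow> fd q \<^bold>\<rightarrow> fd r))"
    unfolding logical_axiom_fm_def neg_code_def using assms by simp
  also have "\<dots> \<longleftrightarrow> (\<exists>\<phi>. val e x = fcode \<phi> \<and> logical_axiom \<phi>)"
  proof
    assume "\<exists>\<phi>. val e x = fcode \<phi> \<and> logical_axiom \<phi>"
    then obtain \<phi> where x: "val e x = fcode \<phi>" and "logical_axiom \<phi>" by blast
    from this(2) show "(\<exists>p q. val e x = fcode (fd p \<^bold>\<rightarrow> fd q \<^bold>\<rightarrow> fd p))
    \<or> (\<exists>p q r. val e x = fcode ((fd p \<^bold>\<rightarrow> fd q \<^bold>\<rightarrow> fd r) \<^bold>\<rightarrow> (fd p \<^bold>\<rightarrow> fd q) \<^bold>\<rightarrow> fd p \<^bold>\<rightarrow> fd r))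
    \<or> (\<exists>p. val e x = fcode (\<^bold>\<not> (\<^bold>\<not> fd p) \<^bold>\<rightarrow> fd p))
    \<or> (\<exists>k t p q. free_for (td t) k (fd p) \<and> q = fcode (subst k (td t) (fd p)) \<and>
        val e x = fcode (Forall k (fd p) \<^bold>\<rightarrow> fd q))
    \<or> (\<exists>k p q. k \<notin> fv (fd p) \<and>
        val e x = fcode (Forall k (fd p \<^bold>\<rightarrow> fd q) \<^bold>\<rightarrow> fd p \<^bold>\<rightarrow> Forall k (fd q)))
    \<or> (\<exists>t. val e x = fcode (td t \<^bold>= td t))
    \<or> (\<exists>k s t p q r. (free_for (td s) k (fd p) \<and> q = fcode (subst k (td s) (fd p))) \<and>
        (free_for (td t) k (fd p) \<and> r = fcode (subst k (td t) (fd p))) \<and>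
        val e x = fcode (td s \<^bold>= td t \<^bold>\<rightarrow> fd q \<^bold>\<rightarrow> fd r))"
    proof cases
      case (1 \<phi> \<psi>)
      show ?thesis
        by (rule disjI1, rule exI[of _ "fcode \<phi>"], rule exI[of _ "fcode \<psi>"]) (simp add: x 1)
    next
      case (2 \<phi> \<psi> \<chi>)
      show ?thesis
        by (rule disjI2, rule disjI1, rule exI[of _ "fcode \<phi>"],
            rule exI[of _ "fcode \<psi>"], rule exI[of _ "fcode \<chi>"]) (simp add: x 2)
    next
      case (3 \<phi>)
      show ?thesis
        by (rule disjI2, rule disjI2, rule disjI1, rule exI[of _ "fcode \<phi>"]) (simp add: x 3)
    next
      case (4 t k \<phi>)
      show ?thesis
        by (rule disjI2, rule disjI2, rule disjI2, rule disjI1, rule exI[of _ k],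
            rule exI[of _ "tcode t"], rule exI[of _ "fcode \<phi>"]) (simp add: x 4)
    next
      case (5 k \<phi> \<psi>)
      show ?thesis
        by (rule disjI2, rule disjI2, rule disjI2, rule disjI2, rule disjI1,
            rule exI[of _ k], rule exI[of _ "fcode \<phi>"], rule exI[of _ "fcode \<psi>"]) (simp add: x 5)
    next
      case (6 t)
      show ?thesis
        by (rule disjI2, rule disjI2, rule disjI2, rule disjI2, rule disjI2,
            rule disjI1, rule exI[of _ "tcode t"]) (simp add: x 6)
    next
      case (7 s k \<phi> t)
      show ?thesis
        by (rule disjI2, rule disjI2, rule disjI2, rule disjI2, rule disjI2,
            rule disjI2, rule exI[of _ k], rule exI[of _ "tcode s"],
            rule exI[of _ "tcode t"], rule exI[of _ "fcode \<phi>"]) (simp add: x 7)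
    qed
  qed (elim disjE exE conjE; simp only: fd_fcode fcode_inj; blast intro: logical_axiom.intros)
  also have "\<dots> \<longleftrightarrow> logical_axiom (fd (val e x))" by (metis fcode_fd fd_fcode)
  finally show ?thesis .
qed

theorem Proof_fm_correct:
  assumes "ub u \<le> d" "ub x \<le> d"
  shows "sat e (Proof_fm d u x) \<longleftrightarrow>
    (\<exists>ps. codes_proof (val e u) ps \<and> is_proof {} ps \<and> fcode (last ps) = val e x)"
proof -
  define P where "P = (\<lambda>y S. logical_axiom (fd y) \<or> (\<exists>p. p \<in> S \<and> 4 * prod_encode (p, y) + 3 \<in> S)
    \<or> (\<exists>k p. p \<in> S \<and> y = 4 * prod_encode (k, p) + 4))"
  let ?R = "\<lambda>d y prev. logical_axiom_fm d y
         \<^bold>\<or> ex d (\<lambda>d p. prev d p \<^bold>\<and> imp_code d p y (\<lambda>d z. prev d z))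
         \<^bold>\<or> ex d (\<lambda>d k. ex d (\<lambda>d p. prev d p \<^bold>\<and> all_code d k p (\<lambda>d z. y \<^bold>= z)))"
  have R: "rule_sem d e ?R P" for d e
    unfolding rule_sem_def P_def
  proof (intro allI impI, goal_cases)
    case (1 d' e' y prev S)
    then show ?case by simp
  qed
  have "sat e (Proof_fm d u x) \<longleftrightarrow>
    (\<exists>a b l. val e u = prod_encode (a, prod_encode (b, l)) \<and> beta a b l = val e x \<and>
       (\<forall>i\<le>l. P (beta a b i) (beta a b ` {..<i})))"
    unfolding Proof_fm_def using assms by (simp add: sat_derivation[OF R])
  also have "\<dots> \<longleftrightarrow> (\<exists>ps. codes_proof (val e u) ps \<and> is_proof {} ps \<and> fcode (last ps) = val e x)"
  proof -
    have *: "(\<forall>i\<le>l. P (beta a b i) (beta a b ` {..<i})) \<longleftrightarrow> is_proof {} ps"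
      if ps: "map fcode ps = map (beta a b) [0..<Suc l]" for a b l ps
    proof -
      have len: "length ps = Suc l" using arg_cong[OF ps, of length] by simp
      have nth: "fcode (ps ! i) = beta a b i" if "i \<le> l" for i
        using arg_cong[OF ps, of "\<lambda>xs. xs ! i"] that len by (simp del: upt_Suc)
      have "P (beta a b i) (beta a b ` {..<i}) \<longleftrightarrow>
          logical_axiom (ps ! i)
         \<or> (\<exists>\<phi>. \<phi> \<in> set (take i ps) \<and> (\<phi> \<^bold>\<rightarrow> ps ! i) \<in> set (take i ps))
         \<or> (\<exists>k \<phi>. \<phi> \<in> set (take i ps) \<and> ps ! i = Forall k \<phi>)" if "i \<le> l" for i
      proof -
        have "set (take i ps) = (\<lambda>j. ps ! j) ` {..<i}"
          using that len by (simp add: nth_image[symmetric] atLeast0LessThan)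
        then have S: "beta a b ` {..<i} = fcode ` set (take i ps)"
          using nth that by (auto simp: image_image)
        have mem: "fcode \<phi> \<in> fcode ` A \<longleftrightarrow> \<phi> \<in> A" for \<phi> A by auto
        have "fd (beta a b i) = ps ! i" using nth[OF that] by (metis fd_fcode)
        moreover have "(\<exists>p. p \<in> fcode ` A \<and> 4 * prod_encode (p, beta a b i) + 3 \<in> fcode ` A) \<longleftrightarrow>
            (\<exists>\<phi>. \<phi> \<in> A \<and> (\<phi> \<^bold>\<rightarrow> ps ! i) \<in> A)" for A
          using mem[of "_ \<^bold>\<rightarrow> ps ! i" A] nth[OF that] by auto
        moreover have "(\<exists>k p. p \<in> fcode ` A \<and> beta a b i = 4 * prod_encode (k, p) + 4) \<longleftrightarrow>
            (\<exists>k \<phi>. \<phi> \<in> A \<and> ps ! i = Forall k \<phi>)" for A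
          unfolding nth[OF that, symmetric] fcode.simps(5)[symmetric]
          by (metis (no_types, lifting) fcode.simps(5) fcode_inj imageE imageI)
        ultimately show ?thesis unfolding P_def S by simp
      qed
      then show ?thesis by (simp add: is_proof_def len less_Suc_eq_le)
    qed
    have last: "fcode (last ps) = beta a b l" if ps: "map fcode ps = map (beta a b) [0..<Suc l]" for a b l ps
    proof -
      from ps have "ps \<noteq> []" by auto
      then show ?thesis using arg_cong[OF ps, of last] by (simp add: last_map)
    qed
    have "\<exists>ps. map fcode ps = map (beta a b) [0..<Suc l]" for a b l
      by (rule exI[of _ "map (\<lambda>i. fd (beta a b i)) [0..<Suc l]"]) (simp add: comp_def)
    then show ?thesis unfolding codes_proof_def using * last by metis
  qed
  finally show ?thesis .
qed

lemma sat_holds_at: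
  assumes "defines_axioms \<sigma> T" "0 \<notin> fvt t"
  shows "sat e (holds_at \<sigma> t) \<longleftrightarrow> val e t \<in> fcode ` T"
proof -
  have "val (e(0 := m)) t = val e t" for m
    using assms(2) by (induction t) auto
  then show ?thesis
    using assms(1) by (simp add: holds_at_def defines_axioms_def)
qed

theorem ConjAx_fm_correct:
  assumes "defines_axioms \<sigma> T" "0 < d" "ub s \<le> d"
  shows "sat e (ConjAx_fm \<sigma> d s) \<longleftrightarrow> conjunction_of T (fd (val e s))"
  unfolding ConjAx_fm_def
proof (rule sat_gen[where \<mu> = id and P = "\<lambda>y S. y \<in> fcode ` T \<or>
      (\<exists>p q. p \<in> S \<and> q \<in> S \<and> y = fcode (fd p \<^bold>\<and> fd q))" and Q = "\<lambda>y. conjunction_of T (fd y)"], goal_cases)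
  case 1
  show ?case
    unfolding rule_sem_def
  proof (intro allI impI, goal_cases)
    case (1 d' e' y prev S)
    then have "0 \<notin> fvt y" using assms by auto
    then show ?case using 1 assms by (simp add: sat_holds_at neg_code_def and_code_def And_def)
  qed
next
  case (3 y S S')
  then show ?case by blast
next
  case (4 y S)
  from 4(1) show ?case
  proof (elim disjE exE conjE)
    fix p q assume "p \<in> S" "q \<in> S" "y = fcode (fd p \<^bold>\<and> fd q)"
    with 4(2) show ?thesis by (simp add: conjunction_of.intros(2))
  qed (auto intro: conjunction_of.intros(1))
next
  case (5 y)
  then obtain \<phi> where y: "y = fcode \<phi>" and "conjunction_of T \<phi>" by (metis fcode_fd)
  from this(2) show ?case
  proof cases
    case 1
    then show ?thesis by (intro exI[of _ "{}"]) (auto simp: y)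
  next
    case (2 \<psi> \<chi>)
    have "fcode \<psi> < y" "fcode \<chi> < y"
      unfolding y 2(1) And_def fcode.simps
      by (meson less_node less_trans zero_less_numeral)+
    with 2 have "finite {fcode \<psi>, fcode \<chi>}"
      "\<exists>p q. p \<in> {fcode \<psi>, fcode \<chi>} \<and> q \<in> {fcode \<psi>, fcode \<chi>} \<and> y = fcode (fd p \<^bold>\<and> fd q)"
      "\<forall>z\<in>{fcode \<psi>, fcode \<chi>}. conjunction_of T (fd z) \<and> id z < id y"
      by (simp, intro exI[of _ "fcode \<psi>"] exI[of _ "fcode \<chi>"], simp add: y, simp)
    then show ?thesis by blast
  qed
qed (use assms in auto)

lemma codes_proof_exists: "ps \<noteq> [] \<Longrightarrow> \<exists>u. codes_proof u ps"
proof -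
  assume "ps \<noteq> []"
  obtain a b where ab: "\<forall>i\<le>length ps. beta a b i = fcode (ps ! i)"
    using beta_exists[of "length ps" "\<lambda>i. fcode (ps ! i)"] by blast
  have "map fcode ps = map (beta a b) [0..<Suc (length ps - 1)]"
    using ab \<open>ps \<noteq> []\<close> by (intro nth_equalityI) (auto simp del: upt_Suc)
  then show ?thesis unfolding codes_proof_def by blast
qed

subsection \<open>Instances and the arithmetical hierarchy\<close>

lemma fvt_numeral_tm [simp]: "fvt (numeral_tm m) = {}"
  by (induction m) auto

lemma free_for_closed [simp]: "fvt t = {} \<Longrightarrow> free_for t k \<phi>"
  by (induction \<phi>) auto

lemma val_closed: "fvt t = {} \<Longrightarrow> val e t = val e' t"
  by (induction t) auto

lemma val_agree: "(\<And>k. k \<in> fvt t \<Longrightarrow> e k = e' k) \<Longrightarrow> val e t = val e' t"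
  by (induction t) auto

lemma sat_agree: "(\<And>k. k \<in> fv \<phi> \<Longrightarrow> e k = e' k) \<Longrightarrow> sat e \<phi> \<longleftrightarrow> sat e' \<phi>"
proof (induction \<phi> arbitrary: e e')
  case (Equal s t)
  then show ?case using val_agree[of s e e'] val_agree[of t e e'] by auto
next
  case (Leq s t)
  then show ?case using val_agree[of s e e'] val_agree[of t e e'] by auto
next
  case (Imp \<phi> \<psi>)
  have "sat e \<phi> = sat e' \<phi>" by (rule Imp.IH(1)) (simp add: Imp.prems)
  moreover have "sat e \<psi> = sat e' \<psi>" by (rule Imp.IH(2)) (simp add: Imp.prems)
  ultimately show ?case by simp
next
  case (Forall k \<phi>)
  have "sat (e(k := m)) \<phi> = sat (e'(k := m)) \<phi>" for m
    by (rule Forall.IH) (use Forall.prems in auto)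
  then show ?case by simp
qed simp

lemma sat_sentence: "sentence \<phi> \<Longrightarrow> sat e \<phi> \<longleftrightarrow> (\<nat> \<Turnstile> \<phi>)"
  unfolding true_in_N_def sentence_def by (metis empty_iff sat_agree)

lemma val_substt: "val e (substt k t s) = val (e(k := val e t)) s"
  by (induction s) auto

lemma sat_subst: "fvt t = {} \<Longrightarrow> sat e (subst k t \<phi>) \<longleftrightarrow> sat (e(k := val e t)) \<phi>"
proof (induction \<phi> arbitrary: e)
  case (Forall j \<phi>)
  have "val (e(j := m)) t = val e t" for m
    using val_closed Forall.prems by blast
  moreover have "e(j := m, k := v) = e(k := v, j := m)" if "j \<noteq> k" for m v
    using that by (rule fun_upd_twist)
  ultimately show ?case
    using Forall by (cases "j = k") (simp_all del: fun_upd_apply)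
qed (auto simp: val_substt)

lemma fvt_substt: "fvt t = {} \<Longrightarrow> fvt (substt k t s) = fvt s - {k}"
  by (induction s) auto

lemma fv_subst: "fvt t = {} \<Longrightarrow> fv (subst k t \<phi>) = fv \<phi> - {k}"
  by (induction \<phi>) (auto simp: fvt_substt)

primrec fsize :: "fm \<Rightarrow> nat" where
  "fsize Bot = 0"
| "fsize (s \<^bold>= t) = 0"
| "fsize (s \<^bold>\<le> t) = 0"
| "fsize (\<phi> \<^bold>\<rightarrow> \<psi>) = Suc (fsize \<phi> + fsize \<psi>)"
| "fsize (Forall k \<phi>) = Suc (fsize \<phi>)"

lemma fsize_subst [simp]: "fsize (subst k t \<phi>) = fsize \<phi>"
  by (induction \<phi>) auto

lemma is_Delta0_simps [simp]:
  "is_Delta0 Bot" "is_Delta0 (s \<^bold>= t)" "is_Delta0 (s \<^bold>\<le> t)"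
  "is_Delta0 (\<phi> \<^bold>\<rightarrow> \<psi>) \<longleftrightarrow> is_Delta0 \<phi> \<and> is_Delta0 \<psi>"
  by (auto intro: is_Delta0.intros elim: is_Delta0.cases)

lemma is_Delta0_Forall:
  "is_Delta0 (Forall k \<phi>) \<longleftrightarrow>
    (\<exists>t \<psi>. \<phi> = (Var k \<^bold>\<le> t \<^bold>\<rightarrow> \<psi>) \<and> k \<notin> fvt t \<and> is_Delta0 \<psi>)"
  by (auto intro: is_Delta0.intros elim: is_Delta0.cases)

lemma Exists_inj [simp]: "Exists k \<phi> = Exists j \<psi> \<longleftrightarrow> k = j \<and> \<phi> = \<psi>"
  by (simp add: Exists_def)

lemma substt_eq_Var: "fvt t = {} \<Longrightarrow> substt k t s = Var j \<longleftrightarrow> s = Var j \<and> j \<noteq> k"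
  by (cases s) auto

lemma is_Delta0_subst: "fvt t = {} \<Longrightarrow> is_Delta0 (subst k t \<phi>) \<longleftrightarrow> is_Delta0 \<phi>"
proof (induction "fsize \<phi>" arbitrary: \<phi> rule: less_induct)
  case less
  show ?case
  proof (cases \<phi>)
    case (Forall j \<psi>)
    show ?thesis
    proof (cases "j = k")
      case False
      have "is_Delta0 (Forall j (subst k t \<psi>)) \<longleftrightarrow> is_Delta0 (Forall j \<psi>)"
      proof (cases \<psi>)
        case (Imp \<psi>1 \<psi>2)
        have "is_Delta0 (subst k t \<psi>2) \<longleftrightarrow> is_Delta0 \<psi>2"
          using less Forall Imp by simp
        then show ?thesis unfolding Imp is_Delta0_Forall
          using less.prems False by (cases \<psi>1) (auto simp: substt_eq_Var fvt_substt)
      qed (auto simp: is_Delta0_Forall)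
      then show ?thesis using False Forall by simp
    qed (simp add: Forall)
  qed (use less in auto)
qed

lemma is_Sigma_0 [simp]: "is_Sigma 0 \<phi> \<longleftrightarrow> is_Delta0 \<phi>" "is_Pi 0 \<phi> \<longleftrightarrow> is_Delta0 \<phi>"
  by (auto intro: is_Sigma_is_Pi.intros elim: is_Sigma.cases is_Pi.cases)

lemma is_Sigma_Suc:
  "is_Sigma (Suc n) \<phi> \<longleftrightarrow> is_Pi n \<phi> \<or> (\<exists>k \<psi>. \<phi> = Exists k \<psi> \<and> is_Sigma (Suc n) \<psi>)"
  by (auto intro: is_Sigma_is_Pi.intros elim: is_Sigma.cases)

lemma is_Pi_Suc:
  "is_Pi (Suc n) \<phi> \<longleftrightarrow> is_Sigma n \<phi> \<or> (\<exists>k \<psi>. \<phi> = Forall k \<psi> \<and> is_Pi (Suc n) \<psi>)"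
  by (auto intro: is_Sigma_is_Pi.intros elim: is_Pi.cases)

lemma subst_eq_Forall:
  "subst k t \<phi> = Forall j \<psi> \<longleftrightarrow> (\<exists>\<chi>. \<phi> = Forall j \<chi> \<and> \<psi> = (if j = k then \<chi> else subst k t \<chi>))"
  by (cases \<phi>) auto

lemma subst_eq_Imp:
  "subst k t \<phi> = (\<psi>1 \<^bold>\<rightarrow> \<psi>2) \<longleftrightarrow> (\<exists>\<chi>1 \<chi>2. \<phi> = (\<chi>1 \<^bold>\<rightarrow> \<chi>2) \<and> \<psi>1 = subst k t \<chi>1 \<and> \<psi>2 = subst k t \<chi>2)"
  by (cases \<phi>) auto

lemma subst_eq_Bot: "Bot = subst k t \<phi> \<longleftrightarrow> \<phi> = Bot"
  by (cases \<phi>) auto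

lemma subst_eq_Exists:
  "subst k t \<phi> = Exists j \<psi> \<longleftrightarrow> (\<exists>\<chi>. \<phi> = Exists j \<chi> \<and> \<psi> = (if j = k then \<chi> else subst k t \<chi>))"
  unfolding Exists_def subst_eq_Imp
  by (auto simp: subst_eq_Bot eq_commute[of "Forall _ _"] subst_eq_Forall subst_eq_Imp eq_commute[of "_ \<^bold>\<rightarrow> _"] split: if_splits)

lemma fsize_Exists: "fsize (Exists k \<phi>) = fsize \<phi> + 3"
  by (simp add: Exists_def)

lemma hierarchy_subst:
  assumes "fvt t = {}"
  shows "(is_Sigma n (subst k t \<phi>) \<longleftrightarrow> is_Sigma n \<phi>) \<and> (is_Pi n (subst k t \<phi>) \<longleftrightarrow> is_Pi n \<phi>)"
proof (induction n arbitrary: \<phi>)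
  case 0
  then show ?case using is_Delta0_subst[OF assms] by simp
next
  case (Suc n)
  have "is_Sigma (Suc n) (subst k t \<phi>) \<longleftrightarrow> is_Sigma (Suc n) \<phi>" for \<phi>
  proof (induction "fsize \<phi>" arbitrary: \<phi> rule: less_induct)
    case less
    have "is_Sigma (Suc n) (if j = k then \<chi> else subst k t \<chi>) \<longleftrightarrow> is_Sigma (Suc n) \<chi>"
      if "\<phi> = Exists j \<chi>" for j \<chi>
      using less[of \<chi>] that by (simp add: fsize_Exists)
    then show ?case
      unfolding is_Sigma_Suc[of n "subst k t \<phi>"] is_Sigma_Suc[of n \<phi>] subst_eq_Exists
      using Suc[of \<phi>] by blast
  qed
  moreover have "is_Pi (Suc n) (subst k t \<phi>) \<longleftrightarrow> is_Pi (Suc n) \<phi>" for \<phi>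
  proof (induction "fsize \<phi>" arbitrary: \<phi> rule: less_induct)
    case less
    have "is_Pi (Suc n) (if j = k then \<chi> else subst k t \<chi>) \<longleftrightarrow> is_Pi (Suc n) \<chi>"
      if "\<phi> = Forall j \<chi>" for j \<chi>
      using less[of \<chi>] that by (simp)
    then show ?case
      unfolding is_Pi_Suc[of n "subst k t \<phi>"] is_Pi_Suc[of n \<phi>] subst_eq_Forall
      using Suc[of \<phi>] by blast
  qed
  ultimately show ?case by blast
qed

lemma sat_numeral_fm [simp]:
  assumes "ub m \<le> d" "ub c \<le> d"
  shows "sat e (numeral_fm d m c) \<longleftrightarrow> val e c = tcode (numeral_tm (val e m))"
  unfolding numeral_fm_def
proof (rule sat_gen2[where \<mu> = id and Q = "\<lambda>m c. c = tcode (numeral_tm m)" and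
    P = "\<lambda>m c prev. m = 0 \<and> c = 0 \<or> (\<exists>m' c'. m = Suc m' \<and> c = 4 * c' + 2 \<and> prev m' c')"], goal_cases)
  case 1
  show ?case unfolding rule2_sem_def
  proof (intro allI impI, goal_cases)
    case (1 d' e' x y prev S)
    then show ?case by simp
  qed
next
  case (6 m c)
  then show ?case
  proof (cases m)
    case (Suc m')
    with 6 show ?thesis by (intro exI[of _ "{(m', tcode (numeral_tm m'))}"]) auto
  qed (auto intro: exI[of _ "{}"])
qed (use assms in auto)

lemma sat_instance_fm [simp]:
  assumes "ub k \<le> d" "ub m \<le> d" "ub p \<le> d"
  shows "sat e (instance_fm d k m p F) \<longleftrightarrow>
    sat (e(d := tcode (numeral_tm (val e m)),
           Suc d := fcode (subst (val e k) (numeral_tm (val e m)) (fd (val e p)))))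
      (F (Suc (Suc d)) (Var (Suc d)))"
  unfolding instance_fm_def using assms by simp

lemma sat_value_fm [simp]:
  assumes "ub x \<le> d" "ub m \<le> d"
  shows "sat e (value_fm d x m) \<longleftrightarrow> fvt (td (val e x)) = {} \<and> val e m = val e0 (td (val e x))"
  unfolding value_fm_def
proof (rule sat_gen2[where \<mu> = id and Q = "\<lambda>x m. fvt (td x) = {} \<and> m = val e0 (td x)" and
    P = "\<lambda>x m prev. x = 0 \<and> m = 0 \<or> (\<exists>u i. x = 4 * u + 2 \<and> m = Suc i \<and> prev u i) \<or>
      (\<exists>u i v j. prev u i \<and> prev v j \<and>
         (x = 4 * prod_encode (u, v) + 3 \<and> m = i + j \<or> x = 4 * prod_encode (u, v) + 4 \<and> m = i * j))"],
    goal_cases)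
  case 1
  show ?case unfolding rule2_sem_def
  proof (intro allI impI, goal_cases)
    case (1 d' e' x y prev S)
    then show ?case by simp
  qed
next
  case (4 x y S S')
  from 4(1) show ?case by (elim disj_forward ex_forward conj_forward) (simp_all add: 4(2))
next
  case (5 x m)
  then have "\<exists>t. x = tcode t \<and> fvt t = {} \<and> m = val e0 t"
    apply (elim disjE exE conjE)
       apply (rule exI[of _ Zero]; simp)
      subgoal for u i by (rule exI[of _ "Succ (td u)"]; simp)
     subgoal for u i v j by (rule exI[of _ "Plus (td u) (td v)"]; simp)
    subgoal for u i v j by (rule exI[of _ "Times (td u) (td v)"]; simp)
    done
  then show ?case by auto
next
  case (6 x m)
  then obtain t where t: "x = tcode t" "fvt t = {}" "m = val e0 t" by (metis tcode_td)
  let ?c = "\<lambda>t. (tcode t, val e0 t)"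
  show ?case
  proof (cases t)
    case Zero
    with t show ?thesis by (intro exI[of _ "{}"]) auto
  next
    case (Succ u)
    with t show ?thesis by (intro exI[of _ "{?c u}"]) auto
  next
    case (Plus u v)
    show ?thesis
    proof (intro exI[of _ "{?c u, ?c v}"] conjI, goal_cases)
      case 2
      show ?case
        by (rule disjI2, rule disjI2, rule exI[of _ "tcode u"], rule exI[of _ "val e0 u"],
            rule exI[of _ "tcode v"], rule exI[of _ "val e0 v"]) (simp add: t Plus)
    qed (use t in \<open>auto simp: Plus\<close>)
  next
    case (Times u v)
    show ?thesis
    proof (intro exI[of _ "{?c u, ?c v}"] conjI, goal_cases)
      case 2
      show ?case
        by (rule disjI2, rule disjI2, rule exI[of _ "tcode u"], rule exI[of _ "val e0 u"],
            rule exI[of _ "tcode v"], rule exI[of _ "val e0 v"]) (simp add: t Times)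
    qed (use t in \<open>auto simp: Times\<close>)
  qed (use t in auto)
qed (use assms in auto)

subsection \<open>Truth and soundness\<close>

lemma sentence_simps [simp]:
  "sentence Bot" "sentence (s \<^bold>= t) \<longleftrightarrow> fvt s = {} \<and> fvt t = {}"
  "sentence (s \<^bold>\<le> t) \<longleftrightarrow> fvt s = {} \<and> fvt t = {}"
  "sentence (\<phi> \<^bold>\<rightarrow> \<psi>) \<longleftrightarrow> sentence \<phi> \<and> sentence \<psi>"
  by (auto simp: sentence_def)

lemma sentence_Forall: "sentence (Forall k \<phi>) \<longleftrightarrow> sentence (subst k (numeral_tm m) \<phi>)"
  by (simp add: sentence_def fv_subst)

lemma sentence_Exists: "sentence (Exists k \<phi>) \<longleftrightarrow> sentence (subst k (numeral_tm m) \<phi>)"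
  by (simp add: Exists_def sentence_def fv_subst)

definition tr :: "fm \<Rightarrow> bool" where "tr \<phi> \<longleftrightarrow> sat (\<lambda>_. 0) \<phi>"

lemma tr_true: "sentence \<phi> \<Longrightarrow> tr \<phi> \<longleftrightarrow> (\<nat> \<Turnstile> \<phi>)"
  unfolding tr_def by (rule sat_sentence)

lemma sentence_subst_sat: "sentence (Forall k \<phi>) \<Longrightarrow> sat (e(k := m)) \<phi> \<longleftrightarrow> tr (subst k (numeral_tm m) \<phi>)"
  using sat_sentence[of "subst k (numeral_tm m) \<phi>" e] tr_true[of "subst k (numeral_tm m) \<phi>"]
    sentence_Forall[of k \<phi> m] sat_subst[of "numeral_tm m" e k \<phi>] by simp

lemma tr_simps [simp]: "\<not> tr Bot" "tr (\<phi> \<^bold>\<rightarrow> \<psi>) \<longleftrightarrow> (tr \<phi> \<longrightarrow> tr \<psi>)"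
  by (simp_all add: tr_def)

lemma tr_Forall: "sentence (Forall k \<phi>) \<Longrightarrow> tr (Forall k \<phi>) \<longleftrightarrow> (\<forall>m. tr (subst k (numeral_tm m) \<phi>))"
  by (simp add: tr_def[of "Forall k \<phi>"] sentence_subst_sat)

lemma tr_Exists: "sentence (Forall k \<phi>) \<Longrightarrow> tr (Exists k \<phi>) \<longleftrightarrow> (\<exists>m. tr (subst k (numeral_tm m) \<phi>))"
  by (simp add: tr_def[of "Exists k \<phi>"] sentence_subst_sat)

abbreviation v0 :: "tm \<Rightarrow> nat" where "v0 \<equiv> val (\<lambda>_. 0)"

lemma tr_ball:
  assumes "sentence (Forall k (Var k \<^bold>\<le> t \<^bold>\<rightarrow> \<phi>))" "k \<notin> fvt t"
  shows "tr (Forall k (Var k \<^bold>\<le> t \<^bold>\<rightarrow> \<phi>)) \<longleftrightarrow> (\<forall>m\<le>v0 t. tr (subst k (numeral_tm m) \<phi>))"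
    "fvt t = {}" "sentence (subst k (numeral_tm m) \<phi>)"
proof -
  show t: "fvt t = {}" "sentence (subst k (numeral_tm m) \<phi>)"
    using assms by (auto simp: sentence_def fv_subst)
  have "substt k (numeral_tm m) t = t" for m
    using t(1) by (induction t) auto
  then show "tr (Forall k (Var k \<^bold>\<le> t \<^bold>\<rightarrow> \<phi>)) \<longleftrightarrow> (\<forall>m\<le>v0 t. tr (subst k (numeral_tm m) \<phi>))"
    unfolding tr_Forall[OF assms(1)] by (simp add: tr_def[of "_ \<^bold>\<le> _"])
qed

definition D0v :: "fm \<Rightarrow> nat \<Rightarrow> bool" where
  "D0v \<phi> b \<longleftrightarrow> is_Delta0 \<phi> \<and> sentence \<phi> \<and> b = of_bool (tr \<phi>)"

lemma D0v_ball: "k \<notin> fvt t \<Longrightarrow> fvt t = {} \<Longrightarrow> \<forall>m\<le>v0 t. is_Delta0 (subst k (numeral_tm m) \<phi>) \<and> sentence (subst k (numeral_tm m) \<phi>) \<Longrightarrow>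
   is_Delta0 (Forall k (Var k \<^bold>\<le> t \<^bold>\<rightarrow> \<phi>)) \<and> sentence (Forall k (Var k \<^bold>\<le> t \<^bold>\<rightarrow> \<phi>))"
  using is_Delta0_subst[of "numeral_tm 0" k \<phi>] 
  by (auto simp: is_Delta0_Forall sentence_def fv_subst dest!: spec[of _ 0])

lemma sat_Delta0_value_fm [simp]:
  assumes "ub x \<le> d" "ub b \<le> d"
  shows "sat e (Delta0_value_fm d x b) \<longleftrightarrow> D0v (fd (val e x)) (val e b)"
  unfolding Delta0_value_fm_def
proof (rule sat_gen2[where \<mu> = "\<lambda>x. fsize (fd x)" and Q = "\<lambda>x b. D0v (fd x) b" and
   P = "\<lambda>x b prev.
       (x = 0 \<and> b = 0)
     \<or> (\<exists>s m t n. (fvt (td s) = {} \<and> m = v0 (td s)) \<and> (fvt (td t) = {} \<and> n = v0 (td t)) \<and>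
         (x = fcode (td s \<^bold>= td t) \<and> (m = n \<and> b = 1 \<or> m \<noteq> n \<and> b = 0) \<or>
          x = fcode (td s \<^bold>\<le> td t) \<and> (m \<le> n \<and> b = 1 \<or> \<not> m \<le> n \<and> b = 0)))
     \<or> (\<exists>p i q j. prev p i \<and> prev q j \<and> x = fcode (fd p \<^bold>\<rightarrow> fd q) \<and>
         (i \<le> j \<and> b = 1 \<or> \<not> i \<le> j \<and> b = 0))
     \<or> (\<exists>k t n p. k \<notin> fvt (td t) \<and> (fvt (td t) = {} \<and> n = v0 (td t)) \<and>
         x = fcode (Forall k (Var k \<^bold>\<le> td t \<^bold>\<rightarrow> fd p)) \<and>
         ((\<forall>m\<le>n. prev (fcode (subst k (numeral_tm m) (fd p))) 1) \<and> b = 1 \<or>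
          (\<forall>m\<le>n. prev (fcode (subst k (numeral_tm m) (fd p))) 0 \<or>
                 prev (fcode (subst k (numeral_tm m) (fd p))) 1) \<and>
          (\<exists>m\<le>n. prev (fcode (subst k (numeral_tm m) (fd p))) 0) \<and> b = 0))"], goal_cases)
  case 1
  show ?case unfolding rule2_sem_def
  proof (intro allI impI, goal_cases)
    case (1 d' e' x y prev S)
    show ?case using 1 by (simp add: sat_value_fm[where ?e0.0 = "\<lambda>_. 0"])
  qed
next
  case (4 x y S S')
  from 4(1) show ?case
    by (elim disj_forward ex_forward conj_forward all_forward imp_forward) (simp_all add: 4(2))
next
  case (5 x b)
  then have "\<exists>\<phi>. x = fcode \<phi> \<and> D0v \<phi> b"
  proof (elim disjE, goal_cases)
    case 1
    then show ?case by (intro exI[of _ Bot]) (simp add: D0v_def)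
  next
    case 2
    then show ?case
      apply (elim exE conjE disjE)
      subgoal for s m t n by (rule exI[of _ "td s \<^bold>= td t"]) (simp add: D0v_def tr_def)
      subgoal for s m t n by (rule exI[of _ "td s \<^bold>= td t"]) (simp add: D0v_def tr_def)
      subgoal for s m t n by (rule exI[of _ "td s \<^bold>\<le> td t"]) (simp add: D0v_def tr_def)
      subgoal for s m t n by (rule exI[of _ "td s \<^bold>\<le> td t"]) (simp add: D0v_def tr_def)
      done
  next
    case 3
    then obtain p i q j where *: "D0v (fd p) i" "D0v (fd q) j" "x = fcode (fd p \<^bold>\<rightarrow> fd q)"
      "i \<le> j \<and> b = 1 \<or> \<not> i \<le> j \<and> b = 0" by blast
    then show ?case
      by (intro exI[of _ "fd p \<^bold>\<rightarrow> fd q"]) (auto simp: D0v_def split: if_splits)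
  next
    case 4
    then obtain k t n p where *: "k \<notin> fvt (td t)" "fvt (td t) = {}" "n = v0 (td t)"
      "x = fcode (Forall k (Var k \<^bold>\<le> td t \<^bold>\<rightarrow> fd p))"
      and **: "(\<forall>m\<le>n. D0v (subst k (numeral_tm m) (fd p)) 1) \<and> b = 1 \<or>
          (\<forall>m\<le>n. D0v (subst k (numeral_tm m) (fd p)) 0 \<or> D0v (subst k (numeral_tm m) (fd p)) 1) \<and>
          (\<exists>m\<le>n. D0v (subst k (numeral_tm m) (fd p)) 0) \<and> b = 0"
      by (simp only: fd_fcode) blast
    from ** have "\<forall>m\<le>v0 (td t). is_Delta0 (subst k (numeral_tm m) (fd p)) \<and> sentence (subst k (numeral_tm m) (fd p))"
      unfolding D0v_def *(3) by blast
    from D0v_ball[OF *(1,2) this]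
    have A: "is_Delta0 (Forall k (Var k \<^bold>\<le> td t \<^bold>\<rightarrow> fd p))" "sentence (Forall k (Var k \<^bold>\<le> td t \<^bold>\<rightarrow> fd p))"
      by blast+
    have "b = of_bool (\<forall>m\<le>n. tr (subst k (numeral_tm m) (fd p)))"
      using ** by (auto simp: D0v_def)
    then show ?case using A tr_ball(1)[OF A(2) *(1)] *(3,4)
      by (intro exI[of _ "Forall k (Var k \<^bold>\<le> td t \<^bold>\<rightarrow> fd p)"]) (simp add: D0v_def del: fcode.simps)
  qed
  then show ?case by auto
next
  case (6 x b)
  then obtain \<phi> where x: "x = fcode \<phi>" and \<phi>: "is_Delta0 \<phi>" "sentence \<phi>" "b = of_bool (tr \<phi>)"
    unfolding D0v_def by (metis fcode_fd)
  let ?c = "\<lambda>\<phi>. (fcode \<phi>, of_bool (tr \<phi>) :: nat)"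
  from \<phi>(1) show ?case
  proof cases
    case 1
    then show ?thesis using x \<phi> by (intro exI[of _ "{}"]) auto
  next
    case (2 s t)
    show ?thesis
    proof (intro exI[of _ "{}"] conjI, goal_cases)
      case 2
      show ?case
        by (rule disjI2, rule disjI1, rule exI[of _ "tcode s"], rule exI[of _ "v0 s"],
            rule exI[of _ "tcode t"], rule exI[of _ "v0 t"])
          (use \<phi> x \<open>\<phi> = (s \<^bold>= t)\<close> in \<open>simp add: tr_def\<close>)
    qed auto
  next
    case (3 s t)
    show ?thesis
    proof (intro exI[of _ "{}"] conjI, goal_cases)
      case 2
      show ?case
        by (rule disjI2, rule disjI1, rule exI[of _ "tcode s"], rule exI[of _ "v0 s"],
            rule exI[of _ "tcode t"], rule exI[of _ "v0 t"])
          (use \<phi> x 3 in \<open>simp add: tr_def\<close>)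
    qed auto
  next
    case (4 \<psi> \<chi>)
    show ?thesis
    proof (intro exI[of _ "{?c \<psi>, ?c \<chi>}"] conjI, goal_cases)
      case 2
      show ?case
        by (rule disjI2, rule disjI2, rule disjI1, rule exI[of _ "fcode \<psi>"], rule exI[of _ "of_bool (tr \<psi>)"],
            rule exI[of _ "fcode \<chi>"], rule exI[of _ "of_bool (tr \<chi>)"])
          (use \<phi> x 4 in simp)
    qed (use \<phi> x 4 in \<open>auto simp: D0v_def simp del: fcode.simps\<close>)
  next
    case (5 \<psi> k t)
    from \<phi>(2) 5 have sen: "sentence (Forall k (Var k \<^bold>\<le> t \<^bold>\<rightarrow> \<psi>))" by simp
    note ball = tr_ball[OF sen 5(3)]
    define S where "S = (\<lambda>m. ?c (subst k (numeral_tm m) \<psi>)) ` {..v0 t}"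
    have in_S: "(fcode (subst k (numeral_tm m) \<psi>), c) \<in> S" if "m \<le> v0 t" "c = of_bool (tr (subst k (numeral_tm m) \<psi>))" for m c
      using that unfolding S_def by auto
    show ?thesis
    proof (intro exI[of _ S] conjI, goal_cases)
      case 1
      show ?case by (simp add: S_def)
    next
      case 2
      have "((\<forall>m\<le>v0 t. (fcode (subst k (numeral_tm m) \<psi>), 1) \<in> S) \<and> b = 1 \<or>
          (\<forall>m\<le>v0 t. (fcode (subst k (numeral_tm m) \<psi>), 0) \<in> S \<or>
                 (fcode (subst k (numeral_tm m) \<psi>), 1) \<in> S) \<and>
          (\<exists>m\<le>v0 t. (fcode (subst k (numeral_tm m) \<psi>), 0) \<in> S) \<and> b = 0)"
      proof (cases "tr \<phi>")
        case True
        then show ?thesis using \<phi>(3) ball(1) 5(1) by (auto intro!: in_S)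
      next
        case False
        have "(fcode (subst k (numeral_tm m) \<psi>), 0) \<in> S \<or> (fcode (subst k (numeral_tm m) \<psi>), 1) \<in> S"
          if "m \<le> v0 t" for m
          using in_S[OF that] by (cases "tr (subst k (numeral_tm m) \<psi>)") auto
        moreover have "\<exists>m\<le>v0 t. (fcode (subst k (numeral_tm m) \<psi>), 0) \<in> S"
          using False ball(1) 5(1) by (auto intro!: in_S)
        ultimately show ?thesis using False \<phi>(3) by auto
      qed
      then show ?case
        using 5 x ball(2)
        by - (rule disjI2, rule disjI2, rule disjI2, rule exI[of _ k], rule exI[of _ "tcode t"],
          rule exI[of _ "v0 t"], rule exI[of _ "fcode \<psi>"], simp only: td_tcode fd_fcode, simp)
    next
      case 3
      show ?case
        using ball(3) 5 x by (auto simp: S_def D0v_def is_Delta0_subst simp del: fcode.simps)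
    qed
  qed
qed (use assms in auto)

lemma sat_is_Delta0_fm [simp]:
  assumes "ub x \<le> d"
  shows "sat e (is_Delta0_fm d x) \<longleftrightarrow> is_Delta0 (fd (val e x))"
  unfolding is_Delta0_fm_def
proof (rule sat_gen[where \<mu> = id and Q = "\<lambda>x. is_Delta0 (fd x)" and P = "\<lambda>x S.
       x = 0
     \<or> (\<exists>s t. x = fcode (td s \<^bold>= td t) \<or> x = fcode (td s \<^bold>\<le> td t))
     \<or> (\<exists>p q. p \<in> S \<and> q \<in> S \<and> x = fcode (fd p \<^bold>\<rightarrow> fd q))
     \<or> (\<exists>k t p. k \<notin> fvt (td t) \<and> p \<in> S \<and> x = fcode (Forall k (Var k \<^bold>\<le> td t \<^bold>\<rightarrow> fd p)))"], goal_cases)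
  case 1
  show ?case unfolding rule_sem_def
  proof (intro allI impI, goal_cases)
    case (1 d' e' y prev S)
    then show ?case by simp
  qed
next
  case (3 y S S')
  then show ?case by blast
next
  case (4 y S)
  then show ?case by (elim disjE exE conjE) (simp_all only: fd_fcode fd_simps is_Delta0_simps is_Delta0_Forall, auto)
next
  case (5 y)
  then obtain \<phi> where y: "y = fcode \<phi>" and "is_Delta0 \<phi>" by (metis fcode_fd)
  from this(2) show ?case
  proof cases
    case (2 s t)
    have "\<exists>u v. y = fcode (td u \<^bold>= td v) \<or> y = fcode (td u \<^bold>\<le> td v)"
      by (rule exI[of _ "tcode s"], rule exI[of _ "tcode t"]) (use y 2 in simp)
    then show ?thesis by (intro exI[of _ "{}"]) simp
  next
    case (3 s t)
    have "\<exists>u v. y = fcode (td u \<^bold>= td v) \<or> y = fcode (td u \<^bold>\<le> td v)"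
      by (rule exI[of _ "tcode s"], rule exI[of _ "tcode t"]) (use y 3 in simp)
    then show ?thesis by (intro exI[of _ "{}"]) simp
  next
    case (4 \<psi> \<chi>)
    show ?thesis
    proof (intro exI[of _ "{fcode \<psi>, fcode \<chi>}"] conjI, goal_cases)
      case 2
      show ?case
        by (rule disjI2, rule disjI2, rule disjI1, rule exI[of _ "fcode \<psi>"], rule exI[of _ "fcode \<chi>"])
          (simp add: y 4)
    qed (use y 4 in auto)
  next
    case (5 \<psi> k t)
    have "fcode \<psi> < y"
      unfolding y 5(1) fcode.simps by (meson less_node less_trans zero_less_numeral)
    show ?thesis
    proof (intro exI[of _ "{fcode \<psi>}"] conjI, goal_cases)
      case 2
      show ?case
        by (rule disjI2, rule disjI2, rule disjI2, rule exI[of _ k], rule exI[of _ "tcode t"], rule exI[of _ "fcode \<psi>"])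
          (use y 5 in simp)
    qed (use \<open>fcode \<psi> < y\<close> y 5 in auto)
  qed (auto simp: y intro: exI[of _ "{}"])
qed (use assms in auto)

lemma sat_ex_code [simp]:
  "ub k \<le> d \<Longrightarrow> ub p \<le> d \<Longrightarrow> ub x \<le> d \<Longrightarrow>
   sat e (ex_code d k p (\<lambda>d z. x \<^bold>= z)) \<longleftrightarrow> val e x = fcode (Exists (val e k) (fd (val e p)))"
  by (simp add: ex_code_def neg_code_def Exists_def)

lemma sat_hierarchy_fm:
  "ub x \<le> d \<Longrightarrow> sat e (is_Sigma_fm n d x) \<longleftrightarrow> is_Sigma n (fd (val e x))"
  "ub x \<le> d \<Longrightarrow> sat e (is_Pi_fm n d x) \<longleftrightarrow> is_Pi n (fd (val e x))"
proof (induction n arbitrary: d e x)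
  case (Suc n)
  {
    case 1
    show ?case unfolding is_Sigma_fm.simps
    proof (rule sat_gen[where \<mu> = "\<lambda>x. fsize (fd x)" and Q = "\<lambda>x. is_Sigma (Suc n) (fd x)" and P = "\<lambda>x S.
        is_Pi n (fd x) \<or> (\<exists>k p. p \<in> S \<and> x = fcode (Exists k (fd p)))"], goal_cases)
      case 1
      show ?case unfolding rule_sem_def
      proof (intro allI impI, goal_cases)
        case (1 d' e' y prev S)
        then show ?case by (simp add: Suc)
      qed
    next
      case (5 y)
      then obtain \<phi> where y: "y = fcode \<phi>" and "is_Sigma (Suc n) \<phi>" by (metis fcode_fd)
      from this(2) consider "is_Pi n \<phi>" | k \<psi> where "\<phi> = Exists k \<psi>" "is_Sigma (Suc n) \<psi>"
        unfolding is_Sigma_Suc[of n \<phi>] by blast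
      then show ?case
      proof cases
        case 1
        then show ?thesis by (intro exI[of _ "{}"]) (simp add: y)
      next
        case 2
        then show ?thesis
          by (intro exI[of _ "{fcode \<psi>}"]) (auto simp: y fsize_Exists intro!: disjI2 exI[of _ "fcode \<psi>"])
      qed
    next
      case (4 y S)
      then show ?case unfolding is_Sigma_Suc[of n "fd y"] by auto
    qed (use 1 in auto)
  next
    case 2
    show ?case unfolding is_Pi_fm.simps
    proof (rule sat_gen[where \<mu> = "\<lambda>x. fsize (fd x)" and Q = "\<lambda>x. is_Pi (Suc n) (fd x)" and P = "\<lambda>x S.
        is_Sigma n (fd x) \<or> (\<exists>k p. p \<in> S \<and> x = fcode (Forall k (fd p)))"], goal_cases)
      case 1
      show ?case unfolding rule_sem_def
      proof (intro allI impI, goal_cases)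
        case (1 d' e' y prev S)
        then show ?case by (simp add: Suc)
      qed
    next
      case (5 y)
      then obtain \<phi> where y: "y = fcode \<phi>" and "is_Pi (Suc n) \<phi>" by (metis fcode_fd)
      from this(2) consider "is_Sigma n \<phi>" | k \<psi> where "\<phi> = Forall k \<psi>" "is_Pi (Suc n) \<psi>"
        unfolding is_Pi_Suc[of n \<phi>] by blast
      then show ?case
      proof cases
        case 1
        then show ?thesis by (intro exI[of _ "{}"]) (simp add: y)
      next
        case 2
        then show ?thesis
          by (intro exI[of _ "{fcode \<psi>}"]) (auto simp: y simp del: fcode.simps intro!: disjI2 exI[of _ "fcode \<psi>"])
      qed
    next
      case (4 y S)
      then show ?case unfolding is_Pi_Suc[of n "fd y"] by (auto simp del: fcode.simps)
    qed (use 2 in auto)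
  }
qed simp_all

lemma sat_truth_fm:
  "ub x \<le> d \<Longrightarrow> sat e (Sigma_True_fm n d x) \<longleftrightarrow>
     is_Sigma n (fd (val e x)) \<and> sentence (fd (val e x)) \<and> tr (fd (val e x))"
  "ub x \<le> d \<Longrightarrow> sat e (Sigma_False_fm n d x) \<longleftrightarrow>
     is_Sigma n (fd (val e x)) \<and> sentence (fd (val e x)) \<and> \<not> tr (fd (val e x))"
  "ub x \<le> d \<Longrightarrow> sat e (Pi_True_fm n d x) \<longleftrightarrow>
     is_Pi n (fd (val e x)) \<and> sentence (fd (val e x)) \<and> tr (fd (val e x))"
  "ub x \<le> d \<Longrightarrow> sat e (Pi_False_fm n d x) \<longleftrightarrow>
     is_Pi n (fd (val e x)) \<and> sentence (fd (val e x)) \<and> \<not> tr (fd (val e x))"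
proof (induction n arbitrary: d e x)
  case 0
  {
    case 1 then show ?case by (simp add: D0v_def)
  next
    case 2 then show ?case by (simp add: D0v_def)
  next
    case 3 then show ?case by (simp add: D0v_def)
  next
    case 4 then show ?case by (simp add: D0v_def)
  }
next
  case (Suc n)
  have A: "sat e (Sigma_True_fm (Suc n) d x) \<longleftrightarrow>
     is_Sigma (Suc n) (fd (val e x)) \<and> sentence (fd (val e x)) \<and> tr (fd (val e x))" if "ub x \<le> d" for e d x
    unfolding Sigma_True_fm.simps
  proof (rule sat_gen[where \<mu> = "\<lambda>x. fsize (fd x)" and
      Q = "\<lambda>x. is_Sigma (Suc n) (fd x) \<and> sentence (fd x) \<and> tr (fd x)" and P = "\<lambda>x S.
      (is_Pi n (fd x) \<and> sentence (fd x) \<and> tr (fd x)) \<or>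
      (\<exists>k p m. x = fcode (Exists k (fd p)) \<and> fcode (subst k (numeral_tm m) (fd p)) \<in> S)"], goal_cases)
    case 1
    show ?case unfolding rule_sem_def
    proof (intro allI impI, goal_cases)
      case (1 d' e' y prev S)
      then show ?case by (simp add: Suc)
    qed
  next
    case (3 y S S')
    then show ?case by blast
  next
    case (4 y S)
    from 4(1) show ?case
    proof (elim disjE exE conjE, goal_cases)
      case 1
      then show ?case by (auto intro: is_Sigma_is_Pi.intros)
    next
      case (2 k p m)
      let ?i = "subst k (numeral_tm m) (fd p)"
      have *: "is_Sigma (Suc n) ?i" "sentence ?i" "tr ?i"
        using 4(2) 2 by (metis fd_fcode)+
      then have "is_Sigma (Suc n) (fd p)" using hierarchy_subst[of "numeral_tm m"] by simp
      moreover have "sentence (Forall k (fd p))" using * sentence_Forall by blast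
      moreover have "sentence (Exists k (fd p))" using * sentence_Exists by blast
      ultimately show ?case
        using *(3) 2 by (auto simp: tr_Exists intro: is_Sigma_is_Pi.intros)
    qed
  next
    case (5 y)
    then obtain \<phi> where y: "y = fcode \<phi>" and "is_Sigma (Suc n) \<phi>" and \<phi>: "sentence \<phi>" "tr \<phi>" by (metis fcode_fd)
    from this(2) consider "is_Pi n \<phi>" | k \<psi> where "\<phi> = Exists k \<psi>" "is_Sigma (Suc n) \<psi>"
      unfolding is_Sigma_Suc[of n \<phi>] by blast
    then show ?case
    proof cases
      case 1
      then show ?thesis using \<phi> by (intro exI[of _ "{}"]) (simp add: y)
    next
      case 2
      then have s: "sentence (Forall k \<psi>)" using \<phi> sentence_Exists sentence_Forall by blast
      then obtain m where m: "tr (subst k (numeral_tm m) \<psi>)"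
        using 2 \<phi> by (auto simp: tr_Exists)
      have "is_Sigma (Suc n) (subst k (numeral_tm m) \<psi>)"
        using 2 hierarchy_subst[of "numeral_tm m"] by simp
      moreover have "sentence (subst k (numeral_tm m) \<psi>)" using s sentence_Forall by blast
      ultimately show ?thesis using 2 m
        by (intro exI[of _ "{fcode (subst k (numeral_tm m) \<psi>)}"] conjI disjI2
            exI[of _ k] exI[of _ "fcode \<psi>"] exI[of _ m])
          (auto simp: y fsize_Exists)
    qed
  qed (use that in auto)
  have B: "sat e (Pi_False_fm (Suc n) d x) \<longleftrightarrow>
     is_Pi (Suc n) (fd (val e x)) \<and> sentence (fd (val e x)) \<and> \<not> tr (fd (val e x))" if "ub x \<le> d" for e d x
    unfolding Pi_False_fm.simps
  proof (rule sat_gen[where \<mu> = "\<lambda>x. fsize (fd x)" and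
      Q = "\<lambda>x. is_Pi (Suc n) (fd x) \<and> sentence (fd x) \<and> \<not> tr (fd x)" and P = "\<lambda>x S.
      (is_Sigma n (fd x) \<and> sentence (fd x) \<and> \<not> tr (fd x)) \<or>
      (\<exists>k p m. x = fcode (Forall k (fd p)) \<and> fcode (subst k (numeral_tm m) (fd p)) \<in> S)"], goal_cases)
    case 1
    show ?case unfolding rule_sem_def
    proof (intro allI impI, goal_cases)
      case (1 d' e' y prev S)
      then show ?case by (simp add: Suc)
    qed
  next
    case (3 y S S')
    then show ?case by blast
  next
    case (4 y S)
    from 4(1) show ?case
    proof (elim disjE exE conjE, goal_cases)
      case 1
      then show ?case by (auto intro: is_Sigma_is_Pi.intros)
    next
      case (2 k p m)
      let ?i = "subst k (numeral_tm m) (fd p)"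
      have *: "is_Pi (Suc n) ?i" "sentence ?i" "\<not> tr ?i"
        using 4(2) 2 by (metis fd_fcode)+
      then have "is_Pi (Suc n) (fd p)" using hierarchy_subst[of "numeral_tm m"] by simp
      moreover have s: "sentence (Forall k (fd p))" using * sentence_Forall by blast
      moreover have "fd y = Forall k (fd p)" using 2 by (simp only: fd_fcode)
      ultimately show ?case
        using *(3) by (auto simp: tr_Forall intro: is_Sigma_is_Pi.intros)
    qed
  next
    case (5 y)
    then obtain \<phi> where y: "y = fcode \<phi>" and "is_Pi (Suc n) \<phi>" and \<phi>: "sentence \<phi>" "\<not> tr \<phi>" by (metis fcode_fd)
    from this(2) consider "is_Sigma n \<phi>" | k \<psi> where "\<phi> = Forall k \<psi>" "is_Pi (Suc n) \<psi>"
      unfolding is_Pi_Suc[of n \<phi>] by blast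
    then show ?case
    proof cases
      case 1
      then show ?thesis using \<phi> by (intro exI[of _ "{}"]) (simp add: y)
    next
      case 2
      then have s: "sentence (Forall k \<psi>)" using \<phi> by blast
      then obtain m where m: "\<not> tr (subst k (numeral_tm m) \<psi>)"
        using 2 \<phi> by (auto simp: tr_Forall)
      have "is_Pi (Suc n) (subst k (numeral_tm m) \<psi>)"
        using 2 hierarchy_subst[of "numeral_tm m"] by simp
      moreover have "sentence (subst k (numeral_tm m) \<psi>)" using s sentence_Forall by blast
      ultimately show ?thesis using 2 m
        by (intro exI[of _ "{fcode (subst k (numeral_tm m) \<psi>)}"] conjI disjI2
            exI[of _ k] exI[of _ "fcode \<psi>"] exI[of _ m])
          (auto simp: y simp del: fcode.simps)
    qed
  qed (use that in auto)
  {
    case 1 then show ?case by (rule A)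
  next
    case 2 then show ?case using A[OF 2] sat_hierarchy_fm(1)[OF 2, of e "Suc n"]
      by (simp only: Sigma_False_fm.simps sat_And sat.simps sat_sentence_fm) blast
  next
    case 3 then show ?case using B[OF 3] sat_hierarchy_fm(2)[OF 3, of e "Suc n"]
      by (simp only: Pi_True_fm.simps sat_And sat.simps sat_sentence_fm) blast
  next
    case 4 then show ?case by (rule B)
  }
qed

theorem Pi_True_fm_correct:
  assumes "ub x \<le> d" "val e x = fcode \<phi>"
  shows "sat e (Pi_True_fm n d x) \<longleftrightarrow> is_Pi n \<phi> \<and> sentence \<phi> \<and> (\<nat> \<Turnstile> \<phi>)"
  using sat_truth_fm(3)[OF assms(1), of e n] assms(2) tr_true by auto

theorem Sound_fm_correct:
  assumes "defines_axioms \<sigma> T"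
  shows "(\<nat> \<Turnstile> Sound_fm n \<sigma>) \<longleftrightarrow>
    (\<forall>\<phi> \<psi>. conjunction_of T \<phi> \<and> is_Pi n \<psi> \<and> sentence \<psi> \<and> (\<nat> \<Turnstile> \<psi>) \<longrightarrow>
       \<not> {} \<turnstile> (\<^bold>\<not> (\<phi> \<^bold>\<and> \<psi>)))"
proof -
  have P: "(\<exists>u ps. codes_proof u ps \<and> is_proof {} ps \<and> fcode (last ps) = fcode \<phi>) \<longleftrightarrow> {} \<turnstile> \<phi>" for \<phi>
  proof -
    have "ps \<noteq> []" if "codes_proof u ps" for u ps
      using that by (auto simp: codes_proof_def)
    then show ?thesis
      unfolding proves_def using codes_proof_exists by (metis fcode_inj)
  qed
  have "(\<nat> \<Turnstile> Sound_fm n \<sigma>) \<longleftrightarrow>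
    (\<forall>s t u. conjunction_of T (fd s) \<and> is_Pi n (fd t) \<and> sentence (fd t) \<and> (\<nat> \<Turnstile> fd t) \<longrightarrow>
       \<not> (\<exists>ps. codes_proof u ps \<and> is_proof {} ps \<and> fcode (last ps) = fcode (\<^bold>\<not> (fd s \<^bold>\<and> fd t))))"
  proof -
    have "fcode (\<phi> \<^bold>\<and> \<psi>) = 4 * prod_encode (4 * prod_encode (fcode \<phi>,
        4 * prod_encode (fcode \<psi>, 0) + 3) + 3, 0) + 3" for \<phi> \<psi>
      by (simp add: And_def)
    then have "sat e (Sound_fm n \<sigma>) \<longleftrightarrow>
      (\<forall>s t u. conjunction_of T (fd s) \<and> is_Pi n (fd t) \<and> sentence (fd t) \<and> (\<nat> \<Turnstile> fd t) \<longrightarrow>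
       \<not> (\<exists>ps. codes_proof u ps \<and> is_proof {} ps \<and> fcode (last ps) = fcode (\<^bold>\<not> (fd s \<^bold>\<and> fd t))))" for e
      by (simp add: Sound_fm_def ConjAx_fm_correct[OF assms] Pi_True_fm_correct[where \<phi> = "fd _"]
          and_code_def neg_code_def Proof_fm_correct)
    then show ?thesis unfolding true_in_N_def[of "Sound_fm n \<sigma>"] by blast
  qed
  also have "\<dots> \<longleftrightarrow> (\<forall>s t. conjunction_of T (fd s) \<and> is_Pi n (fd t) \<and> sentence (fd t) \<and> (\<nat> \<Turnstile> fd t) \<longrightarrow>
       \<not> {} \<turnstile> (\<^bold>\<not> (fd s \<^bold>\<and> fd t)))"
    unfolding P[symmetric] by blast
  also have "\<dots> \<longleftrightarrow> (\<forall>\<phi> \<psi>. conjunction_of T \<phi> \<and> is_Pi n \<psi> \<and> sentence \<psi> \<and> (\<nat> \<Turnstile> \<psi>) \<longrightarrow>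
       \<not> {} \<turnstile> (\<^bold>\<not> (\<phi> \<^bold>\<and> \<psi>)))"
    by (metis fd_fcode)
  finally show ?thesis .
qed

end

theory Submission
  imports Defs
begin

text \<open>Let \<open>\<theta>\<close> be the (universally closed) soundness sentence of \<open>\<sigma>\<close>, where \<open>\<sigma>(x)\<close> says self-referentially that \<open>x\<close> is an
  axiom of PA, or \<open>x\<close> is \<open>\<theta>\<close> and PA together with \<open>\<theta>\<close> is \<open>\<Sigma>\<^sub>n\<^sub>-\<^sub>1\<close>-sound. If PA with \<open>\<theta>\<close> were
  unsound, then \<open>\<sigma>\<close> would define PA, which is sound, so \<open>\<theta>\<close> would be true and PA with \<open>\<theta>\<close> sound
  after all. Hence \<open>\<sigma>\<close> defines PA with \<open>\<theta>\<close>, this theory is true, and it proves \<open>\<theta>\<close> because \<open>\<theta>\<close> is an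
  axiom. The extra condition on \<open>\<theta>\<close> is \<open>\<Pi>\<^sub>n\<close>, so \<open>\<sigma>\<close> is \<open>\<Sigma>\<^sub>n\<^sub>+\<^sub>1\<close>. The
  self-reference is needed only up to truth in the standard model, not provably in PA.\<close>

section \<open>Closure properties of the arithmetical hierarchy\<close>

text \<open>Levels are assigned to conditions on assignments, that is, to formulas up to equivalence
  in \<nat>. \<open>is_Sigma\<close> admits only a quantifier prefix in front of a Delta_0 matrix,
  so already the conjunction of two existential formulas leaves the class.\<close>

definition Sg :: "nat \<Rightarrow> ((nat \<Rightarrow> nat) \<Rightarrow> bool) \<Rightarrow> bool" where
  "Sg n P \<longleftrightarrow> (\<exists>\<phi>. is_Sigma n \<phi> \<and> (\<forall>e. sat e \<phi> \<longleftrightarrow> P e))"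

definition Pg :: "nat \<Rightarrow> ((nat \<Rightarrow> nat) \<Rightarrow> bool) \<Rightarrow> bool" where
  "Pg n P \<longleftrightarrow> (\<exists>\<phi>. is_Pi n \<phi> \<and> (\<forall>e. sat e \<phi> \<longleftrightarrow> P e))"

lemma finite_fvt: "finite (fvt t)"
  by (induction t) auto

lemma finite_fv: "finite (fv \<phi>)"
  by (induction \<phi>) (auto simp: finite_fvt)

lemma sat_upd_notin: "k \<notin> fv \<phi> \<Longrightarrow> sat (e(k := m)) \<phi> \<longleftrightarrow> sat e \<phi>"
  by (rule sat_agree) auto

lemma val_upd_notin: "k \<notin> fvt t \<Longrightarrow> val (e(k := m)) t = val e t"
  by (rule val_agree) auto

text \<open>A threshold in place of a single fresh index allows further freshness conditions to be
  met by a larger index.\<close>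

lemma sat_upd_large: "\<exists>N. \<forall>c\<ge>N. \<forall>e m. sat (e(c := m)) \<phi> \<longleftrightarrow> sat e \<phi>"
proof -
  obtain N where "\<forall>k\<in>fv \<phi>. k < N"
    using finite_fv[of \<phi>] finite_nat_set_iff_bounded by blast
  then show ?thesis using sat_upd_notin by (intro exI[of _ N]) (auto simp: not_le[symmetric])
qed

lemma val_upd_large: "\<exists>N. \<forall>c\<ge>N. c \<notin> fvt t"
proof -
  obtain N where "\<forall>k\<in>fvt t. k < N"
    using finite_fvt[of t] finite_nat_set_iff_bounded by blast
  then show ?thesis by (intro exI[of _ N]) (auto simp: not_le[symmetric])
qed

text \<open>Negation dualizes the prefix quantifier by quantifier, down to the Delta_0 matrix, where
  implication to \<open>Bot\<close> is available.\<close>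

lemma hierarchy_neg:
  "(is_Sigma n \<phi> \<longrightarrow> (\<exists>\<psi>. is_Pi n \<psi> \<and> (\<forall>e. sat e \<psi> \<longleftrightarrow> \<not> sat e \<phi>))) \<and>
   (is_Pi n \<phi> \<longrightarrow> (\<exists>\<psi>. is_Sigma n \<psi> \<and> (\<forall>e. sat e \<psi> \<longleftrightarrow> \<not> sat e \<phi>)))"
proof -
  have "is_Sigma n \<phi> \<Longrightarrow> \<exists>\<psi>. is_Pi n \<psi> \<and> (\<forall>e. sat e \<psi> \<longleftrightarrow> \<not> sat e \<phi>)"
    and "is_Pi n \<phi> \<Longrightarrow> \<exists>\<psi>. is_Sigma n \<psi> \<and> (\<forall>e. sat e \<psi> \<longleftrightarrow> \<not> sat e \<phi>)" for n \<phi>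
  proof (induction rule: is_Sigma_is_Pi.inducts)
    case (1 \<phi>)
    then show ?case by (intro exI[of _ "\<^bold>\<not> \<phi>"]) simp
  next
    case (2 \<phi>)
    then show ?case by (intro exI[of _ "\<^bold>\<not> \<phi>"]) simp
  next
    case (4 n \<phi> k)
    then obtain \<psi> where "is_Pi (Suc n) \<psi>" "\<forall>e. sat e \<psi> \<longleftrightarrow> \<not> sat e \<phi>" by blast
    then show ?case by (intro exI[of _ "Forall k \<psi>"]) (auto intro: is_Sigma_is_Pi.intros)
  next
    case (6 n \<phi> k)
    then obtain \<psi> where "is_Sigma (Suc n) \<psi>" "\<forall>e. sat e \<psi> \<longleftrightarrow> \<not> sat e \<phi>" by blast
    then show ?case by (intro exI[of _ "Exists k \<psi>"]) (auto intro: is_Sigma_is_Pi.intros)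
  qed (blast intro: is_Sigma_is_Pi.intros)+
  then show ?thesis by blast
qed

lemma Pg_iff: "Pg n P \<longleftrightarrow> Sg n (\<lambda>e. \<not> P e)"
proof
  assume "Pg n P"
  then obtain \<phi> where "is_Pi n \<phi>" "\<forall>e. sat e \<phi> \<longleftrightarrow> P e" unfolding Pg_def by blast
  then show "Sg n (\<lambda>e. \<not> P e)" using hierarchy_neg[of n \<phi>] unfolding Sg_def by simp
next
  assume "Sg n (\<lambda>e. \<not> P e)"
  then obtain \<phi> where "is_Sigma n \<phi>" "\<forall>e. sat e \<phi> \<longleftrightarrow> \<not> P e" unfolding Sg_def by blast
  then show "Pg n P" using hierarchy_neg[of n \<phi>] unfolding Pg_def by simp
qed

lemma hierarchy_Suc:
  "is_Sigma n \<phi> \<Longrightarrow> is_Sigma (Suc n) \<phi>" "is_Pi n \<phi> \<Longrightarrow> is_Pi (Suc n) \<phi>"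
  by (induction rule: is_Sigma_is_Pi.inducts) (auto intro: is_Sigma_is_Pi.intros)

lemma hierarchy_mono:
  assumes "m \<le> n"
  shows "is_Sigma m \<phi> \<Longrightarrow> is_Sigma n \<phi>" "is_Pi m \<phi> \<Longrightarrow> is_Pi n \<phi>"
  using assms by (induction rule: dec_induct) (auto intro: hierarchy_Suc)

lemma Sg_mono: "Sg m P \<Longrightarrow> m \<le> n \<Longrightarrow> Sg n P"
  unfolding Sg_def using hierarchy_mono by blast

lemma Pg_imp_Sg: "Pg n P \<Longrightarrow> Sg (Suc n) P"
  unfolding Sg_def Pg_def by (blast intro: is_Sigma_is_Pi.intros)

lemma Sg_ex: "Sg (Suc n) P \<Longrightarrow> Sg (Suc n) (\<lambda>e. \<exists>m. P (e(k := m)))"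
  unfolding Sg_def
  apply (elim exE conjE)
  subgoal for \<phi> by (rule exI[of _ "Exists k \<phi>"]) (simp add: is_Sigma_is_Pi.intros)
  done

text \<open>The four conditions are bundled because negation permutes them: conjunction with
  disjunction, bounded universal with bounded existential quantification. The bundle thus passes
  from Sigma_n to Pi_n as a whole, which drives the induction in
  \<open>bounded_closed_Sg\<close>.\<close>

definition bounded_closed :: "(((nat \<Rightarrow> nat) \<Rightarrow> bool) \<Rightarrow> bool) \<Rightarrow> bool" where
  "bounded_closed X \<longleftrightarrow>
     (\<forall>P Q. X P \<longrightarrow> X Q \<longrightarrow> X (\<lambda>e. P e \<and> Q e)) \<and>
     (\<forall>P Q. X P \<longrightarrow> X Q \<longrightarrow> X (\<lambda>e. P e \<or> Q e)) \<and>
     (\<forall>P k t. X P \<longrightarrow> k \<notin> fvt t \<longrightarrow> X (\<lambda>e. \<forall>m\<le>val e t. P (e(k := m)))) \<and>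
     (\<forall>P k t. X P \<longrightarrow> k \<notin> fvt t \<longrightarrow> X (\<lambda>e. \<exists>m\<le>val e t. P (e(k := m))))"

lemma bounded_closedD:
  assumes "bounded_closed X"
  shows "X P \<Longrightarrow> X Q \<Longrightarrow> X (\<lambda>e. P e \<and> Q e)"
    "X P \<Longrightarrow> X Q \<Longrightarrow> X (\<lambda>e. P e \<or> Q e)"
    "X P \<Longrightarrow> k \<notin> fvt t \<Longrightarrow> X (\<lambda>e. \<forall>m\<le>val e t. P (e(k := m)))"
    "X P \<Longrightarrow> k \<notin> fvt t \<Longrightarrow> X (\<lambda>e. \<exists>m\<le>val e t. P (e(k := m)))"
  using assms unfolding bounded_closed_def by blast+

lemma bounded_closed_dual:
  assumes "bounded_closed (Sg n)"
  shows "bounded_closed (Pg n)"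
  unfolding bounded_closed_def Pg_iff
proof (intro conjI allI impI, goal_cases)
  case (1 P Q)
  then show ?case using bounded_closedD(2)[OF assms, of "\<lambda>e. \<not> P e" "\<lambda>e. \<not> Q e"] by simp
next
  case (2 P Q)
  then show ?case using bounded_closedD(1)[OF assms, of "\<lambda>e. \<not> P e" "\<lambda>e. \<not> Q e"] by simp
next
  case (3 P k t)
  then show ?case using bounded_closedD(4)[OF assms, of "\<lambda>e. \<not> P e" k t] by simp
next
  case (4 P k t)
  then show ?case using bounded_closedD(3)[OF assms, of "\<lambda>e. \<not> P e" k t] by simp
qed

text \<open>Since the matrix can be made monotone in the quantified variable, that variable may be shared
  by several formulas, so that no bound variable ever has to be renamed.\<close>

lemma Sg_Suc_normal:
  assumes "bounded_closed (Pg n)" "Sg (Suc n) P"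
  shows "\<exists>N. \<forall>c\<ge>N. \<exists>Q. Pg n Q \<and> (\<forall>e. P e \<longleftrightarrow> (\<exists>x. Q (e(c := x)))) \<and>
    (\<forall>e x y. x \<le> y \<longrightarrow> Q (e(c := x)) \<longrightarrow> Q (e(c := y)))"
proof -
  have "\<exists>N. \<forall>c\<ge>N. \<exists>Q. Pg n Q \<and> (\<forall>e. sat e \<phi> \<longleftrightarrow> (\<exists>x. Q (e(c := x)))) \<and>
    (\<forall>e x y. x \<le> y \<longrightarrow> Q (e(c := x)) \<longrightarrow> Q (e(c := y)))"
    if "is_Sigma (Suc n) \<phi>" for \<phi>
    using that
  proof (induction "fsize \<phi>" arbitrary: \<phi> rule: less_induct)
    case less
    from less.prems consider "is_Pi n \<phi>" | k \<psi> where "\<phi> = Exists k \<psi>" "is_Sigma (Suc n) \<psi>"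
      unfolding is_Sigma_Suc[of n \<phi>] by blast
    then show ?case
    proof cases
      case 1
      then have "Pg n (\<lambda>e. sat e \<phi>)" unfolding Pg_def by blast
      moreover obtain N where "\<forall>c\<ge>N. \<forall>e m. sat (e(c := m)) \<phi> \<longleftrightarrow> sat e \<phi>"
        using sat_upd_large by blast
      ultimately show ?thesis by (intro exI[of _ N] allI impI exI[of _ "\<lambda>e. sat e \<phi>"]) auto
    next
      case 2
      have "fsize \<psi> < fsize \<phi>" using 2 by (simp add: fsize_Exists)
      from less.hyps[OF this 2(2)] obtain N where N: "\<forall>c\<ge>N. \<exists>Q. Pg n Q \<and>
        (\<forall>e. sat e \<psi> \<longleftrightarrow> (\<exists>x. Q (e(c := x)))) \<and>
        (\<forall>e x y. x \<le> y \<longrightarrow> Q (e(c := x)) \<longrightarrow> Q (e(c := y)))" by blast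
      show ?thesis
      proof (intro exI[of _ "max N (Suc k)"] allI impI)
        fix c assume c: "max N (Suc k) \<le> c"
        then obtain Q where Q: "Pg n Q" "\<And>e. sat e \<psi> \<longleftrightarrow> (\<exists>x. Q (e(c := x)))"
          "\<And>e x y. x \<le> y \<Longrightarrow> Q (e(c := x)) \<Longrightarrow> Q (e(c := y))"
          using N[rule_format, of c] by auto
        have ck: "c \<noteq> k" using c by auto
        have tw: "e(k := m, c := x) = e(c := x, k := m)" for e :: "nat \<Rightarrow> nat" and m x
          using ck by (simp add: fun_upd_twist)
        \<comment> \<open>The variable \<open>c\<close> now serves twice, as witness for
          \<open>Q\<close> and as bound for \<open>k\<close>, so that two unbounded quantifiers
          become one. Monotonicity of \<open>Q\<close> permits enlarging its witness to the common
          bound.\<close>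
        have "Pg n (\<lambda>e. \<exists>m\<le>val e (Var c). Q (e(k := m)))"
          by (rule bounded_closedD(4)[OF assms(1) Q(1)]) (use ck in simp)
        moreover have "sat e \<phi> \<longleftrightarrow> (\<exists>x. \<exists>m\<le>val (e(c := x)) (Var c). Q (e(c := x, k := m)))" for e
        proof
          assume "sat e \<phi>"
          then obtain m x where "Q (e(k := m, c := x))" unfolding 2(1) sat_Exists Q(2) by blast
          then have "Q (e(k := m, c := max m x))" by (rule Q(3)[rotated]) simp
          then have "Q (e(c := max m x, k := m))" unfolding tw .
          then show "\<exists>x. \<exists>m\<le>val (e(c := x)) (Var c). Q (e(c := x, k := m))"
            by (intro exI[of _ "max m x"] exI[of _ m]) simp
        next
          assume "\<exists>x. \<exists>m\<le>val (e(c := x)) (Var c). Q (e(c := x, k := m))"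
          then obtain m x where "Q (e(k := m, c := x))" unfolding tw by blast
          then show "sat e \<phi>" unfolding 2(1) sat_Exists Q(2) by blast
        qed
        moreover have "(\<exists>m\<le>val (e(c := x)) (Var c). Q (e(c := x, k := m))) \<Longrightarrow> x \<le> y \<Longrightarrow>
          (\<exists>m\<le>val (e(c := y)) (Var c). Q (e(c := y, k := m)))" for e x y
        proof (elim exE conjE)
          fix m assume "m \<le> val (e(c := x)) (Var c)" "Q (e(c := x, k := m))" "x \<le> y"
          then have "m \<le> y" "Q (e(k := m, c := y))"
            using Q(3)[of x y "e(k := m)"] unfolding tw by simp_all
          then show "\<exists>m\<le>val (e(c := y)) (Var c). Q (e(c := y, k := m))"
            unfolding tw by (intro exI[of _ m]) simp
        qed
        ultimately show "\<exists>Q. Pg n Q \<and> (\<forall>e. sat e \<phi> \<longleftrightarrow> (\<exists>x. Q (e(c := x)))) \<and>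
            (\<forall>e x y. x \<le> y \<longrightarrow> Q (e(c := x)) \<longrightarrow> Q (e(c := y)))" by blast
      qed
    qed
  qed
  moreover obtain \<phi> where \<phi>: "is_Sigma (Suc n) \<phi>" and P: "\<And>e. P e \<longleftrightarrow> sat e \<phi>"
    using assms(2) unfolding Sg_def by blast
  ultimately show ?thesis unfolding P by blast
qed

text \<open>Monotone matrices sharing one variable reduce everything to level n: conjunction takes
  the maximum of the two witnesses, disjunction and the bounded existential quantifier commute with
  the unbounded one, and the bounded universal quantifier uses collection.\<close>

lemma bounded_closed_Sg_Suc:
  assumes n: "bounded_closed (Pg n)"
  shows "bounded_closed (Sg (Suc n))"
proof -
  note closed = bounded_closedD[OF n]
  have Ex: "Sg (Suc n) (\<lambda>e. \<exists>x. Q (e(c := x)))" if "Pg n Q" for Q c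
    using that by (intro Sg_ex Pg_imp_Sg)
  have conn: "Sg (Suc n) (\<lambda>e. P e \<and> P' e) \<and> Sg (Suc n) (\<lambda>e. P e \<or> P' e)"
    if P: "Sg (Suc n) P" "Sg (Suc n) P'" for P P'
  proof -
    obtain N where N: "\<forall>c\<ge>N. \<exists>Q. Pg n Q \<and> (\<forall>e. P e \<longleftrightarrow> (\<exists>x. Q (e(c := x)))) \<and>
      (\<forall>e x y. x \<le> y \<longrightarrow> Q (e(c := x)) \<longrightarrow> Q (e(c := y)))"
      using Sg_Suc_normal[OF n P(1)] by blast
    obtain N' where N': "\<forall>c\<ge>N'. \<exists>Q. Pg n Q \<and> (\<forall>e. P' e \<longleftrightarrow> (\<exists>x. Q (e(c := x)))) \<and>
      (\<forall>e x y. x \<le> y \<longrightarrow> Q (e(c := x)) \<longrightarrow> Q (e(c := y)))"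
      using Sg_Suc_normal[OF n P(2)] by blast
    define c where "c = max N N'"
    obtain Q where Q: "Pg n Q" "\<And>e. P e \<longleftrightarrow> (\<exists>x. Q (e(c := x)))"
        "\<And>e x y. x \<le> y \<Longrightarrow> Q (e(c := x)) \<Longrightarrow> Q (e(c := y))"
      using N[rule_format, of c] by (auto simp: c_def)
    obtain Q' where Q': "Pg n Q'" "\<And>e. P' e \<longleftrightarrow> (\<exists>x. Q' (e(c := x)))"
        "\<And>e x y. x \<le> y \<Longrightarrow> Q' (e(c := x)) \<Longrightarrow> Q' (e(c := y))"
      using N'[rule_format, of c] by (auto simp: c_def)
    have "(P e \<and> P' e) = (\<exists>x. Q (e(c := x)) \<and> Q' (e(c := x)))" for e
    proof
      assume "P e \<and> P' e"
      then obtain x y where "Q (e(c := x))" "Q' (e(c := y))" unfolding Q(2) Q'(2) by blast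
      then have "Q (e(c := max x y))" "Q' (e(c := max x y))"
        by (auto intro: Q(3)[rotated] Q'(3)[rotated])
      then show "\<exists>x. Q (e(c := x)) \<and> Q' (e(c := x))" by blast
    qed (auto simp: Q(2) Q'(2))
    moreover have "(P e \<or> P' e) = (\<exists>x. Q (e(c := x)) \<or> Q' (e(c := x)))" for e
      unfolding Q(2) Q'(2) by blast
    ultimately show ?thesis
      using Ex[OF closed(1)[OF Q(1) Q'(1)]] Ex[OF closed(2)[OF Q(1) Q'(1)]] by simp
  qed
  have quant: "Sg (Suc n) (\<lambda>e. \<forall>m\<le>val e t. P (e(k := m))) \<and>
      Sg (Suc n) (\<lambda>e. \<exists>m\<le>val e t. P (e(k := m)))"
    if P: "Sg (Suc n) P" "k \<notin> fvt t" for P k t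
  proof -
    obtain M where M: "\<forall>c\<ge>M. c \<notin> fvt t" using val_upd_large by blast
    obtain N where N: "\<forall>c\<ge>N. \<exists>Q. Pg n Q \<and> (\<forall>e. P e \<longleftrightarrow> (\<exists>x. Q (e(c := x)))) \<and>
      (\<forall>e x y. x \<le> y \<longrightarrow> Q (e(c := x)) \<longrightarrow> Q (e(c := y)))"
      using Sg_Suc_normal[OF n P(1)] by blast
    \<comment> \<open>\<open>c\<close> must differ from \<open>k\<close> and be absent from
      \<open>t\<close>, so that the unbounded quantifier on \<open>c\<close> can be moved across the
      bounded one on \<open>k\<close>.\<close>
    define c where "c = max (Suc k) (max M N)"
    have "N \<le> c" "M \<le> c" and ck: "c \<noteq> k" by (auto simp: c_def)
    then have ct: "c \<notin> fvt t" using M by blast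
    obtain Q where Q: "Pg n Q" "\<And>e. P e \<longleftrightarrow> (\<exists>x. Q (e(c := x)))"
          "\<And>e x y. x \<le> y \<Longrightarrow> Q (e(c := x)) \<Longrightarrow> Q (e(c := y))"
      using N[rule_format, OF \<open>N \<le> c\<close>] by auto
    have tw: "e(k := m, c := x) = e(c := x, k := m)" for e :: "nat \<Rightarrow> nat" and m x
      using ck by (simp add: fun_upd_twist)
    have "(\<forall>m\<le>val e t. P (e(k := m))) = (\<exists>x. \<forall>m\<le>val (e(c := x)) t. Q (e(c := x, k := m)))" for e
    proof
      assume "\<forall>m\<le>val e t. P (e(k := m))"
      then obtain f where f: "\<forall>m\<le>val e t. Q (e(k := m, c := f m))" unfolding Q(2) by metis
      \<comment> \<open>Collection: only finitely many witnesses occur, and by monotonicity their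
        maximum works for all \<open>m\<close> at once.\<close>
      define x where "x = Max (f ` {..val e t})"
      have "\<forall>m\<le>val e t. f m \<le> x" unfolding x_def by auto
      then have "\<forall>m\<le>val e t. Q (e(k := m, c := x))" using f Q(3) by blast
      then show "\<exists>x. \<forall>m\<le>val (e(c := x)) t. Q (e(c := x, k := m))"
        by (auto simp: tw val_upd_notin[OF ct])
    qed (auto simp: Q(2) tw val_upd_notin[OF ct])
    moreover have "(\<exists>m\<le>val e t. P (e(k := m))) = (\<exists>x. \<exists>m\<le>val (e(c := x)) t. Q (e(c := x, k := m)))" for e
      by (auto simp: Q(2) tw val_upd_notin[OF ct])
    ultimately show ?thesis
      using Ex[OF closed(3)[OF Q(1) P(2)], of c] Ex[OF closed(4)[OF Q(1) P(2)], of c] by simp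
  qed
  show ?thesis unfolding bounded_closed_def using conn quant by blast
qed

lemma bounded_closed_Sg_0: "bounded_closed (Sg 0)"
proof -
  have "Sg 0 (\<lambda>e. P e \<and> Q e) \<and> Sg 0 (\<lambda>e. P e \<or> Q e)" if "Sg 0 P" "Sg 0 Q" for P Q
  proof -
    obtain \<phi> \<psi> where *: "is_Delta0 \<phi>" "\<forall>e. sat e \<phi> \<longleftrightarrow> P e" "is_Delta0 \<psi>" "\<forall>e. sat e \<psi> \<longleftrightarrow> Q e"
      using \<open>Sg 0 P\<close> \<open>Sg 0 Q\<close> unfolding Sg_def by auto
    have "is_Delta0 (\<phi> \<^bold>\<and> \<psi>)" "is_Delta0 (\<phi> \<^bold>\<or> \<psi>)" using * by (simp_all add: And_def Or_def)
    moreover have "sat e (\<phi> \<^bold>\<and> \<psi>) \<longleftrightarrow> P e \<and> Q e" "sat e (\<phi> \<^bold>\<or> \<psi>) \<longleftrightarrow> P e \<or> Q e" for e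
      using * by simp_all
    ultimately show ?thesis unfolding Sg_def is_Sigma_0 by blast
  qed
  moreover have "Sg 0 (\<lambda>e. \<forall>m\<le>val e t. P (e(k := m))) \<and> Sg 0 (\<lambda>e. \<exists>m\<le>val e t. P (e(k := m)))"
    if P: "Sg 0 P" and kt: "k \<notin> fvt t" for P k t
  proof -
    obtain \<phi> where *: "is_Delta0 \<phi>" "\<forall>e. sat e \<phi> \<longleftrightarrow> P e"
      using P unfolding Sg_def by auto
    \<comment> \<open>The bounded existential quantifier is spelled as a negated bounded universal
      one; the body of \<open>exb\<close> unfolds to a formula that is not literally
      \<open>is_Delta0\<close>.\<close>
    have "is_Delta0 (Forall k (Var k \<^bold>\<le> t \<^bold>\<rightarrow> \<phi>))" "is_Delta0 (\<^bold>\<not> Forall k (Var k \<^bold>\<le> t \<^bold>\<rightarrow> \<^bold>\<not> \<phi>))"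
      using * kt by (auto intro: is_Delta0.intros)
    moreover have "sat e (Forall k (Var k \<^bold>\<le> t \<^bold>\<rightarrow> \<phi>)) \<longleftrightarrow> (\<forall>m\<le>val e t. P (e(k := m)))"
      "sat e (\<^bold>\<not> Forall k (Var k \<^bold>\<le> t \<^bold>\<rightarrow> \<^bold>\<not> \<phi>)) \<longleftrightarrow> (\<exists>m\<le>val e t. P (e(k := m)))" for e
      using * by (auto simp: val_upd_notin[OF kt])
    ultimately show ?thesis unfolding Sg_def is_Sigma_0 by blast
  qed
  ultimately show ?thesis unfolding bounded_closed_def by blast
qed

lemma bounded_closed_Sg: "bounded_closed (Sg n)"
  by (induction n) (auto intro: bounded_closed_Sg_0 bounded_closed_Sg_Suc bounded_closed_dual)

lemmas Sg_closed = bounded_closedD[OF bounded_closed_Sg]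

section \<open>Complexity of the arithmetized notions\<close>

text \<open>The builders nest connectives and quantifiers freely, so their level is only meaningful
  up to equivalence.\<close>

definition SF :: "nat \<Rightarrow> fm \<Rightarrow> bool" where "SF n \<phi> \<longleftrightarrow> Sg n (\<lambda>e. sat e \<phi>)"

lemma SF_mono: "SF m \<phi> \<Longrightarrow> m \<le> n \<Longrightarrow> SF n \<phi>"
  unfolding SF_def by (rule Sg_mono)

named_theorems SF_intros

lemma SF_Delta0: "is_Delta0 \<phi> \<Longrightarrow> SF n \<phi>"
  unfolding SF_def by (rule Sg_mono[of 0]) (auto simp: Sg_def)

text \<open>Negated atoms are listed separately because \<open>SF_neg\<close> raises the level,
  which must not happen inside the rules of the generated relations.\<close>

lemma SF_atom [SF_intros]:
  "SF n (s \<^bold>= t)" "SF n (s \<^bold>\<le> t)" "SF n (\<^bold>\<not> (s \<^bold>= t))" "SF n (\<^bold>\<not> (s \<^bold>\<le> t))" "SF n Bot"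
  "SF n (pair_fm s t u)"
  by (simp_all add: SF_Delta0 pair_fm_def)

lemma SF_connectives [SF_intros]:
  "SF n \<phi> \<Longrightarrow> SF n \<psi> \<Longrightarrow> SF n (\<phi> \<^bold>\<and> \<psi>)" "SF n \<phi> \<Longrightarrow> SF n \<psi> \<Longrightarrow> SF n (\<phi> \<^bold>\<or> \<psi>)"
  using Sg_closed(1,2)[of n "\<lambda>e. sat e \<phi>" "\<lambda>e. sat e \<psi>"] by (simp_all add: SF_def)

lemma SF_neg: "SF n \<phi> \<Longrightarrow> SF (Suc n) (\<^bold>\<not> \<phi>)"
  unfolding SF_def by (rule Pg_imp_Sg) (simp add: Pg_iff)

lemma SF_Exists: "0 < n \<Longrightarrow> SF n \<phi> \<Longrightarrow> SF n (Exists k \<phi>)"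
  using Sg_ex[of "n - 1" "\<lambda>e. sat e \<phi>" k] by (simp add: SF_def)

lemma notin_fvt_ub: "ub t \<le> d \<Longrightarrow> d \<notin> fvt t"
  by (induction t) auto

lemma SF_ex [SF_intros]: "0 < n \<Longrightarrow> SF n (F (Suc d) (Var d)) \<Longrightarrow> SF n (ex d F)"
  unfolding ex_def by (rule SF_Exists)

lemma SF_bounded [SF_intros]:
  assumes "ub t \<le> d" "SF n (F (Suc d) (Var d))"
  shows "SF n (allb d t F)" "SF n (exb d t F)"
  using Sg_closed(3,4)[of n "\<lambda>e. sat e (F (Suc d) (Var d))" d t] assms
  by (simp_all add: SF_def notin_fvt_ub)

lemma SF_node [SF_intros]:
  "0 < n \<Longrightarrow> SF n (F (Suc d) (tag r (Var d))) \<Longrightarrow> SF n (node r d x y F)"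
  unfolding node_def by (intro SF_intros)

lemma SF_neg_code [SF_intros]:
  "0 < n \<Longrightarrow> SF n (F (Suc d) (tag 3 (Var d))) \<Longrightarrow> SF n (neg_code d x F)"
  unfolding neg_code_def by (intro SF_intros)

lemma SF_and_code [SF_intros]:
  "0 < n \<Longrightarrow> SF n (F (Suc (Suc (Suc d))) (tag 3 (Var (Suc (Suc d))))) \<Longrightarrow> SF n (and_code d x y F)"
  unfolding and_code_def by (intro SF_intros)

lemma SF_ex_code [SF_intros]:
  "0 < n \<Longrightarrow> SF n (F (Suc (Suc (Suc d))) (tag 3 (Var (Suc (Suc d))))) \<Longrightarrow> SF n (ex_code d k x F)"
  unfolding ex_code_def by (intro SF_intros)

lemma SF_beta_fm [SF_intros]: "0 < n \<Longrightarrow> SF n (beta_fm d a b i y)"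
  unfolding beta_fm_def Let_def by (intro SF_intros)

text \<open>The quantifier over positions is bounded and therefore costs nothing. Treating
  \<open>prev\<close> as an arbitrary Sigma_n formula leaves the rule abstract; the condition is met
  by rules that use \<open>prev\<close> only positively.\<close>

lemma SF_derivation:
  assumes "0 < n" "ub l \<le> d"
    and "\<And>d' y prev. d \<le> d' \<Longrightarrow> ub y \<le> d' \<Longrightarrow> (\<And>d'' z. d' \<le> d'' \<Longrightarrow> SF n (prev d'' z)) \<Longrightarrow>
      SF n (R d' y prev)"
  shows "SF n (derivation d a b l R)"
  unfolding derivation_def
proof (intro SF_intros)
  show "SF n (R (Suc (Suc d)) (Var (Suc d))
      (\<lambda>d' z. exb d' (Var d) (\<lambda>d'' j. Succ j \<^bold>\<le> Var d \<^bold>\<and> beta_fm d'' a b j z)))"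
    by (rule assms(3)) (auto intro!: SF_intros \<open>0 < n\<close>)
qed (use assms in auto)

lemma SF_gen:
  assumes "0 < n"
    and "\<And>d' y prev. d \<le> d' \<Longrightarrow> ub y \<le> d' \<Longrightarrow> (\<And>d'' z. d' \<le> d'' \<Longrightarrow> SF n (prev d'' z)) \<Longrightarrow>
      SF n (R d' y prev)"
  shows "SF n (gen d R x)"
  unfolding gen_def by (intro SF_intros SF_derivation assms) auto

lemma SF_gen2:
  assumes "0 < n"
    and "\<And>d' x y prev. d \<le> d' \<Longrightarrow> ub x \<le> d' \<Longrightarrow> ub y \<le> d' \<Longrightarrow>
      (\<And>d'' u v. d' \<le> d'' \<Longrightarrow> SF n (prev d'' u v)) \<Longrightarrow> SF n (R d' x y prev)"
  shows "SF n (gen2 d R x y)"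
  unfolding gen2_def
  by (intro SF_intros SF_gen assms(1)) (auto intro!: SF_intros assms)

section \<open>Syntactic notions: substitution, free variables, logical axioms and proofs\<close>

lemma SF_substt_fm [SF_intros]: "0 < n \<Longrightarrow> SF n (substt_fm d k t x y)"
  unfolding substt_fm_def by (rule SF_gen2) (auto intro!: SF_intros)

lemma SF_not_free_tm_fm [SF_intros]: "0 < n \<Longrightarrow> SF n (not_free_tm_fm d k x)"
  unfolding not_free_tm_fm_def by (intro SF_intros)

lemma SF_subst_fm [SF_intros]: "0 < n \<Longrightarrow> SF n (subst_fm d k t x y)"
  unfolding subst_fm_def by (rule SF_gen2) (auto intro!: SF_intros)

lemma SF_not_free_fm [SF_intros]: "0 < n \<Longrightarrow> SF n (not_free_fm d k x)"
  unfolding not_free_fm_def by (intro SF_intros)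

lemma SF_sentence_fm [SF_intros]: "0 < n \<Longrightarrow> ub x \<le> d \<Longrightarrow> SF n (sentence_fm d x)"
  unfolding sentence_fm_def by (intro SF_intros)

lemma SF_logical_axiom_fm [SF_intros]: "0 < n \<Longrightarrow> SF n (logical_axiom_fm d x)"
  unfolding logical_axiom_fm_def by (intro SF_intros)

lemma SF_Proof_fm [SF_intros]: "0 < n \<Longrightarrow> SF n (Proof_fm d u x)"
  unfolding Proof_fm_def by (intro SF_intros SF_derivation) (auto intro!: SF_intros)

section \<open>Numerals, values, the hierarchy and the truth predicates\<close>

lemma SF_numeral_fm [SF_intros]: "0 < n \<Longrightarrow> SF n (numeral_fm d m c)"
  unfolding numeral_fm_def by (rule SF_gen2) (auto intro!: SF_intros)

lemma SF_value_fm [SF_intros]: "0 < n \<Longrightarrow> SF n (value_fm d x m)"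
  unfolding value_fm_def by (rule SF_gen2) (auto intro!: SF_intros)

lemma SF_instance_fm [SF_intros]:
  "0 < n \<Longrightarrow> SF n (F (Suc (Suc d)) (Var (Suc d))) \<Longrightarrow> SF n (instance_fm d k m p F)"
  unfolding instance_fm_def by (intro SF_intros)

lemma SF_Delta0_value_fm [SF_intros]: "0 < n \<Longrightarrow> SF n (Delta0_value_fm d x b)"
  unfolding Delta0_value_fm_def by (rule SF_gen2) (auto intro!: SF_intros)

lemma SF_is_Delta0_fm [SF_intros]: "0 < n \<Longrightarrow> SF n (is_Delta0_fm d x)"
  unfolding is_Delta0_fm_def by (rule SF_gen) (auto intro!: SF_intros)

lemma SF_hierarchy_fm:
  "0 < m \<Longrightarrow> SF m (is_Sigma_fm n d x)" "0 < m \<Longrightarrow> SF m (is_Pi_fm n d x)"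
proof (induction n arbitrary: d x)
  case (Suc n)
  {
    case 1
    then show ?case unfolding is_Sigma_fm.simps by (rule SF_gen) (auto intro!: SF_intros Suc.IH 1)
  next
    case 2
    then show ?case unfolding is_Pi_fm.simps by (rule SF_gen) (auto intro!: SF_intros Suc.IH 2)
  }
qed (simp_all add: SF_intros)

text \<open>Truth of Sigma and falsity of Pi sentences of level n + 1 are generated from instances
  over notions that are Sigma_(n+1) by the induction hypothesis, and so stay there. Complementation
  then costs one level, whence the bound \<open>n < m\<close>.\<close>

lemma SF_truth_fm:
  "ub x \<le> d \<Longrightarrow> n < m \<Longrightarrow> SF m (Sigma_False_fm n d x)"
  "ub x \<le> d \<Longrightarrow> n < m \<Longrightarrow> SF m (Pi_True_fm n d x)"
proof (induction n arbitrary: d x m)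
  case (Suc n)
  {
    case 1
    have "SF (Suc n) (Sigma_True_fm (Suc n) d x)"
      unfolding Sigma_True_fm.simps by (rule SF_gen) (auto intro!: SF_intros Suc.IH)
    then have "SF m (\<^bold>\<not> Sigma_True_fm (Suc n) d x)"
      using 1 by (intro SF_mono[OF SF_neg]) auto
    then show ?case
      unfolding Sigma_False_fm.simps using 1 by (intro SF_intros SF_hierarchy_fm) auto
  next
    case 2
    have "SF (Suc n) (Pi_False_fm (Suc n) d x)"
      unfolding Pi_False_fm.simps by (rule SF_gen) (auto intro!: SF_intros Suc.IH)
    then have "SF m (\<^bold>\<not> Pi_False_fm (Suc n) d x)"
      using 2 by (intro SF_mono[OF SF_neg]) auto
    then show ?case
      unfolding Pi_True_fm.simps using 2 by (intro SF_intros SF_hierarchy_fm) auto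
  }
qed (simp_all add: SF_intros)

section \<open>Soundness of the calculus and some derivations\<close>

text \<open>Extends \<open>sat_subst\<close> beyond closed terms, as the quantifier and equality
  axioms require.\<close>

lemma sat_subst_free_for:
  "free_for t k \<phi> \<Longrightarrow> sat e (subst k t \<phi>) \<longleftrightarrow> sat (e(k := val e t)) \<phi>"
proof (induction \<phi> arbitrary: e)
  case (Forall j \<phi>)
  show ?case
  proof (cases "j = k")
    case False
    with Forall.prems have "j \<notin> fvt t" "free_for t k \<phi>" by auto
    then have "val (e(j := m)) t = val e t" for m by (intro val_agree) auto
    moreover have "e(j := m, k := v) = e(k := v, j := m)" for m v
      using False by (simp add: fun_upd_twist)
    ultimately show ?thesis
      using Forall.IH[OF \<open>free_for t k \<phi>\<close>] False by (simp del: fun_upd_apply)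
  qed (simp del: fun_upd_apply)
qed (auto simp: val_substt)

lemma logical_axiom_sound: "logical_axiom \<phi> \<Longrightarrow> sat e \<phi>"
proof (induction rule: logical_axiom.induct)
  case (5 k \<phi> \<psi>)
  then have "sat (e(k := m)) \<phi> \<longleftrightarrow> sat e \<phi>" for m by (intro sat_agree) auto
  then show ?case by simp
qed (auto simp: sat_subst_free_for)

text \<open>Course-of-values induction along the proof. Unrestricted generalization is sound because
  truth in \<nat> means satisfaction under every assignment.\<close>

lemma is_proof_sound:
  assumes T: "\<forall>\<phi>\<in>T. \<nat> \<Turnstile> \<phi>" and ps: "is_proof T ps"
  shows "i < length ps \<Longrightarrow> \<nat> \<Turnstile> ps ! i"
proof (induction i rule: less_induct)
  case (less i)
  have IH: "\<nat> \<Turnstile> \<phi>" if "\<phi> \<in> set (take i ps)" for \<phi>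
    using that less by (auto simp: in_set_conv_nth)
  from ps less.prems consider "ps ! i \<in> T" | "logical_axiom (ps ! i)"
    | \<phi> where "\<phi> \<in> set (take i ps)" "(\<phi> \<^bold>\<rightarrow> ps ! i) \<in> set (take i ps)"
    | k \<phi> where "\<phi> \<in> set (take i ps)" "ps ! i = Forall k \<phi>"
    unfolding is_proof_def by blast
  then show ?case
  proof cases
    case 3
    then show ?thesis using IH[OF 3(1)] IH[OF 3(2)] by (simp add: true_in_N_def)
  next
    case 4
    then show ?thesis using IH[OF 4(1)] by (simp add: true_in_N_def)
  qed (use T logical_axiom_sound in \<open>auto simp: true_in_N_def\<close>)
qed

lemma proves_sound: "T \<turnstile> \<phi> \<Longrightarrow> \<forall>\<psi>\<in>T. \<nat> \<Turnstile> \<psi> \<Longrightarrow> \<nat> \<Turnstile> \<phi>"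
  unfolding proves_def using is_proof_sound[of T] by (auto simp: last_conv_nth)

text \<open>Truth already ranges over all assignments, so universal closure changes nothing. This
  serves the induction axioms and later the closed soundness sentence.\<close>

lemma foldr_Forall_true: "(\<nat> \<Turnstile> foldr Forall ks \<phi>) \<longleftrightarrow> (\<nat> \<Turnstile> \<phi>)"
proof (induction ks)
  case (Cons k ks)
  have "(\<nat> \<Turnstile> Forall k \<psi>) \<longleftrightarrow> (\<nat> \<Turnstile> \<psi>)" for \<psi>
    unfolding true_in_N_def sat.simps by (auto dest: spec) (metis fun_upd_triv)
  with Cons show ?case by simp
qed simp

text \<open>A quantifier on \<open>k\<close> stops the substitution, and any other quantifier binds
  a variable that \<open>t\<close> lacks.\<close>

lemma free_for_same: "fvt t \<subseteq> {k} \<Longrightarrow> free_for t k \<phi>"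
  by (induction \<phi>) auto

lemma induction_fm_true: "\<nat> \<Turnstile> induction_fm k \<phi>"
  unfolding true_in_N_def
proof
  fix e
  have "sat (e(k := m)) \<phi>"
    if "sat (e(k := 0)) \<phi>" "\<forall>m. sat (e(k := m)) \<phi> \<longrightarrow> sat (e(k := Suc m)) \<phi>" for m
    using that(1) by (induction m) (simp_all only: that(2)[rule_format])
  then show "sat e (induction_fm k \<phi>)"
    unfolding induction_fm_def sat.simps
    by (simp only: sat_subst_free_for free_for_same fvt.simps empty_subsetI order_refl val.simps fun_upd_upd fun_upd_same) blast
qed

lemma PA_true: "\<phi> \<in> PA \<Longrightarrow> \<nat> \<Turnstile> \<phi>"
proof (induction rule: PA.induct)
  case (7)
  then show ?case by (auto simp: true_in_N_def le_iff_add add.commute)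
next
  case (8)
  then show ?case by (auto simp: true_in_N_def)
next
  case (9 ks k \<phi>)
  show ?case unfolding foldr_Forall_true by (rule induction_fm_true)
qed (simp_all add: true_in_N_def)

section \<open>Composing derivations\<close>

lemma is_proof_append:
  assumes "is_proof T ps" "is_proof T qs"
  shows "is_proof T (ps @ qs)"
  unfolding is_proof_def
proof (intro allI impI)
  fix i assume i: "i < length (ps @ qs)"
  show "(ps @ qs) ! i \<in> T \<or> logical_axiom ((ps @ qs) ! i)
     \<or> (\<exists>\<phi>. \<phi> \<in> set (take i (ps @ qs)) \<and> (\<phi> \<^bold>\<rightarrow> (ps @ qs) ! i) \<in> set (take i (ps @ qs)))
     \<or> (\<exists>k \<phi>. \<phi> \<in> set (take i (ps @ qs)) \<and> (ps @ qs) ! i = Forall k \<phi>)"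
  proof (cases "i < length ps")
    case True
    then show ?thesis using assms(1)[unfolded is_proof_def, rule_format, of i] by (simp add: nth_append)
  next
    case False
    then have "i - length ps < length qs" "(ps @ qs) ! i = qs ! (i - length ps)"
      "set (take i (ps @ qs)) = set ps \<union> set (take (i - length ps) qs)"
      using i by (auto simp: nth_append)
    then show ?thesis using assms(2)[unfolded is_proof_def, rule_format, of "i - length ps"]
      by (simp only:) blast
  qed
qed

lemma is_proof_snoc:
  assumes "is_proof T ps"
    and "\<chi> \<in> T \<or> logical_axiom \<chi> \<or> (\<exists>\<phi>. \<phi> \<in> set ps \<and> (\<phi> \<^bold>\<rightarrow> \<chi>) \<in> set ps)"
  shows "is_proof T (ps @ [\<chi>])"
  using assms unfolding is_proof_def by (auto simp: nth_append less_Suc_eq)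

lemma proves_intro: "\<phi> \<in> T \<or> logical_axiom \<phi> \<Longrightarrow> T \<turnstile> \<phi>"
  unfolding proves_def using is_proof_snoc[of T "[]" \<phi>]
  by (intro exI[of _ "[\<phi>]"]) (auto simp: is_proof_def)

lemma proves_mp:
  assumes "T \<turnstile> \<phi>" "T \<turnstile> (\<phi> \<^bold>\<rightarrow> \<psi>)"
  shows "T \<turnstile> \<psi>"
proof -
  obtain ps qs where ps: "ps \<noteq> []" "is_proof T ps" "last ps = \<phi>"
    and qs: "qs \<noteq> []" "is_proof T qs" "last qs = (\<phi> \<^bold>\<rightarrow> \<psi>)"
    using assms unfolding proves_def by blast
  have "\<phi> \<in> set (ps @ qs)" "(\<phi> \<^bold>\<rightarrow> \<psi>) \<in> set (ps @ qs)"
    using ps(1,3) qs(1,3) last_in_set by fastforce+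
  then have "is_proof T ((ps @ qs) @ [\<psi>])"
    by (intro is_proof_snoc is_proof_append ps qs) blast
  then show ?thesis unfolding proves_def by (intro exI[of _ "(ps @ qs) @ [\<psi>]"]) simp
qed

lemma extends_supset: "S \<subseteq> T \<Longrightarrow> extends T S"
proof -
  assume "S \<subseteq> T"
  then have "is_proof T ps" if "is_proof S ps" for ps
    using that unfolding is_proof_def by fast
  then show ?thesis unfolding extends_def proves_def by blast
qed

lemma substt_self: "substt k (Var k) t = t"
  by (induction t) auto

lemma subst_self: "subst k (Var k) \<phi> = \<phi>"
  by (induction \<phi>) (auto simp: substt_self)

text \<open>Each quantifier is instantiated with its own variable, which is always free for
  itself.\<close>

lemma proves_foldr_Forall: "T \<turnstile> foldr Forall ks \<phi> \<Longrightarrow> T \<turnstile> \<phi>"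
proof (induction ks)
  case (Cons k ks)
  have "logical_axiom (Forall k (foldr Forall ks \<phi>) \<^bold>\<rightarrow> subst k (Var k) (foldr Forall ks \<phi>))"
    by (intro logical_axiom.intros free_for_same) simp
  then have "T \<turnstile> (Forall k (foldr Forall ks \<phi>) \<^bold>\<rightarrow> foldr Forall ks \<phi>)"
    unfolding subst_self by (intro proves_intro) blast
  from Cons.IH[OF proves_mp[OF _ this]] Cons.prems show ?case by simp
qed simp

lemma fv_foldr_Forall: "fv (foldr Forall ks \<phi>) = fv \<phi> - set ks"
  by (induction ks) auto

section \<open>Axioms of PA and conjunctions of axioms\<close>

text \<open>Separating the finitely many single axioms lets \<open>PA_fm\<close> list them by the
  numerals of their codes; only the induction schema needs genuine arithmetization.\<close>

definition PA_basic :: "fm list" where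
  "PA_basic =
    [Forall 0 (\<^bold>\<not> (Succ (Var 0) \<^bold>= Zero)),
     Forall 0 (Forall 1 (Succ (Var 0) \<^bold>= Succ (Var 1) \<^bold>\<rightarrow> Var 0 \<^bold>= Var 1)),
     Forall 0 (Plus (Var 0) Zero \<^bold>= Var 0),
     Forall 0 (Forall 1 (Plus (Var 0) (Succ (Var 1)) \<^bold>= Succ (Plus (Var 0) (Var 1)))),
     Forall 0 (Times (Var 0) Zero \<^bold>= Zero),
     Forall 0 (Forall 1 (Times (Var 0) (Succ (Var 1)) \<^bold>= Plus (Times (Var 0) (Var 1)) (Var 0))),
     Forall 0 (Forall 1 (Var 0 \<^bold>\<le> Var 1 \<^bold>\<rightarrow> Exists 2 (Plus (Var 2) (Var 0) \<^bold>= Var 1))),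
     Forall 0 (Forall 1 (Exists 2 (Plus (Var 2) (Var 0) \<^bold>= Var 1) \<^bold>\<rightarrow> Var 0 \<^bold>\<le> Var 1))]"

text \<open>The closure prefix is given inductively to match a \<open>gen\<close> rule. Being a
  sentence is not part of it, since it can fail while the prefix is being built;
  \<open>PA_iff\<close> imposes it at the end.\<close>

inductive is_induction :: "fm \<Rightarrow> bool" where
  "is_induction (induction_fm k \<phi>)"
| "is_induction \<phi> \<Longrightarrow> is_induction (Forall k \<phi>)"

lemma is_induction_iff: "is_induction \<psi> \<longleftrightarrow> (\<exists>ks k \<phi>. \<psi> = foldr Forall ks (induction_fm k \<phi>))"
proof
  assume "is_induction \<psi>"
  then show "\<exists>ks k \<phi>. \<psi> = foldr Forall ks (induction_fm k \<phi>)"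
  proof (induction rule: is_induction.induct)
    case (1 k \<phi>)
    show ?case by (rule exI[of _ "[]"]) auto
  next
    case (2 \<psi> j)
    then obtain ks k \<phi> where "\<psi> = foldr Forall ks (induction_fm k \<phi>)" by blast
    then show ?case by (intro exI[of _ "j # ks"] exI[of _ k] exI[of _ \<phi>]) simp
  qed
next
  assume "\<exists>ks k \<phi>. \<psi> = foldr Forall ks (induction_fm k \<phi>)"
  then obtain ks k \<phi> where "\<psi> = foldr Forall ks (induction_fm k \<phi>)" by blast
  moreover have "is_induction (foldr Forall ks (induction_fm k \<phi>))"
    by (induction ks) (auto intro: is_induction.intros)
  ultimately show "is_induction \<psi>" by simp
qed

lemma PA_iff: "\<phi> \<in> PA \<longleftrightarrow> \<phi> \<in> set PA_basic \<or> sentence \<phi> \<and> is_induction \<phi>"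
  unfolding is_induction_iff
proof
  show "\<phi> \<in> PA \<Longrightarrow> \<phi> \<in> set PA_basic \<or> sentence \<phi> \<and> (\<exists>ks k \<psi>. \<phi> = foldr Forall ks (induction_fm k \<psi>))"
    by (erule PA.cases) (unfold PA_basic_def list.set insert_iff, blast+)
next
  assume "\<phi> \<in> set PA_basic \<or> sentence \<phi> \<and> (\<exists>ks k \<psi>. \<phi> = foldr Forall ks (induction_fm k \<psi>))"
  then show "\<phi> \<in> PA"
    unfolding PA_basic_def list.set insert_iff
    by (elim disjE exE conjE) (simp_all only: PA.intros empty_iff)
qed

lemma sentence_PA: "\<phi> \<in> PA \<Longrightarrow> sentence \<phi>"
  unfolding PA_iff by (auto simp: PA_basic_def Exists_def sentence_def)

section \<open>Arithmetized recognition of the axioms of PA\<close>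

definition is_induction_code_fm :: "nat \<Rightarrow> tm \<Rightarrow> fm" where
  "is_induction_code_fm d = gen d (\<lambda>d x prev.
       ex d (\<lambda>d k. ex d (\<lambda>d p. ex d (\<lambda>d q. ex d (\<lambda>d r.
         subst_fm d k Zero p q \<^bold>\<and> subst_fm d k (succ_code (var_code k)) p r \<^bold>\<and>
         imp_code d p r (\<lambda>d pr. all_code d k pr (\<lambda>d apr. all_code d k p (\<lambda>d ap.
         imp_code d apr ap (\<lambda>d z. imp_code d q z (\<lambda>d z. x \<^bold>= z)))))))))
     \<^bold>\<or> ex d (\<lambda>d k. ex d (\<lambda>d p. prev d p \<^bold>\<and> all_code d k p (\<lambda>d z. x \<^bold>= z))))"

lemma SF_is_induction_code_fm [SF_intros]: "0 < n \<Longrightarrow> SF n (is_induction_code_fm d x)"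
  unfolding is_induction_code_fm_def by (rule SF_gen) (auto intro!: SF_intros)

lemma td_Succ_Var: "td (4 * (4 * k + 1) + 2) = Succ (Var k)"
  using td_tcode[of "Succ (Var k)"] by simp

lemma sat_is_induction_code_fm [simp]:
  assumes "ub x \<le> d"
  shows "sat e (is_induction_code_fm d x) \<longleftrightarrow> is_induction (fd (val e x))"
  unfolding is_induction_code_fm_def
proof (rule sat_gen[where \<mu> = "\<lambda>x. fsize (fd x)" and Q = "\<lambda>x. is_induction (fd x)" and P = "\<lambda>x S.
      (\<exists>k p. x = fcode (induction_fm k (fd p))) \<or> (\<exists>k p. p \<in> S \<and> x = fcode (Forall k (fd p)))"], goal_cases)
  case 1
  show ?case unfolding rule_sem_def
  proof (intro allI impI, goal_cases)
    case (1 d' e' y prev S)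
    \<comment> \<open>\<open>subst_fm\<close> also asserts that the term is free for the variable;
      for \<open>Zero\<close> and for the successor of the variable itself this holds
      automatically.\<close>
    then show ?case
      by (simp add: td_Succ_Var[simplified] free_for_Zero free_for_same induction_fm_def)
  qed
next
  case (3 y S S')
  then show ?case by blast
next
  case (4 y S)
  then show ?case by (elim disjE exE conjE) (simp_all only: fd_fcode, auto intro: is_induction.intros)
next
  case (5 y)
  then obtain \<phi> where y: "y = fcode \<phi>" and "is_induction \<phi>" by (metis fcode_fd)
  from this(2) show ?case
  proof cases
    case (1 k \<psi>)
    show ?thesis
      by (intro exI[of _ "{}"] conjI disjI1 exI[of _ k] exI[of _ "fcode \<psi>"]) (simp_all add: y 1)
  next
    case (2 \<psi> k)
    show ?thesis
      by (intro exI[of _ "{fcode \<psi>}"] conjI disjI2 exI[of _ k] exI[of _ "fcode \<psi>"])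
        (simp_all add: y 2 del: fcode.simps)
  qed
qed (use assms in auto)

definition PA_fm :: "nat \<Rightarrow> tm \<Rightarrow> fm" where
  "PA_fm d x = foldr (\<lambda>\<phi> \<psi>. x \<^bold>= numeral_tm (fcode \<phi>) \<^bold>\<or> \<psi>) PA_basic
     (sentence_fm d x \<^bold>\<and> is_induction_code_fm d x)"

lemma SF_PA_fm [SF_intros]:
  assumes "0 < n" "ub x \<le> d"
  shows "SF n (PA_fm d x)"
proof -
  have "SF n (foldr (\<lambda>\<phi> \<psi>. x \<^bold>= numeral_tm (fcode \<phi>) \<^bold>\<or> \<psi>) \<phi>s
     (sentence_fm d x \<^bold>\<and> is_induction_code_fm d x))" for \<phi>s
    using assms by (induction \<phi>s) (auto intro!: SF_intros)
  then show ?thesis unfolding PA_fm_def .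
qed

lemma sat_PA_fm [simp]:
  assumes "ub x \<le> d"
  shows "sat e (PA_fm d x) \<longleftrightarrow> fd (val e x) \<in> PA"
proof -
  have eq: "val e x = fcode \<phi> \<longleftrightarrow> fd (val e x) = \<phi>" for \<phi> by auto
  have "sat e (foldr (\<lambda>\<phi> \<psi>. x \<^bold>= numeral_tm (fcode \<phi>) \<^bold>\<or> \<psi>) \<phi>s
      (sentence_fm d x \<^bold>\<and> is_induction_code_fm d x)) \<longleftrightarrow>
      fd (val e x) \<in> set \<phi>s \<or> sentence (fd (val e x)) \<and> is_induction (fd (val e x))" for \<phi>s
    using assms by (induction \<phi>s) (auto simp: eq)
  then show ?thesis unfolding PA_fm_def PA_iff .
qed

text \<open>\<open>ConjAx_fm\<close> is not reused here: it only admits axiom sets without parameters, whereas \<open>m\<close> has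
  to be a variable.\<close>

definition ConjPA_fm :: "nat \<Rightarrow> tm \<Rightarrow> tm \<Rightarrow> fm" where
  "ConjPA_fm d m = gen d (\<lambda>d x prev. PA_fm d x \<^bold>\<or> x \<^bold>= m
     \<^bold>\<or> ex d (\<lambda>d p. ex d (\<lambda>d q. prev d p \<^bold>\<and> prev d q \<^bold>\<and> and_code d p q (\<lambda>d z. x \<^bold>= z))))"

lemma SF_ConjPA_fm [SF_intros]: "0 < n \<Longrightarrow> SF n (ConjPA_fm d m s)"
  unfolding ConjPA_fm_def by (rule SF_gen) (auto intro!: SF_intros)

lemma sat_ConjPA_fm [simp]:
  assumes "ub m \<le> d" "ub s \<le> d"
  shows "sat e (ConjPA_fm d m s) \<longleftrightarrow> conjunction_of (insert (fd (val e m)) PA) (fd (val e s))"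
  unfolding ConjPA_fm_def
proof (rule sat_gen[where \<mu> = "\<lambda>y. fsize (fd y)" and Q = "\<lambda>y. conjunction_of (insert (fd (val e m)) PA) (fd y)" and
    P = "\<lambda>y S. fd y \<in> insert (fd (val e m)) PA \<or>
      (\<exists>p q. p \<in> S \<and> q \<in> S \<and> y = fcode (fd p \<^bold>\<and> fd q))"], goal_cases)
  case 1
  show ?case
    unfolding rule_sem_def
  proof (intro allI impI, goal_cases)
    case (1 d' e' y prev S)
    have "val e' m = val e m" using 1(2) assms by (auto intro!: val_cong)
    moreover have "fd a = fd b \<longleftrightarrow> a = b" for a b by (metis fcode_fd)
    ultimately show ?case using 1 assms by (auto simp: neg_code_def and_code_def And_def)
  qed
next
  case (3 y S S')
  then show ?case by blast
next
  case (4 y S)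
  then show ?case
    by (elim disjE exE conjE) (simp_all only: fd_fcode, auto intro: conjunction_of.intros)
next
  case (5 y)
  then obtain \<phi> where y: "y = fcode \<phi>" and "conjunction_of (insert (fd (val e m)) PA) \<phi>"
    by (metis fcode_fd)
  from this(2) show ?case
  proof cases
    case 1
    then show ?thesis by (intro exI[of _ "{}"]) (simp add: y)
  next
    case (2 \<psi> \<chi>)
    show ?thesis
    proof (intro exI[of _ "{fcode \<psi>, fcode \<chi>}"] conjI, goal_cases)
      case 2
      show ?case
        by (intro disjI2 exI[of _ "fcode \<psi>"] exI[of _ "fcode \<chi>"]) (simp add: y \<open>\<phi> = _\<close>)
    qed (simp_all add: y 2, simp add: And_def)
  qed
qed (use assms in auto)

text \<open>By \<open>Sound_fm_correct\<close>, the negation of what the soundness sentence says in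
  \<nat>. The existential form is kept because its arithmetization is Sigma_(n+1).\<close>

definition Pi_inconsistent :: "nat \<Rightarrow> fm set \<Rightarrow> bool" where
  "Pi_inconsistent n T \<longleftrightarrow> (\<exists>\<phi> \<psi>. conjunction_of T \<phi> \<and> is_Pi n \<psi> \<and> sentence \<psi> \<and> (\<nat> \<Turnstile> \<psi>) \<and>
     {} \<turnstile> (\<^bold>\<not> (\<phi> \<^bold>\<and> \<psi>)))"

text \<open>By soundness of the calculus, true axioms together with a true \<psi> cannot be refuted.
  Applied both to PA and to PA with the new sentence.\<close>

lemma Pi_inconsistent_false:
  assumes "Pi_inconsistent n T"
  shows "\<exists>\<phi>\<in>T. \<not> (\<nat> \<Turnstile> \<phi>)"
proof (rule ccontr)
  assume "\<not> ?thesis"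
  then have T: "\<forall>\<phi>\<in>T. \<nat> \<Turnstile> \<phi>" by blast
  have conj: "conjunction_of T \<phi> \<Longrightarrow> \<nat> \<Turnstile> \<phi>" for \<phi>
    by (induction rule: conjunction_of.induct) (use T in \<open>auto simp: true_in_N_def\<close>)
  from assms obtain \<phi> \<psi> where "conjunction_of T \<phi>" "\<nat> \<Turnstile> \<psi>" "{} \<turnstile> (\<^bold>\<not> (\<phi> \<^bold>\<and> \<psi>))"
    unfolding Pi_inconsistent_def by blast
  then show False using conj proves_sound[of "{}" "\<^bold>\<not> (\<phi> \<^bold>\<and> \<psi>)"] by (auto simp: true_in_N_def)
qed

text \<open>\<open>m\<close> stands for the code of the sentence added to PA; the self-referential
  formula passes its own variable 0 here.\<close>

definition Pi_inconsistent_fm :: "nat \<Rightarrow> nat \<Rightarrow> tm \<Rightarrow> fm" where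
  "Pi_inconsistent_fm n d m = ex d (\<lambda>d s. ex d (\<lambda>d t. ex d (\<lambda>d u.
     ConjPA_fm d m s \<^bold>\<and> Pi_True_fm n d t \<^bold>\<and>
     and_code d s t (\<lambda>d z. neg_code d z (\<lambda>d z. Proof_fm d u z)))))"

lemma SF_Pi_inconsistent_fm: "SF (Suc n) (Pi_inconsistent_fm n d m)"
  unfolding Pi_inconsistent_fm_def by (intro SF_intros SF_truth_fm) auto

lemma ex_codes_proof:
  "(\<exists>u ps. codes_proof u ps \<and> is_proof {} ps \<and> fcode (last ps) = fcode \<phi>) \<longleftrightarrow> {} \<turnstile> \<phi>"
proof -
  have "ps \<noteq> []" if "codes_proof u ps" for u ps
    using that by (auto simp: codes_proof_def)
  then show ?thesis
    unfolding proves_def using codes_proof_exists by (metis fcode_inj)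
qed

lemma sat_Pi_inconsistent_fm [simp]:
  assumes "ub m \<le> d"
  shows "sat e (Pi_inconsistent_fm n d m) \<longleftrightarrow> Pi_inconsistent n (insert (fd (val e m)) PA)"
proof -
  have code: "fcode (\<phi> \<^bold>\<and> \<psi>) = 4 * prod_encode (4 * prod_encode (fcode \<phi>,
      4 * prod_encode (fcode \<psi>, 0) + 3) + 3, 0) + 3" for \<phi> \<psi>
    by (simp add: And_def)
  have "sat e (Pi_inconsistent_fm n d m) \<longleftrightarrow> (\<exists>s t. conjunction_of (insert (fd (val e m)) PA) (fd s) \<and>
      is_Pi n (fd t) \<and> sentence (fd t) \<and> (\<nat> \<Turnstile> fd t) \<and>
      (\<exists>u ps. codes_proof u ps \<and> is_proof {} ps \<and> fcode (last ps) = fcode (\<^bold>\<not> (fd s \<^bold>\<and> fd t))))"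
    using assms by (simp add: Pi_inconsistent_fm_def Pi_True_fm_correct[where \<phi> = "fd _"]
        and_code_def neg_code_def Proof_fm_correct code)
  then show ?thesis
    unfolding ex_codes_proof Pi_inconsistent_def by (metis fd_fcode)
qed

section \<open>Formula contexts\<close>

text \<open>Operations that copy their argument unchanged into fixed places of a fixed formula. The
  code of the result is then obtained from the code of the argument by pairing alone.\<close>

inductive is_context :: "(fm \<Rightarrow> fm) \<Rightarrow> bool" where
  is_context_const: "is_context (\<lambda>\<sigma>. \<phi>)"
| is_context_id: "is_context (\<lambda>\<sigma>. \<sigma>)"
| is_context_Imp: "is_context F \<Longrightarrow> is_context G \<Longrightarrow> is_context (\<lambda>\<sigma>. F \<sigma> \<^bold>\<rightarrow> G \<sigma>)"
| is_context_Forall: "is_context F \<Longrightarrow> is_context (\<lambda>\<sigma>. Forall k (F \<sigma>))"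

lemma is_context_foldr_Forall: "is_context F \<Longrightarrow> is_context (\<lambda>\<sigma>. foldr Forall ks (F \<sigma>))"
  by (induction ks) (auto intro: is_context.intros)

text \<open>\<sigma> enters only through \<open>holds_at\<close>, which quantifies over variable 0
  instead of substituting into \<sigma>. Everything off the path to that place is constant and stays
  folded.\<close>

lemma is_context_Sound_fm: "is_context (Sound_fm n)"
proof -
  have "is_context (\<lambda>\<sigma>. Sound_fm n \<sigma>)"
    unfolding Sound_fm_def ConjAx_fm_def gen_def derivation_def holds_at_def ex_def allb_def
      And_def Or_def Exists_def
    by (intro is_context.intros)
  then show ?thesis .
qed

lemma fv_context: "is_context F \<Longrightarrow> fv (F \<sigma>) \<subseteq> fv (F Bot) \<union> fv \<sigma>"
  by (induction rule: is_context.induct) auto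

text \<open>\<open>C\<close> is a Sigma_1 graph, on Goedel numbers, of the operation
  \<open>F\<close>; a graph is used because the language has no symbol for this function.\<close>

definition code_graph :: "(fm \<Rightarrow> fm) \<Rightarrow> (nat \<Rightarrow> tm \<Rightarrow> tm \<Rightarrow> fm) \<Rightarrow> bool" where
  "code_graph F C \<longleftrightarrow> (\<forall>n d x y. 0 < n \<longrightarrow> SF n (C d x y)) \<and>
    (\<forall>d x y e. ub x \<le> d \<longrightarrow> ub y \<le> d \<longrightarrow> sat e (C d x y) \<longleftrightarrow> val e y = fcode (F (fd (val e x))))"

lemma code_graphD:
  assumes "code_graph F C"
  shows "0 < n \<Longrightarrow> SF n (C d x y)"
    "ub x \<le> d \<Longrightarrow> ub y \<le> d \<Longrightarrow> sat e (C d x y) \<longleftrightarrow> val e y = fcode (F (fd (val e x)))"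
  using assms unfolding code_graph_def by blast+

lemma context_code_graph: "is_context F \<Longrightarrow> \<exists>C. code_graph F C"
proof (induction rule: is_context.induct)
  case (is_context_const \<phi>)
  have "code_graph (\<lambda>\<sigma>. \<phi>) (\<lambda>d x y. y \<^bold>= numeral_tm (fcode \<phi>))"
    unfolding code_graph_def by (auto intro: SF_intros)
  then show ?case by (intro exI)
next
  case is_context_id
  have "code_graph (\<lambda>\<sigma>. \<sigma>) (\<lambda>d x y. y \<^bold>= x)"
    unfolding code_graph_def by (auto intro: SF_intros)
  then show ?case by (intro exI)
next
  case (is_context_Imp F G)
  then obtain C D where "code_graph F C" "code_graph G D" by blast
  note C = code_graphD[OF this(1)] and D = code_graphD[OF this(2)]
  have "code_graph (\<lambda>\<sigma>. F \<sigma> \<^bold>\<rightarrow> G \<sigma>) (\<lambda>d x y. ex d (\<lambda>d u. ex d (\<lambda>d v.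
        C d x u \<^bold>\<and> D d x v \<^bold>\<and> imp_code d u v (\<lambda>d z. y \<^bold>= z))))"
    unfolding code_graph_def
  proof (intro conjI allI impI, goal_cases)
    case 1
    then show ?case by (intro SF_intros C(1) D(1))
  next
    case 2
    then show ?case by (simp add: C(2) D(2))
  qed
  then show ?case by (intro exI)
next
  case (is_context_Forall F k)
  then obtain C where "code_graph F C" by blast
  note C = code_graphD[OF this]
  have "code_graph (\<lambda>\<sigma>. Forall k (F \<sigma>)) (\<lambda>d x y. ex d (\<lambda>d u.
        C d x u \<^bold>\<and> all_code d (numeral_tm k) u (\<lambda>d z. y \<^bold>= z)))"
    unfolding code_graph_def
  proof (intro conjI allI impI, goal_cases)
    case 1
    then show ?case by (intro SF_intros C(1))
  next
    case 2
    then show ?case by (simp add: C(2))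
  qed
  then show ?case by (intro exI)
qed

section \<open>The self-referential axiom\<close>

text \<open>\<open>SF\<close> yields an equivalent formula without control over its free variables.
  Those on which truth does not depend are instantiated with \<open>Zero\<close>, which preserves
  the level by \<open>hierarchy_subst\<close>.\<close>

lemma is_Sigma_remove_vars:
  assumes "finite A" "is_Sigma n \<phi>" "\<And>k e m. k \<in> A \<Longrightarrow> sat (e(k := m)) \<phi> \<longleftrightarrow> sat e \<phi>"
  shows "\<exists>\<psi>. is_Sigma n \<psi> \<and> (\<forall>e. sat e \<psi> \<longleftrightarrow> sat e \<phi>) \<and> fv \<psi> \<subseteq> fv \<phi> - A"
  using assms(1,3)
proof (induction A rule: finite_induct)
  case empty
  show ?case using assms(2) by auto
next
  case (insert k A)
  then obtain \<psi> where \<psi>: "is_Sigma n \<psi>" "\<forall>e. sat e \<psi> \<longleftrightarrow> sat e \<phi>" "fv \<psi> \<subseteq> fv \<phi> - A" by auto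
  have "is_Sigma n (subst k Zero \<psi>)" using \<psi>(1) by (simp add: hierarchy_subst)
  moreover have "sat e (subst k Zero \<psi>) \<longleftrightarrow> sat e \<phi>" for e
    using \<psi>(2) insert.prems[of k e 0] by (simp add: sat_subst del: fun_upd_apply)
  moreover have "fv (subst k Zero \<psi>) \<subseteq> fv \<phi> - insert k A" using \<psi>(3) by (auto simp: fv_subst)
  ultimately show ?case by blast
qed

text \<open>The diagonal construction: \<rho> has an extra variable 1 for a code c and refers to
  \<open>G (D c)\<close>; \<sigma> is \<open>D\<close> applied to the code of \<rho>, so that the
  reference hits \<sigma> itself.\<close>

lemma self_reference:
  assumes G: "is_context G"
  shows "\<exists>\<sigma>. is_Sigma (Suc (Suc n)) \<sigma> \<and> fv \<sigma> \<subseteq> {0} \<and>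
    (\<forall>e. sat e \<sigma> \<longleftrightarrow> fd (e 0) \<in> PA \<or> fd (e 0) = G \<sigma> \<and> \<not> Pi_inconsistent n (insert (G \<sigma>) PA))"
proof -
  obtain C where "code_graph G C" using context_code_graph[OF G] by blast
  note C = code_graphD[OF this]
  \<comment> \<open>Here \<open>instance_fm\<close> replaces variable 1, in the formula coded by the
    value of variable 1, by the numeral of that value; this is \<open>D\<close>. Inconsistency may
    be tested at variable 0, because the other conjunct equates it with the code of
    \<open>G (D c)\<close>. Bound variables start at 2, as 0 and 1 are parameters.\<close>
  define R where "R = (PA_fm 2 (Var 0) \<^bold>\<or>
    instance_fm 2 (numeral_tm 1) (Var 1) (Var 1) (\<lambda>d q. C d q (Var 0) \<^bold>\<and> \<^bold>\<not> Pi_inconsistent_fm n d (Var 0)))"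
  define D where "D = (\<lambda>c. subst 1 (numeral_tm c) (fd c))"
  have sat_R: "sat e R \<longleftrightarrow> fd (e 0) \<in> PA \<or>
      e 0 = fcode (G (D (e 1))) \<and> \<not> Pi_inconsistent n (insert (fd (e 0)) PA)" for e
    by (simp add: R_def D_def C(2) eval_nat_numeral)
  \<comment> \<open>Inconsistency has Sigma level n + 1, and its negation costs one more; all other
    parts are Sigma_1.\<close>
  have "SF (Suc (Suc n)) R"
    unfolding R_def by (intro SF_intros SF_neg SF_Pi_inconsistent_fm C(1)) auto
  then obtain \<rho>\<^sub>0 where \<rho>\<^sub>0: "is_Sigma (Suc (Suc n)) \<rho>\<^sub>0" "\<And>e. sat e \<rho>\<^sub>0 \<longleftrightarrow> sat e R"
    unfolding SF_def Sg_def by blast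
  obtain \<rho> where \<rho>: "is_Sigma (Suc (Suc n)) \<rho>" "\<And>e. sat e \<rho> \<longleftrightarrow> sat e R" "fv \<rho> \<subseteq> {0, 1}"
    using is_Sigma_remove_vars[of "fv \<rho>\<^sub>0 - {0, 1}" "Suc (Suc n)" \<rho>\<^sub>0] finite_fv[of \<rho>\<^sub>0] \<rho>\<^sub>0
    by (auto simp: sat_R)
  define \<sigma> where "\<sigma> = D (fcode \<rho>)"
  have "is_Sigma (Suc (Suc n)) \<sigma>" "fv \<sigma> \<subseteq> {0}"
    using \<rho>(1,3) by (auto simp: \<sigma>_def D_def hierarchy_subst fv_subst)
  moreover have "sat e \<sigma> \<longleftrightarrow> fd (e 0) \<in> PA \<or> fd (e 0) = G \<sigma> \<and> \<not> Pi_inconsistent n (insert (G \<sigma>) PA)" for e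
  proof -
    have "sat e \<sigma> \<longleftrightarrow> sat (e(1 := fcode \<rho>)) \<rho>"
      by (simp add: \<sigma>_def D_def sat_subst)
    also have "\<dots> \<longleftrightarrow> fd (e 0) \<in> PA \<or> e 0 = fcode (G \<sigma>) \<and> \<not> Pi_inconsistent n (insert (fd (e 0)) PA)"
      by (simp add: \<rho>(2) sat_R \<sigma>_def)
    also have "e 0 = fcode (G \<sigma>) \<longleftrightarrow> fd (e 0) = G \<sigma>" by (metis fcode_fd fd_fcode)
    finally show ?thesis by auto
  qed
  ultimately show ?thesis by blast
qed

theorem theorem3p5:
  fixes n :: nat
  assumes "n \<ge> 1"
  shows "\<exists>T \<sigma> \<pi>.
      is_theory T \<and> extends T PA
    \<and> is_Sigma (n + 1) \<sigma> \<and> defines_axioms \<sigma> T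
    \<and> is_Pi (n + 1) \<pi> \<and> defines_axioms \<pi> T
    \<and> Sigma_sound (n - 1) T
    \<and> T \<turnstile> Sound_fm (n - 1) \<sigma>"
proof -
  define p where "p = n - 1"
  have n: "n + 1 = Suc (Suc p)" "n - 1 = p" using assms by (auto simp: p_def)
  \<comment> \<open>The prefix of \<open>G\<close> must be fixed before \<sigma> is known. As
    \<sigma> adds at most variable 0 to the free variables of \<open>Sound_fm p Bot\<close>, the
    list \<open>[0..<Suc N]\<close> covers them all; \<open>Suc\<close> ensures that it contains
    0.\<close>
  obtain N where N: "\<forall>k\<in>fv (Sound_fm p Bot). k < N"
    using finite_fv[of "Sound_fm p Bot"] finite_nat_set_iff_bounded by blast
  \<comment> \<open>Closing \<open>Sound_fm p \<sigma>\<close> universally spares the proof that it has no free variables.\<close>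
  define G where "G = (\<lambda>\<sigma>. foldr Forall [0..<Suc N] (Sound_fm p \<sigma>))"
  have G: "is_context G"
    unfolding G_def by (intro is_context_foldr_Forall is_context_Sound_fm)
  obtain \<sigma> where \<sigma>: "is_Sigma (Suc (Suc p)) \<sigma>" "fv \<sigma> \<subseteq> {0}"
    "\<And>e. sat e \<sigma> \<longleftrightarrow> fd (e 0) \<in> PA \<or> fd (e 0) = G \<sigma> \<and> \<not> Pi_inconsistent p (insert (G \<sigma>) PA)"
    using self_reference[OF G] by blast
  define \<theta> where "\<theta> = G \<sigma>"
  have code: "m \<in> fcode ` A \<longleftrightarrow> fd m \<in> A" for m A by (metis fcode_fd fd_fcode imageE imageI)
  \<comment> \<open>The theory is left open: the equivalence is applied to PA in the case refuted by
    \<open>cons\<close>, and to PA with \<theta> once \<sigma> is known to define it.\<close>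
  have \<theta>_true: "(\<nat> \<Turnstile> \<theta>) \<longleftrightarrow> \<not> Pi_inconsistent p T" if "defines_axioms \<sigma> T" for T
    unfolding \<theta>_def G_def foldr_Forall_true Sound_fm_correct[OF that] Pi_inconsistent_def by blast
  define T where "T = insert \<theta> PA"
  have cons: "\<not> Pi_inconsistent p T"
  proof
    assume inc: "Pi_inconsistent p T"
    then have "defines_axioms \<sigma> PA"
      using \<sigma>(2) by (simp add: defines_axioms_def \<sigma>(3) code T_def \<theta>_def)
    from \<theta>_true[OF this] have "\<nat> \<Turnstile> \<theta>" using Pi_inconsistent_false PA_true by blast
    with inc show False using Pi_inconsistent_false[OF inc] PA_true unfolding T_def by blast
  qed
  then have def: "defines_axioms \<sigma> T"
    using \<sigma>(2) unfolding defines_axioms_def \<sigma>(3) code T_def \<theta>_def by auto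
  with cons have T_true: "\<forall>\<phi>\<in>T. \<nat> \<Turnstile> \<phi>"
    using \<theta>_true PA_true unfolding T_def by blast
  have "fv (Sound_fm p \<sigma>) \<subseteq> {0..<Suc N}"
    using fv_context[OF is_context_Sound_fm, of p \<sigma>] N \<sigma>(2) by fastforce
  then have "sentence \<theta>"
    unfolding \<theta>_def G_def sentence_def fv_foldr_Forall set_upt by blast
  then have "is_theory T"
    using sentence_PA by (simp add: is_theory_def T_def)
  moreover have "extends T PA"
    by (rule extends_supset) (auto simp: T_def)
  moreover have "Sigma_sound p T"
    unfolding Sigma_sound_def using proves_sound T_true by blast
  moreover have "T \<turnstile> Sound_fm p \<sigma>"
    by (rule proves_foldr_Forall[of T "[0..<Suc N]"], rule proves_intro)
      (simp add: T_def \<theta>_def G_def del: upt_Suc)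
  moreover obtain \<pi> where "is_Pi (Suc (Suc p)) \<pi>" "defines_axioms \<pi> T"
  proof -
    \<comment> \<open>Now that the theory is PA plus one fixed sentence, naming the code of \<theta>
      by a numeral gives a Sigma_1 definition without self-reference, and Sigma_1 lies inside
      Pi_2.\<close>
    have "SF 1 (PA_fm 1 (Var 0) \<^bold>\<or> Var 0 \<^bold>= numeral_tm (fcode \<theta>))" by (intro SF_intros) auto
    then obtain \<pi>\<^sub>0 where *: "is_Sigma 1 \<pi>\<^sub>0"
      "\<forall>e. sat e \<pi>\<^sub>0 \<longleftrightarrow> sat e (PA_fm 1 (Var 0) \<^bold>\<or> Var 0 \<^bold>= numeral_tm (fcode \<theta>))"
      unfolding SF_def Sg_def by blast
    have "m = fcode \<theta> \<longleftrightarrow> fd m = \<theta>" for m by (metis fcode_fd fd_fcode)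
    with * have \<pi>\<^sub>0: "is_Sigma 1 \<pi>\<^sub>0" "\<And>e. sat e \<pi>\<^sub>0 \<longleftrightarrow> fd (e 0) \<in> T"
      by (auto simp: T_def)
    obtain \<pi> where \<pi>: "is_Sigma 1 \<pi>" "\<And>e. sat e \<pi> \<longleftrightarrow> fd (e 0) \<in> T" "fv \<pi> \<subseteq> {0}"
      using is_Sigma_remove_vars[of "fv \<pi>\<^sub>0 - {0}" 1 \<pi>\<^sub>0] finite_fv[of \<pi>\<^sub>0] \<pi>\<^sub>0 by auto
    have "is_Pi (Suc 1) \<pi>" using \<pi>(1) by (rule is_Sigma_is_Pi.intros)
    then have "is_Pi (Suc (Suc p)) \<pi>" by (rule hierarchy_mono(2)[rotated]) simp
    moreover have "defines_axioms \<pi> T" using \<pi>(2,3) by (simp add: defines_axioms_def code)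
    ultimately show thesis by (rule that)
  qed
  ultimately show ?thesis using \<sigma>(1) def unfolding n by blast
qed

end
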